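(* Let $k$ be a commutative ring, $G$ a group, $\mathcal{B}$ a $G$-graded category over $k$ and $\mathcal{C}=\mathcal{B}\# G$ its Galois covering given by the smash product category. Then the category $\mathcal{B}\text{-}\mathsf{Mod}_G$ of graded $\mathcal{B}$-modules and the category $\mathcal{C}\text{-}\mathsf{Mod}$ of $\mathcal{C}$-modules are isomorphic categories.
   Context: Category over $k$: a small category with object set $\mathcal{B}_0$ such that each morphism set ${}_y\mathcal{B}_x$ (morphisms from $x$ to $y$) is a $k$-module and composition is $k$-bilinear. $G$-graded category over $k$: a category $\mathcal{B}$ over $k$ with decompositions ${}_y\mathcal{B}_x=\bigoplus_{s\in G}{}_y\mathcal{B}_x^{\,s}$ such that ${}_z\mathcal{B}_y^{\,t}\;{}_y\mathcal{B}_x^{\,s}\subset{}_z\mathcal{B}_x^{\,ts}$ and ${}_x1_x\in{}_x\mathcal{B}_x^{\,1}$. Smash product category $\mathcal{B}\# G$: objects $\mathcal{B}_0\times G$, morphisms ${}_{(y,t)}(\mathcal{B}\# G)_{(x,s)}={}_y\mathcal{B}_x^{\,t^{-1}s}$, composition given by the composition ${}_z\mathcal{B}_y^{\,u^{-1}t}\otimes_k{}_y\mathcal{B}_x^{\,t^{-1}s}\to{}_z\mathcal{B}_x^{\,u^{-1}s}$ of $\mathcal{B}$. A left $\mathcal{C}$-module $\mathcal{M}$ is a $k$-linear covariant functor from $\mathcal{C}$ to $k$-modules: a collection of $k$-modules $\{{}_x\mathcal{M}\}_{x\in\mathcal{C}_0}$ with $k$-module maps ${}_y\mathcal{C}_x\otimes_k{}_x\mathcal{M}\to{}_y\mathcal{M}$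 satisfying associativity and unit axioms. $\mathcal{C}\text{-}\mathsf{Mod}$ is the category of left $\mathcal{C}$-modules, with natural transformations as morphisms. A graded $\mathcal{B}$-module is a $\mathcal{B}$-module $\mathcal{N}$ with direct sum decompositions ${}_x\mathcal{N}=\bigoplus_{s\in G}{}_x\mathcal{N}^s$ such that ${}_y\mathcal{B}_x^{\,t}\;{}_x\mathcal{N}^s\subset{}_y\mathcal{N}^{ts}$. Morphisms of graded $\mathcal{B}$-modules are the module morphisms preserving degrees. *)

theory Defs
  imports "HOL-Algebra.Algebra" "HOL-Library.Equipollence"
begin

section \<open>Categories, functors, isomorphism of categories\<close>

text \<open>\<open>arr A x y\<close> is the set of arrows from \<open>x\<close> to \<open>y\<close>; sets of arrows for different pairs of objects
  need not be disjoint, so identities and composition carry their objects as arguments: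
  \<open>cmp A x y z g f\<close> is \<open>g\<close> after \<open>f\<close> for \<open>f : x \<rightarrow> y\<close> and \<open>g : y \<rightarrow> z\<close>.\<close>

record ('ob, 'ar) cat =
  obj :: "'ob set"
  arr :: "'ob \<Rightarrow> 'ob \<Rightarrow> 'ar set"
  idt :: "'ob \<Rightarrow> 'ar"
  cmp :: "'ob \<Rightarrow> 'ob \<Rightarrow> 'ob \<Rightarrow> 'ar \<Rightarrow> 'ar \<Rightarrow> 'ar"

definition category :: "('ob, 'ar) cat \<Rightarrow> bool" where
  "category A \<longleftrightarrow>
     (\<forall>x \<in> obj A. idt A x \<in> arr A x x) \<and>
     (\<forall>x \<in> obj A. \<forall>y \<in> obj A. \<forall>z \<in> obj A. \<forall>f \<in> arr A x y. \<forall>g \<in> arr A y z.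
        cmp A x y z g f \<in> arr A x z) \<and>
     (\<forall>x \<in> obj A. \<forall>y \<in> obj A. \<forall>f \<in> arr A x y.
        cmp A x x y f (idt A x) = f \<and> cmp A x y y (idt A y) f = f) \<and>
     (\<forall>w \<in> obj A. \<forall>x \<in> obj A. \<forall>y \<in> obj A. \<forall>z \<in> obj A.
        \<forall>f \<in> arr A w x. \<forall>g \<in> arr A x y. \<forall>h \<in> arr A y z.
        cmp A w y z h (cmp A w x y g f) = cmp A w x z (cmp A x y z h g) f)"

text \<open>A functor is given by its object part \<open>Fo\<close> and its arrow part \<open>Fa\<close>, the latter indexed by
  source and target.\<close>

definition is_functor ::
  "('o1, 'a1) cat \<Rightarrow> ('o2, 'a2) cat \<Rightarrow> ('o1 \<Rightarrow> 'o2) \<Rightarrow> ('o1 \<Rightarrow> 'o1 \<Rightarrow> 'a1 \<Rightarrow> 'a2) \<Rightarrow> bool" where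
  "is_functor A B Fo Fa \<longleftrightarrow>
     Fo \<in> obj A \<rightarrow> obj B \<and>
     (\<forall>x \<in> obj A. \<forall>y \<in> obj A. Fa x y \<in> arr A x y \<rightarrow> arr B (Fo x) (Fo y)) \<and>
     (\<forall>x \<in> obj A. Fa x x (idt A x) = idt B (Fo x)) \<and>
     (\<forall>x \<in> obj A. \<forall>y \<in> obj A. \<forall>z \<in> obj A. \<forall>f \<in> arr A x y. \<forall>g \<in> arr A y z.
        Fa x z (cmp A x y z g f) = cmp B (Fo x) (Fo y) (Fo z) (Fa y z g) (Fa x y f))"

text \<open>Isomorphism, not equivalence: the two composites are equal to the identity functors.\<close>

definition isomorphic_categories :: "('o1, 'a1) cat \<Rightarrow> ('o2, 'a2) cat \<Rightarrow> bool" where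
  "isomorphic_categories A B \<longleftrightarrow> category A \<and> category B \<and>
     (\<exists>Fo Fa Go Ga. is_functor A B Fo Fa \<and> is_functor B A Go Ga \<and>
        (\<forall>x \<in> obj A. Go (Fo x) = x) \<and>
        (\<forall>x \<in> obj A. \<forall>y \<in> obj A. \<forall>f \<in> arr A x y. Ga (Fo x) (Fo y) (Fa x y f) = f) \<and>
        (\<forall>u \<in> obj B. Fo (Go u) = u) \<and>
        (\<forall>u \<in> obj B. \<forall>v \<in> obj B. \<forall>g \<in> arr B u v. Fa (Go u) (Go v) (Ga u v g) = g))"

section \<open>Linear algebra over a commutative ring\<close>

definition linear_map ::
  "('k, 'r) ring_scheme \<Rightarrow> ('k, 'a) module \<Rightarrow> ('k, 'b) module \<Rightarrow> ('a \<Rightarrow> 'b) \<Rightarrow> bool" where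
  "linear_map k M N f \<longleftrightarrow>
     f \<in> carrier M \<rightarrow> carrier N \<and>
     (\<forall>v \<in> carrier M. \<forall>w \<in> carrier M. f (v \<oplus>\<^bsub>M\<^esub> w) = f v \<oplus>\<^bsub>N\<^esub> f w) \<and>
     (\<forall>a \<in> carrier k. \<forall>v \<in> carrier M. f (a \<odot>\<^bsub>M\<^esub> v) = a \<odot>\<^bsub>N\<^esub> f v)"

definition bilinear_map ::
  "('k, 'r) ring_scheme \<Rightarrow> ('k, 'a) module \<Rightarrow> ('k, 'b) module \<Rightarrow> ('k, 'c) module
     \<Rightarrow> ('a \<Rightarrow> 'b \<Rightarrow> 'c) \<Rightarrow> bool" where
  "bilinear_map k M N P f \<longleftrightarrow>
     (\<forall>v \<in> carrier M. linear_map k N P (f v)) \<and>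
     (\<forall>w \<in> carrier N. linear_map k M P (\<lambda>v. f v w))"

text \<open>\<open>M\<close> is the internal direct sum of the submodules \<open>D s\<close>, \<open>s \<in> I\<close>: every element is in a
  unique way a finite sum of elements of the \<open>D s\<close>.\<close>

definition internal_direct_sum ::
  "('k, 'r) ring_scheme \<Rightarrow> ('k, 'a) module \<Rightarrow> 'i set \<Rightarrow> ('i \<Rightarrow> 'a set) \<Rightarrow> bool" where
  "internal_direct_sum k M I D \<longleftrightarrow>
     (\<forall>s \<in> I. submodule (D s) k M) \<and>
     (\<forall>v \<in> carrier M. \<exists>!f. f \<in> (\<Pi>\<^sub>E s \<in> I. D s) \<and> finite {s \<in> I. f s \<noteq> \<zero>\<^bsub>M\<^esub>} \<and>
        v = finsum M f {s \<in> I. f s \<noteq> \<zero>\<^bsub>M\<^esub>})"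

section \<open>Categories over \<open>k\<close>, gradings, smash product\<close>

text \<open>Indices are written from target to source: \<open>mor B y x\<close> is the \<open>k\<close>-module of morphisms from
  \<open>x\<close> to \<open>y\<close>, and \<open>mcomp B z y x g f\<close> is \<open>g f\<close> for \<open>f\<close> in \<open>mor B y x\<close> and \<open>g\<close> in \<open>mor B z y\<close>.\<close>

record ('o, 'k, 'b) kcat =
  objs :: "'o set"
  mor :: "'o \<Rightarrow> 'o \<Rightarrow> ('k, 'b) module"
  mcomp :: "'o \<Rightarrow> 'o \<Rightarrow> 'o \<Rightarrow> 'b \<Rightarrow> 'b \<Rightarrow> 'b"
  ident :: "'o \<Rightarrow> 'b"

definition underlying_cat :: "('o, 'k, 'b, 'z) kcat_scheme \<Rightarrow> ('o, 'b) cat" where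
  "underlying_cat B = \<lparr>obj = objs B, arr = (\<lambda>x y. carrier (mor B y x)), idt = ident B,
     cmp = (\<lambda>x y z. mcomp B z y x)\<rparr>"

definition category_over ::
  "('k, 'r) ring_scheme \<Rightarrow> ('o, 'k, 'b, 'z) kcat_scheme \<Rightarrow> bool" where
  "category_over k B \<longleftrightarrow>
     category (underlying_cat B) \<and>
     (\<forall>x \<in> objs B. \<forall>y \<in> objs B. module k (mor B y x)) \<and>
     (\<forall>x \<in> objs B. \<forall>y \<in> objs B. \<forall>z \<in> objs B.
        bilinear_map k (mor B z y) (mor B y x) (mor B z x) (mcomp B z y x))"

text \<open>\<open>homog B y x s\<close> is the degree \<open>s\<close> component of \<open>mor B y x\<close>.\<close>

record ('o, 'g, 'k, 'b) graded_kcat = "('o, 'k, 'b) kcat" +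
  homog :: "'o \<Rightarrow> 'o \<Rightarrow> 'g \<Rightarrow> 'b set"

definition graded_category_over ::
  "('k, 'r) ring_scheme \<Rightarrow> ('g, 'h) monoid_scheme \<Rightarrow> ('o, 'g, 'k, 'b) graded_kcat \<Rightarrow> bool" where
  "graded_category_over k G B \<longleftrightarrow>
     category_over k B \<and>
     (\<forall>x \<in> objs B. \<forall>y \<in> objs B. internal_direct_sum k (mor B y x) (carrier G) (homog B y x)) \<and>
     (\<forall>x \<in> objs B. \<forall>y \<in> objs B. \<forall>z \<in> objs B. \<forall>s \<in> carrier G. \<forall>t \<in> carrier G.
        \<forall>g \<in> homog B z y t. \<forall>f \<in> homog B y x s. mcomp B z y x g f \<in> homog B z x (t \<otimes>\<^bsub>G\<^esub> s)) \<and>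
     (\<forall>x \<in> objs B. ident B x \<in> homog B x x \<one>\<^bsub>G\<^esub>)"

definition smash_product ::
  "('g, 'h) monoid_scheme \<Rightarrow> ('o, 'g, 'k, 'b) graded_kcat \<Rightarrow> ('o \<times> 'g, 'k, 'b) kcat" where
  "smash_product G B =
     \<lparr>objs = objs B \<times> carrier G,
      mor = (\<lambda>(y, t) (x, s). (mor B y x)\<lparr>carrier := homog B y x (inv\<^bsub>G\<^esub> t \<otimes>\<^bsub>G\<^esub> s)\<rparr>),
      mcomp = (\<lambda>(z, u) (y, t) (x, s). mcomp B z y x),
      ident = (\<lambda>(x, s). ident B x)\<rparr>"

text \<open>A check on the conventions: the smash product is again a category over \<open>k\<close>.\<close>

lemma category_over_smash_product:
  assumes "group G" and B: "graded_category_over k G B"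
  shows "category_over k (smash_product G B)"
proof -
  interpret G: group G by fact
  let ?h = "\<lambda>y t x s. homog B y x (inv\<^bsub>G\<^esub> t \<otimes>\<^bsub>G\<^esub> s)"
  have C: "category (underlying_cat B)"
    and m: "\<And>x y. \<lbrakk>x \<in> objs B; y \<in> objs B\<rbrakk> \<Longrightarrow> module k (mor B y x)"
    and bil: "\<And>x y z. \<lbrakk>x \<in> objs B; y \<in> objs B; z \<in> objs B\<rbrakk> \<Longrightarrow>
        bilinear_map k (mor B z y) (mor B y x) (mor B z x) (mcomp B z y x)"
    and one: "\<And>x. x \<in> objs B \<Longrightarrow> ident B x \<in> homog B x x \<one>\<^bsub>G\<^esub>"
    using B unfolding graded_category_over_def category_over_def by blast+
  have unit: "mcomp B y x x f (ident B x) = f" "mcomp B y y x (ident B y) f = f"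
    if "x \<in> objs B" "y \<in> objs B" "f \<in> carrier (mor B y x)" for x y f
    using C that by (simp_all add: category_def underlying_cat_def)
  have assoc: "mcomp B z y w h (mcomp B y x w g f) = mcomp B z x w (mcomp B z y x h g) f"
    if "w \<in> objs B" "x \<in> objs B" "y \<in> objs B" "z \<in> objs B" "f \<in> carrier (mor B x w)"
      "g \<in> carrier (mor B y x)" "h \<in> carrier (mor B z y)" for w x y z f g h
    using C that by (simp add: category_def underlying_cat_def)
  have sub: "submodule (homog B y x s) k (mor B y x)"
    if "x \<in> objs B" "y \<in> objs B" "s \<in> carrier G" for x y s
    using B that unfolding graded_category_over_def internal_direct_sum_def by blast
  have subset: "f \<in> carrier (mor B y x)"
    if "f \<in> ?h y t x s" "x \<in> objs B" "y \<in> objs B" "s \<in> carrier G" "t \<in> carrier G" for f x y s t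
    using subgroup.subset[OF submodule.axioms(1)[OF sub, of x y "inv\<^bsub>G\<^esub> t \<otimes>\<^bsub>G\<^esub> s"]] that
    by auto
  have comp: "mcomp B z y x g f \<in> ?h z u x s"
    if "x \<in> objs B" "y \<in> objs B" "z \<in> objs B" "s \<in> carrier G" "t \<in> carrier G" "u \<in> carrier G"
      "g \<in> ?h z u y t" "f \<in> ?h y t x s" for x y z s t u f g
  proof -
    have "mcomp B z y x g f \<in> homog B z x ((inv\<^bsub>G\<^esub> u \<otimes>\<^bsub>G\<^esub> t) \<otimes>\<^bsub>G\<^esub> (inv\<^bsub>G\<^esub> t \<otimes>\<^bsub>G\<^esub> s))"
      using B that G.inv_closed G.m_closed unfolding graded_category_over_def by blast
    moreover have "(inv\<^bsub>G\<^esub> u \<otimes>\<^bsub>G\<^esub> t) \<otimes>\<^bsub>G\<^esub> (inv\<^bsub>G\<^esub> t \<otimes>\<^bsub>G\<^esub> s) = inv\<^bsub>G\<^esub> u \<otimes>\<^bsub>G\<^esub> s"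
      using that by (metis G.inv_closed G.inv_solve_left G.m_assoc G.m_closed)
    ultimately show ?thesis by simp
  qed
  have "category (underlying_cat (smash_product G B))"
    unfolding category_def
  proof (intro conjI ballI, goal_cases)
    case (1 p)
    then show ?case by (auto simp: underlying_cat_def smash_product_def one)
  next
    case (2 p q r f g)
    then show ?case by (auto simp: underlying_cat_def smash_product_def intro: comp)
  next
    case (3 p q f)
    then have "f \<in> carrier (mor B (fst q) (fst p))"
      by (cases p; cases q) (simp add: underlying_cat_def smash_product_def subset)
    then show ?case
      using 3 by (cases p; cases q) (simp add: underlying_cat_def smash_product_def unit)
  next
    case (4 p q f)
    then have "f \<in> carrier (mor B (fst q) (fst p))"
      by (cases p; cases q) (simp add: underlying_cat_def smash_product_def subset)
    then show ?case
      using 4 by (cases p; cases q) (simp add: underlying_cat_def smash_product_def unit)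
  next
    case (5 p q r w f g h)
    then have "f \<in> carrier (mor B (fst q) (fst p))" "g \<in> carrier (mor B (fst r) (fst q))"
      "h \<in> carrier (mor B (fst w) (fst r))"
      by (cases p; cases q; cases r; cases w;
          simp add: underlying_cat_def smash_product_def subset)+
    then show ?case
      using 5 by (cases p; cases q; cases r; cases w)
        (simp add: underlying_cat_def smash_product_def assoc)
  qed
  moreover have "module k ((mor B y x)\<lparr>carrier := ?h y t x s\<rparr>)"
    if "x \<in> objs B" "y \<in> objs B" "s \<in> carrier G" "t \<in> carrier G" for x y s t
    using submodule.submodule_is_module[OF sub m] that by simp
  moreover have "bilinear_map k ((mor B z y)\<lparr>carrier := ?h z u y t\<rparr>)
      ((mor B y x)\<lparr>carrier := ?h y t x s\<rparr>) ((mor B z x)\<lparr>carrier := ?h z u x s\<rparr>) (mcomp B z y x)"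
    if "x \<in> objs B" "y \<in> objs B" "z \<in> objs B" "s \<in> carrier G" "t \<in> carrier G" "u \<in> carrier G"
    for x y z s t u
    using bil[OF that(1-3)] that
    by (simp add: bilinear_map_def linear_map_def Pi_iff comp subset)
  ultimately show ?thesis
    by (simp add: category_over_def smash_product_def split_beta mem_Times_iff)
qed

section \<open>Left modules\<close>

text \<open>\<open>act M y x b v\<close> is the element \<open>b v\<close> of \<open>fib M y\<close> for \<open>b\<close> in \<open>mor C y x\<close> and \<open>v\<close> in \<open>fib M x\<close>.\<close>

record ('o, 'k, 'b, 'm) lmod =
  fib :: "'o \<Rightarrow> ('k, 'm) module"
  act :: "'o \<Rightarrow> 'o \<Rightarrow> 'b \<Rightarrow> 'm \<Rightarrow> 'm"

text \<open>Functions in HOL are total, so these records also have values outside the domains of the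
  operations, and the module record of HOL-Algebra has multiplicative fields which are meaningless
  for modules. All of these are fixed to \<open>undefined\<close>, so that HOL equality of records is equality of
  modules and no object of a module category is counted several times.\<close>

definition extensional_module ::
  "('k, 'r) ring_scheme \<Rightarrow> ('k, 'm) module \<Rightarrow> bool" where
  "extensional_module k V \<longleftrightarrow>
     (\<forall>v w. \<not> (v \<in> carrier V \<and> w \<in> carrier V) \<longrightarrow> v \<oplus>\<^bsub>V\<^esub> w = undefined) \<and>
     (\<forall>a v. \<not> (a \<in> carrier k \<and> v \<in> carrier V) \<longrightarrow> a \<odot>\<^bsub>V\<^esub> v = undefined) \<and>
     monoid.mult V = undefined \<and> monoid.one V = undefined"

definition extensional_lmod ::
  "('k, 'r) ring_scheme \<Rightarrow> ('o, 'k, 'b, 'y) kcat_scheme \<Rightarrow> ('o, 'k, 'b, 'm, 'z) lmod_scheme \<Rightarrow> bool"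
  where
  "extensional_lmod k C M \<longleftrightarrow>
     fib M \<in> extensional (objs C) \<and>
     (\<forall>x \<in> objs C. extensional_module k (fib M x)) \<and>
     (\<forall>y x b v. \<not> (x \<in> objs C \<and> y \<in> objs C \<and> b \<in> carrier (mor C y x) \<and> v \<in> carrier (fib M x))
        \<longrightarrow> act M y x b v = undefined)"

definition left_module ::
  "('k, 'r) ring_scheme \<Rightarrow> ('o, 'k, 'b, 'y) kcat_scheme \<Rightarrow> ('o, 'k, 'b, 'm, 'z) lmod_scheme \<Rightarrow> bool"
  where
  "left_module k C M \<longleftrightarrow>
     (\<forall>x \<in> objs C. module k (fib M x)) \<and>
     (\<forall>x \<in> objs C. \<forall>y \<in> objs C. bilinear_map k (mor C y x) (fib M x) (fib M y) (act M y x)) \<and>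
     (\<forall>x \<in> objs C. \<forall>y \<in> objs C. \<forall>z \<in> objs C.
        \<forall>c \<in> carrier (mor C z y). \<forall>b \<in> carrier (mor C y x). \<forall>v \<in> carrier (fib M x).
        act M z x (mcomp C z y x c b) v = act M z y c (act M y x b v)) \<and>
     (\<forall>x \<in> objs C. \<forall>v \<in> carrier (fib M x). act M x x (ident C x) v = v)"

text \<open>Natural transformations: families of \<open>k\<close>-linear maps commuting with the action.\<close>

definition module_morphisms ::
  "('k, 'r) ring_scheme \<Rightarrow> ('o, 'k, 'b, 'y) kcat_scheme \<Rightarrow> ('o, 'k, 'b, 'm, 'z) lmod_scheme
     \<Rightarrow> ('o, 'k, 'b, 'm, 'z) lmod_scheme \<Rightarrow> ('o \<Rightarrow> 'm \<Rightarrow> 'm) set" where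
  "module_morphisms k C M N =
     {\<eta> \<in> extensional (objs C).
        (\<forall>x \<in> objs C. \<eta> x \<in> extensional (carrier (fib M x)) \<and>
           linear_map k (fib M x) (fib N x) (\<eta> x)) \<and>
        (\<forall>x \<in> objs C. \<forall>y \<in> objs C. \<forall>b \<in> carrier (mor C y x). \<forall>v \<in> carrier (fib M x).
           \<eta> y (act M y x b v) = act N y x b (\<eta> x v))}"

definition identity_morphism ::
  "('o, 'k, 'b, 'y) kcat_scheme \<Rightarrow> ('o, 'k, 'b, 'm, 'z) lmod_scheme \<Rightarrow> 'o \<Rightarrow> 'm \<Rightarrow> 'm" where
  "identity_morphism C M = (\<lambda>x \<in> objs C. \<lambda>v \<in> carrier (fib M x). v)"

definition compose_morphisms ::
  "('o, 'k, 'b, 'y) kcat_scheme \<Rightarrow> ('o, 'k, 'b, 'm, 'z) lmod_scheme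
     \<Rightarrow> ('o \<Rightarrow> 'm \<Rightarrow> 'm) \<Rightarrow> ('o \<Rightarrow> 'm \<Rightarrow> 'm) \<Rightarrow> 'o \<Rightarrow> 'm \<Rightarrow> 'm" where
  "compose_morphisms C M \<theta> \<eta> = (\<lambda>x \<in> objs C. compose (carrier (fib M x)) (\<theta> x) (\<eta> x))"

text \<open>The category of all left \<open>C\<close>-modules whose elements are taken from the type \<open>'m\<close>.\<close>

definition module_category ::
  "('k, 'r) ring_scheme \<Rightarrow> ('o, 'k, 'b, 'y) kcat_scheme
     \<Rightarrow> (('o, 'k, 'b, 'm) lmod, 'o \<Rightarrow> 'm \<Rightarrow> 'm) cat" where
  "module_category k C =
     \<lparr>obj = {M. left_module k C M \<and> extensional_lmod k C M},
      arr = module_morphisms k C,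
      idt = identity_morphism C,
      cmp = (\<lambda>M N P. compose_morphisms C M)\<rparr>"

section \<open>Graded modules\<close>

text \<open>\<open>deg N x s\<close> is the degree \<open>s\<close> component of \<open>fib N x\<close>.\<close>

record ('o, 'g, 'k, 'b, 'm) graded_lmod = "('o, 'k, 'b, 'm) lmod" +
  deg :: "'o \<Rightarrow> 'g \<Rightarrow> 'm set"

definition graded_module ::
  "('k, 'r) ring_scheme \<Rightarrow> ('g, 'h) monoid_scheme \<Rightarrow> ('o, 'g, 'k, 'b) graded_kcat
     \<Rightarrow> ('o, 'g, 'k, 'b, 'm) graded_lmod \<Rightarrow> bool" where
  "graded_module k G B N \<longleftrightarrow>
     left_module k B N \<and>
     (\<forall>x \<in> objs B. internal_direct_sum k (fib N x) (carrier G) (deg N x)) \<and>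
     (\<forall>x \<in> objs B. \<forall>y \<in> objs B. \<forall>s \<in> carrier G. \<forall>t \<in> carrier G.
        \<forall>b \<in> homog B y x t. \<forall>v \<in> deg N x s. act N y x b v \<in> deg N y (t \<otimes>\<^bsub>G\<^esub> s))"

definition extensional_grading ::
  "('g, 'h) monoid_scheme \<Rightarrow> ('o, 'g, 'k, 'b) graded_kcat
     \<Rightarrow> ('o, 'g, 'k, 'b, 'm) graded_lmod \<Rightarrow> bool" where
  "extensional_grading G B N \<longleftrightarrow>
     (\<forall>x s. \<not> (x \<in> objs B \<and> s \<in> carrier G) \<longrightarrow> deg N x s = undefined)"

definition graded_morphisms ::
  "('k, 'r) ring_scheme \<Rightarrow> ('g, 'h) monoid_scheme \<Rightarrow> ('o, 'g, 'k, 'b) graded_kcat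
     \<Rightarrow> ('o, 'g, 'k, 'b, 'm) graded_lmod \<Rightarrow> ('o, 'g, 'k, 'b, 'm) graded_lmod
     \<Rightarrow> ('o \<Rightarrow> 'm \<Rightarrow> 'm) set" where
  "graded_morphisms k G B N P =
     {\<eta> \<in> module_morphisms k B N P.
        \<forall>x \<in> objs B. \<forall>s \<in> carrier G. \<eta> x ` deg N x s \<subseteq> deg P x s}"

definition graded_module_category ::
  "('k, 'r) ring_scheme \<Rightarrow> ('g, 'h) monoid_scheme \<Rightarrow> ('o, 'g, 'k, 'b) graded_kcat
     \<Rightarrow> (('o, 'g, 'k, 'b, 'm) graded_lmod, 'o \<Rightarrow> 'm \<Rightarrow> 'm) cat" where
  "graded_module_category k G B =
     \<lparr>obj = {N. graded_module k G B N \<and> extensional_lmod k B N \<and> extensional_grading G B N},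
      arr = graded_morphisms k G B,
      idt = identity_morphism B,
      cmp = (\<lambda>M N P. compose_morphisms B M)\<rparr>"

section \<open>The universe of module elements\<close>

text \<open>HOL has no class of all \<open>k\<close>-modules: a module category consists of the modules with elements
  in a given type \<open>'m\<close>, which plays the role of a set-theoretic universe. For it to be closed under
  direct sums over the group, and to offer as many copies of a family of modules indexed by \<open>I\<close>
  as of a single module, we ask that \<open>I\<close>-indexed families of elements can be coded by
  elements. This is a condition on the size of \<open>'m\<close> only.\<close>

definition closed_under_families :: "'i set \<Rightarrow> 'm itself \<Rightarrow> bool" where
  "closed_under_families I U \<longleftrightarrow> (I \<rightarrow>\<^sub>E (UNIV :: 'm set)) \<lesssim> (UNIV :: 'm set)"

text \<open>Such universes exist above any given type \<open>'c\<close> (embedded as the constant functions).\<close>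

lemma closed_under_families_exists:
  "closed_under_families (I :: 'i set) TYPE('i list \<Rightarrow> 'c)"
proof -
  let ?c = "\<lambda>F :: 'i \<Rightarrow> 'i list \<Rightarrow> 'c. \<lambda>l. F (hd l) (tl l)"
  have "inj ?c"
  proof (rule injI, intro ext)
    fix F F' i l assume "?c F = ?c F'"
    then have "?c F (i # l) = ?c F' (i # l)" by (rule fun_cong)
    then show "F i l = F' i l" by simp
  qed
  then have "inj_on ?c (I \<rightarrow>\<^sub>E UNIV)" by (rule inj_on_subset) simp
  then show ?thesis
    unfolding closed_under_families_def lepoll_def by (intro exI[of _ ?c]) simp
qed

end

theory Submission
  imports Defs
begin

text \<open>Sending a graded module to the family of its homogeneous components is a fully faithful functor:
  equivariant maps between the components extend uniquely to the direct sums. Every \<open>B # G\<close>-module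
  \<open>M\<close> is isomorphic to the image of the direct sum of its components, so this is an equivalence. An
  equivalence can be changed into an isomorphism if corresponding isomorphism classes are equally
  large. Coding the finitely supported families of elements of \<open>M\<close> by elements of the universe makes
  the direct sum injective on objects, which gives one inequality. For the other one, a graded
  module is determined by its components and by the names of its non-homogeneous elements. Over an
  infinite universe these names are attached to the homogeneous elements, which gives an injection
  into the \<open>B # G\<close>-modules; over a finite universe all elements are homogeneous. The
  Cantor--Schroeder--Bernstein construction then yields a bijection on objects.\<close>

section \<open>Isomorphism of categories from a fully faithful functor\<close>

text \<open>The obstacle is equality of objects. In a graded module all degrees at \<open>x\<close>
  lie in one carrier: the components meet only in zero, and the elements of mixed degree have freely
  chosen names. The fibres of a \<open>B # G\<close>-module over \<open>(x, s)\<close> and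
  \<open>(x, t)\<close> are unrelated sets that may overlap in any way. So the functor is in general
  neither injective nor surjective on objects, although it is an equivalence. The injections used
  instead must agree with it up to isomorphism, and the bijection made from them must inherit this;
  chosen isomorphisms then turn that bijection into the object part of a functor. The condition on
  the universe enters twice. As soon as there is an object, it gives one injective code for all
  families over \<open>G\<close>, independent of the module, so that coded sums of different modules
  can be compared; and if the universe is finite, it forces the group to be trivial or the universe
  to have at most one element.\<close>

definition isomorphic_in :: "('o, 'a) cat \<Rightarrow> 'o \<Rightarrow> 'o \<Rightarrow> bool" where
  "isomorphic_in A x y \<longleftrightarrow>
     (\<exists>f \<in> arr A x y. \<exists>g \<in> arr A y x. cmp A x y x g f = idt A x \<and> cmp A y x y f g = idt A y)"

lemma category_idt: "\<lbrakk>category A; x \<in> obj A\<rbrakk> \<Longrightarrow> idt A x \<in> arr A x x"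
  by (simp add: category_def)

lemma category_cmp:
  "\<lbrakk>category A; x \<in> obj A; y \<in> obj A; z \<in> obj A; f \<in> arr A x y; g \<in> arr A y z\<rbrakk>
     \<Longrightarrow> cmp A x y z g f \<in> arr A x z"
  by (simp add: category_def)

lemma category_unit:
  assumes "category A" "x \<in> obj A" "y \<in> obj A" "f \<in> arr A x y"
  shows "cmp A x x y f (idt A x) = f" "cmp A x y y (idt A y) f = f"
  using assms by (simp_all add: category_def)

lemma category_assoc:
  "\<lbrakk>category A; w \<in> obj A; x \<in> obj A; y \<in> obj A; z \<in> obj A;
    f \<in> arr A w x; g \<in> arr A x y; h \<in> arr A y z\<rbrakk>
     \<Longrightarrow> cmp A w y z h (cmp A w x y g f) = cmp A w x z (cmp A x y z h g) f"
  by (simp add: category_def)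

text \<open>The set-theoretic inverses form a functor because \<open>Fa\<close> is injective on each
  hom-set: an equation between arrows of \<open>A\<close> may be checked after applying
  \<open>Fa\<close>, where it is an equation in \<open>B\<close>.\<close>

lemma isomorphic_categoriesI_bij:
  assumes A: "category A" and B: "category B" and F: "is_functor A B Fo Fa"
    and bo: "bij_betw Fo (obj A) (obj B)"
    and ba: "\<And>x y. \<lbrakk>x \<in> obj A; y \<in> obj A\<rbrakk>
      \<Longrightarrow> bij_betw (Fa x y) (arr A x y) (arr B (Fo x) (Fo y))"
  shows "isomorphic_categories A B"
proof -
  define Go where "Go = inv_into (obj A) Fo"
  define Ga where "Ga u v = inv_into (arr A (Go u) (Go v)) (Fa (Go u) (Go v))" for u v
  have Go: "Go u \<in> obj A" "Fo (Go u) = u" if "u \<in> obj B" for u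
    using that bo unfolding Go_def bij_betw_def by (auto simp: inv_into_into f_inv_into_f)
  have GF: "Go (Fo x) = x" if "x \<in> obj A" for x
    using that bo unfolding Go_def by (simp add: bij_betw_inv_into_left)
  have Ga: "Ga u v g \<in> arr A (Go u) (Go v)" "Fa (Go u) (Go v) (Ga u v g) = g"
    if "u \<in> obj B" "v \<in> obj B" "g \<in> arr B u v" for u v g
    using ba[of "Go u" "Go v"] that Go unfolding Ga_def bij_betw_def
    by (auto simp: inv_into_into f_inv_into_f)
  have GFa: "Ga (Fo x) (Fo y) (Fa x y f) = f" if "x \<in> obj A" "y \<in> obj A" "f \<in> arr A x y" for x y f
    using ba[OF that(1,2)] that unfolding Ga_def
    by (simp add: GF bij_betw_inv_into_left)
  have "is_functor B A Go Ga"
    unfolding is_functor_def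
  proof (intro conjI ballI Pi_I)
    fix u assume u: "u \<in> obj B"
    then have "Fa (Go u) (Go u) (idt A (Go u)) = idt B u"
      using F Go by (simp add: is_functor_def)
    then show "Ga u u (idt B u) = idt A (Go u)"
      using GFa[of "Go u" "Go u" "idt A (Go u)"] category_idt[OF A] Go u by simp
  next
    fix u v w f g
    assume *: "u \<in> obj B" "v \<in> obj B" "w \<in> obj B" "f \<in> arr B u v" "g \<in> arr B v w"
    have "Fa (Go u) (Go w) (cmp A (Go u) (Go v) (Go w) (Ga v w g) (Ga u v f)) = cmp B u v w g f"
      using F * Go Ga by (simp add: is_functor_def)
    then show "Ga u w (cmp B u v w g f) = cmp A (Go u) (Go v) (Go w) (Ga v w g) (Ga u v f)"
      using GFa[of "Go u" "Go w" "cmp A (Go u) (Go v) (Go w) (Ga v w g) (Ga u v f)"]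
        category_cmp[OF A] Go Ga * by simp
  qed (use Go Ga in auto)
  then show ?thesis
    unfolding isomorphic_categories_def using A B F GF GFa Go Ga by blast
qed

text \<open>Conjugation by chosen isomorphisms \<open>Fo x \<rightarrow> \<Phi> x\<close> replaces
  the object part of the functor by the pointwise isomorphic \<open>\<Phi>\<close> and keeps it
  bijective on hom-sets. As \<open>\<Phi>\<close> is bijective, the previous criterion
  applies.\<close>

lemma isomorphic_categoriesI_conjugate:
  assumes A: "category A" and B: "category B" and F: "is_functor A B Fo Fa"
    and ba: "\<And>x y. \<lbrakk>x \<in> obj A; y \<in> obj A\<rbrakk>
      \<Longrightarrow> bij_betw (Fa x y) (arr A x y) (arr B (Fo x) (Fo y))"
    and bo: "bij_betw \<Phi> (obj A) (obj B)"
    and iso: "\<And>x. x \<in> obj A \<Longrightarrow> isomorphic_in B (Fo x) (\<Phi> x)"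
  shows "isomorphic_categories A B"
proof -
  have "\<forall>x \<in> obj A. \<exists>p. fst p \<in> arr B (Fo x) (\<Phi> x) \<and> snd p \<in> arr B (\<Phi> x) (Fo x) \<and>
      cmp B (Fo x) (\<Phi> x) (Fo x) (snd p) (fst p) = idt B (Fo x) \<and>
      cmp B (\<Phi> x) (Fo x) (\<Phi> x) (fst p) (snd p) = idt B (\<Phi> x)"
    using iso unfolding isomorphic_in_def by fastforce
  then obtain p where p: "\<And>x. x \<in> obj A \<Longrightarrow> fst (p x) \<in> arr B (Fo x) (\<Phi> x) \<and>
      snd (p x) \<in> arr B (\<Phi> x) (Fo x) \<and>
      cmp B (Fo x) (\<Phi> x) (Fo x) (snd (p x)) (fst (p x)) = idt B (Fo x) \<and>
      cmp B (\<Phi> x) (Fo x) (\<Phi> x) (fst (p x)) (snd (p x)) = idt B (\<Phi> x)"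
    by metis
  define \<theta> where "\<theta> x = fst (p x)" for x
  define \<tau> where "\<tau> x = snd (p x)" for x
  have \<theta>: "\<theta> x \<in> arr B (Fo x) (\<Phi> x)" and \<tau>: "\<tau> x \<in> arr B (\<Phi> x) (Fo x)"
    and \<tau>\<theta>: "cmp B (Fo x) (\<Phi> x) (Fo x) (\<tau> x) (\<theta> x) = idt B (Fo x)"
    and \<theta>\<tau>: "cmp B (\<Phi> x) (Fo x) (\<Phi> x) (\<theta> x) (\<tau> x) = idt B (\<Phi> x)"
    if "x \<in> obj A" for x
    using p that by (auto simp: \<theta>_def \<tau>_def)
  have o: "Fo x \<in> obj B" "\<Phi> x \<in> obj B" if "x \<in> obj A" for x
    using that F bo by (auto simp: is_functor_def bij_betw_def)
  have a: "Fa x y f \<in> arr B (Fo x) (Fo y)" if "x \<in> obj A" "y \<in> obj A" "f \<in> arr A x y" for x y f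
    using that F by (auto simp: is_functor_def)
  note cc = category_cmp[OF B] and cu = category_unit[OF B] and ca = category_assoc[OF B]
  define c where "c x y f = cmp B (\<Phi> x) (Fo y) (\<Phi> y) (\<theta> y) (cmp B (\<Phi> x) (Fo x) (Fo y) f (\<tau> x))"
    for x y f
  define d where "d x y g = cmp B (Fo x) (\<Phi> y) (Fo y) (\<tau> y) (cmp B (Fo x) (\<Phi> x) (\<Phi> y) g (\<theta> x))"
    for x y g
  have c: "c x y f \<in> arr B (\<Phi> x) (\<Phi> y)"
    if "x \<in> obj A" "y \<in> obj A" "f \<in> arr B (Fo x) (Fo y)" for x y f
    unfolding c_def using that o \<theta> \<tau> by (auto intro!: cc)
  have d: "d x y g \<in> arr B (Fo x) (Fo y)"
    if "x \<in> obj A" "y \<in> obj A" "g \<in> arr B (\<Phi> x) (\<Phi> y)" for x y g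
    unfolding d_def using that o \<theta> \<tau> by (auto intro!: cc)
  have left: "cmp B w (\<Phi> x) (Fo x) (\<tau> x) (cmp B w (Fo x) (\<Phi> x) (\<theta> x) h) = h"
    if "x \<in> obj A" "w \<in> obj B" "h \<in> arr B w (Fo x)" for x w h
    using that o \<theta>[of x] \<tau>[of x] \<tau>\<theta>[of x] by (simp add: ca cu)
  have left': "cmp B w (Fo x) (\<Phi> x) (\<theta> x) (cmp B w (\<Phi> x) (Fo x) (\<tau> x) h) = h"
    if "x \<in> obj A" "w \<in> obj B" "h \<in> arr B w (\<Phi> x)" for x w h
    using that o \<theta>[of x] \<tau>[of x] \<theta>\<tau>[of x] by (simp add: ca cu)
  have right: "cmp B (Fo x) (\<Phi> x) w (cmp B (\<Phi> x) (Fo x) w h (\<tau> x)) (\<theta> x) = h"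
    if "x \<in> obj A" "w \<in> obj B" "h \<in> arr B (Fo x) w" for x w h
    using that o \<theta>[of x] \<tau>[of x] \<tau>\<theta>[of x] by (simp add: ca[symmetric] cu)
  have right': "cmp B (\<Phi> x) (Fo x) w (cmp B (Fo x) (\<Phi> x) w h (\<theta> x)) (\<tau> x) = h"
    if "x \<in> obj A" "w \<in> obj B" "h \<in> arr B (\<Phi> x) w" for x w h
    using that o \<theta>[of x] \<tau>[of x] \<theta>\<tau>[of x] by (simp add: ca[symmetric] cu)
  have cd: "c x y (d x y g) = g"
    if "x \<in> obj A" "y \<in> obj A" "g \<in> arr B (\<Phi> x) (\<Phi> y)" for x y g
  proof -
    have "d x y g = cmp B (Fo x) (\<Phi> x) (Fo y) (cmp B (\<Phi> x) (\<Phi> y) (Fo y) (\<tau> y) g) (\<theta> x)"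
      unfolding d_def using that o \<theta> \<tau> by (simp add: ca)
    then show ?thesis
      unfolding c_def using that o \<theta> \<tau> by (simp add: right' left' cc)
  qed
  have dc: "d x y (c x y f) = f"
    if "x \<in> obj A" "y \<in> obj A" "f \<in> arr B (Fo x) (Fo y)" for x y f
  proof -
    have "c x y f = cmp B (\<Phi> x) (Fo x) (\<Phi> y) (cmp B (Fo x) (Fo y) (\<Phi> y) (\<theta> y) f) (\<tau> x)"
      unfolding c_def using that o \<theta> \<tau> by (simp add: ca)
    then show ?thesis
      unfolding d_def using that o \<theta> \<tau> by (simp add: right left cc)
  qed
  have bc: "bij_betw (c x y) (arr B (Fo x) (Fo y)) (arr B (\<Phi> x) (\<Phi> y))"
    if "x \<in> obj A" "y \<in> obj A" for x y
    by (rule bij_betwI[where g = "d x y"]) (use that c d cd dc in auto)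
  have ccomp: "c x z (cmp B (Fo x) (Fo y) (Fo z) g f) = cmp B (\<Phi> x) (\<Phi> y) (\<Phi> z) (c y z g) (c x y f)"
    if "x \<in> obj A" "y \<in> obj A" "z \<in> obj A" "f \<in> arr B (Fo x) (Fo y)" "g \<in> arr B (Fo y) (Fo z)"
    for x y z f g
  proof -
    have "cmp B (\<Phi> x) (\<Phi> y) (\<Phi> z) (c y z g) (c x y f)
      = cmp B (\<Phi> x) (Fo z) (\<Phi> z) (\<theta> z) (cmp B (\<Phi> x) (Fo y) (Fo z) g
          (cmp B (\<Phi> x) (\<Phi> y) (Fo y) (\<tau> y) (c x y f)))"
      unfolding c_def[of y z] using that o \<theta> \<tau> c by (simp add: ca[symmetric] cc)
    \<comment> \<open>The adjacent factors \<open>\<tau> y\<close> and \<open>\<theta> y\<close>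
      cancel, the usual reason why conjugation preserves composition.\<close>
    also have "cmp B (\<Phi> x) (\<Phi> y) (Fo y) (\<tau> y) (c x y f) = cmp B (\<Phi> x) (Fo x) (Fo y) f (\<tau> x)"
      unfolding c_def using that o \<tau> by (simp add: left cc)
    finally show ?thesis
      unfolding c_def using that o \<theta> \<tau> by (simp add: ca)
  qed
  show ?thesis
  proof (rule isomorphic_categoriesI_bij[OF A B _ bo])
    show "is_functor A B \<Phi> (\<lambda>x y f. c x y (Fa x y f))"
      unfolding is_functor_def
    proof (intro conjI ballI Pi_I)
      fix x assume "x \<in> obj A"
      then show "c x x (Fa x x (idt A x)) = idt B (\<Phi> x)"
        using F o \<theta> \<tau> \<theta>\<tau> cu by (simp add: c_def is_functor_def)
    next
      fix x y z f g
      assume *: "x \<in> obj A" "y \<in> obj A" "z \<in> obj A" "f \<in> arr A x y" "g \<in> arr A y z"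
      then show "c x z (Fa x z (cmp A x y z g f))
          = cmp B (\<Phi> x) (\<Phi> y) (\<Phi> z) (c y z (Fa y z g)) (c x y (Fa x y f))"
        using F a by (simp add: is_functor_def ccomp)
    qed (use o a c in auto)
    show "bij_betw (\<lambda>f. c x y (Fa x y f)) (arr A x y) (arr B (\<Phi> x) (\<Phi> y))"
      if "x \<in> obj A" "y \<in> obj A" for x y
      using bij_betw_trans[OF ba bc] that by (simp add: comp_def)
  qed
qed

text \<open>The usual proof pastes \<open>f\<close> on one part of \<open>A\<close> with the inverse
  of \<open>g\<close> on the rest. That description of \<open>h\<close> is kept in the conclusion,
  since a bare bijection need not respect isomorphism classes.\<close>

lemma Schroeder_Bernstein_choice:
  assumes f: "inj_on f A" "f ` A \<subseteq> B" and g: "inj_on g B" "g ` B \<subseteq> A"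
  obtains h where "bij_betw h A B" "\<And>x. x \<in> A \<Longrightarrow> h x = f x \<or> g (h x) = x"
proof -
  \<comment> \<open>The least fixed point collects the points of \<open>A\<close> whose history
    under alternating preimages by \<open>g\<close> and \<open>f\<close> stops in \<open>A\<close>;
    there \<open>f\<close> is used, elsewhere the inverse of \<open>g\<close>.\<close>
  define S where "S = lfp (\<lambda>S. A - g ` (B - f ` S))"
  have "mono (\<lambda>S. A - g ` (B - f ` S))" by (rule monoI) blast
  then have S: "S = A - g ` (B - f ` S)" unfolding S_def by (rule lfp_unfold)
  have SA: "S \<subseteq> A" using S by blast
  have AS: "A - S = g ` (B - f ` S)" using S g(2) by blast
  define h where "h x = (if x \<in> S then f x else inv_into B g x)" for x
  have 1: "bij_betw h S (f ` S)"
    using f(1) SA unfolding h_def by (auto simp: bij_betw_def inj_on_def)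
  have gi: "inj_on g (B - f ` S)" using g(1) by (rule inj_on_subset) blast
  have hg: "h (g b) = b" if "b \<in> B - f ` S" for b
  proof -
    have "g b \<notin> S" using that AS by blast
    then show ?thesis using that g(1) by (simp add: h_def inv_into_f_f)
  qed
  have 2: "bij_betw h (A - S) (B - f ` S)"
    by (rule bij_betw_byWitness[where f' = g]) (use hg AS in auto)
  have "bij_betw h (S \<union> (A - S)) (f ` S \<union> (B - f ` S))"
    by (rule bij_betw_combine[OF 1 2]) blast
  moreover have "S \<union> (A - S) = A" "f ` S \<union> (B - f ` S) = B" using SA f(2) by auto
  ultimately have bij: "bij_betw h A B" by simp
  have "h x = f x \<or> g (h x) = x" if "x \<in> A" for x
  proof (cases "x \<in> S")
    case False
    then have "x \<in> A - S" using that by simp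
    then obtain b where b: "b \<in> B - f ` S" "x = g b" unfolding AS by fast
    have "h x = b" unfolding b(2) by (rule hg[OF b(1)])
    then have "g (h x) = x" using b(2)[symmetric] by (rule ssubst)
    then show ?thesis ..
  qed (simp add: h_def)
  with bij show ?thesis by (rule that)
qed

text \<open>A fully faithful functor need not be bijective on objects up to equality; it is enough that
  the isomorphism classes on both sides have the same size. \<open>J\<close> and \<open>H\<close> bound the sizes of these
  classes by each other.\<close>

lemma isomorphic_categoriesI_injections:
  assumes A: "category A" and B: "category B" and F: "is_functor A B Fo Fa"
    and ba: "\<And>x y. \<lbrakk>x \<in> obj A; y \<in> obj A\<rbrakk>
      \<Longrightarrow> bij_betw (Fa x y) (arr A x y) (arr B (Fo x) (Fo y))"
    and J: "inj_on J (obj A)" "J ` obj A \<subseteq> obj B"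
      "\<And>x. x \<in> obj A \<Longrightarrow> isomorphic_in B (Fo x) (J x)"
    and H: "inj_on H (obj B)" "H ` obj B \<subseteq> obj A"
      "\<And>u. u \<in> obj B \<Longrightarrow> isomorphic_in B (Fo (H u)) u"
  shows "isomorphic_categories A B"
proof -
  obtain h where h: "bij_betw h (obj A) (obj B)" "\<And>x. x \<in> obj A \<Longrightarrow> h x = J x \<or> H (h x) = x"
    using Schroeder_Bernstein_choice[OF J(1,2) H(1,2)] by blast
  \<comment> \<open>If \<open>H (h x) = x\<close>, then \<open>Fo x\<close> is
    \<open>Fo (H (h x))\<close>, which is isomorphic to \<open>h x\<close> by the property of
    \<open>H\<close>.\<close>
  have iso: "isomorphic_in B (Fo x) (h x)" if "x \<in> obj A" for x
    using h(2)[OF that] J(3)[OF that] H(3)[of "h x"] bij_betwE[OF h(1)] that by auto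
  show ?thesis
    using isomorphic_categoriesI_conjugate[of A B Fo Fa h] A B F ba h(1) iso by blast
qed

section \<open>Linear maps and internal direct sums\<close>

lemma linear_mapI:
  assumes "\<And>v. v \<in> carrier M \<Longrightarrow> f v \<in> carrier N"
    and "\<And>v w. \<lbrakk>v \<in> carrier M; w \<in> carrier M\<rbrakk> \<Longrightarrow> f (v \<oplus>\<^bsub>M\<^esub> w) = f v \<oplus>\<^bsub>N\<^esub> f w"
    and "\<And>a v. \<lbrakk>a \<in> carrier k; v \<in> carrier M\<rbrakk> \<Longrightarrow> f (a \<odot>\<^bsub>M\<^esub> v) = a \<odot>\<^bsub>N\<^esub> f v"
  shows "linear_map k M N f"
  using assms by (simp add: linear_map_def)

lemma linear_mapD:
  assumes "linear_map k M N f"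
  shows "v \<in> carrier M \<Longrightarrow> f v \<in> carrier N"
    and "\<lbrakk>v \<in> carrier M; w \<in> carrier M\<rbrakk> \<Longrightarrow> f (v \<oplus>\<^bsub>M\<^esub> w) = f v \<oplus>\<^bsub>N\<^esub> f w"
    and "\<lbrakk>a \<in> carrier k; v \<in> carrier M\<rbrakk> \<Longrightarrow> f (a \<odot>\<^bsub>M\<^esub> v) = a \<odot>\<^bsub>N\<^esub> f v"
  using assms by (auto simp: linear_map_def)

lemma linear_map_zero:
  assumes "module k M" "module k N" "linear_map k M N f"
  shows "f \<zero>\<^bsub>M\<^esub> = \<zero>\<^bsub>N\<^esub>"
proof -
  interpret M: module k M by fact
  interpret N: module k N by fact
  have "f (\<zero>\<^bsub>k\<^esub> \<odot>\<^bsub>M\<^esub> \<zero>\<^bsub>M\<^esub>) = \<zero>\<^bsub>k\<^esub> \<odot>\<^bsub>N\<^esub> f \<zero>\<^bsub>M\<^esub>"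
    by (rule linear_mapD(3)[OF assms(3)]) simp_all
  then show ?thesis using linear_mapD(1)[OF assms(3), of "\<zero>\<^bsub>M\<^esub>"] by simp
qed

lemma linear_map_compose:
  assumes "linear_map k M N f" "linear_map k N P g"
  shows "linear_map k M P (\<lambda>v. g (f v))"
  using assms by (auto simp: linear_map_def Pi_iff)

lemma linear_map_cong:
  assumes "module k M" "\<And>v. v \<in> carrier M \<Longrightarrow> f v = g v"
  shows "linear_map k M N f \<longleftrightarrow> linear_map k M N g"
proof -
  interpret M: module k M by fact
  show ?thesis using assms(2) by (simp add: linear_map_def Pi_iff)
qed

lemma linear_map_add:
  assumes "module k N" "linear_map k M N f" "linear_map k M N g"
  shows "linear_map k M N (\<lambda>v. f v \<oplus>\<^bsub>N\<^esub> g v)"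
proof -
  interpret N: module k N by fact
  note f = linear_mapD[OF assms(2)] and g = linear_mapD[OF assms(3)]
  show ?thesis
    by (rule linear_mapI) (simp_all add: f g N.M.add.m_ac N.smult_r_distr)
qed

lemma linear_map_const_zero:
  assumes "module k N" shows "linear_map k M N (\<lambda>v. \<zero>\<^bsub>N\<^esub>)"
proof -
  interpret N: module k N by fact
  show ?thesis by (rule linear_mapI) simp_all
qed

lemma linear_map_finsum:
  assumes M: "module k M" and N: "module k N" and f: "linear_map k M N f"
    and "finite S" "g \<in> S \<rightarrow> carrier M"
  shows "f (finsum M g S) = finsum N (\<lambda>s. f (g s)) S"
proof -
  interpret M: module k M by fact
  interpret N: module k N by fact
  show ?thesis using assms(4,5)
  proof (induction S rule: finite_induct)
    case empty
    then show ?case using linear_map_zero[OF M N f] by simp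
  next
    case (insert s S)
    then have "(\<lambda>s. f (g s)) \<in> S \<rightarrow> carrier N" using linear_mapD(1)[OF f] by auto
    with insert show ?case
      using linear_mapD[OF f] by (simp add: M.M.finsum_insert N.M.finsum_insert M.M.finsum_closed)
  qed
qed

lemma submoduleD:
  assumes "submodule D k M"
  shows "D \<subseteq> carrier M" "\<zero>\<^bsub>M\<^esub> \<in> D" "\<lbrakk>v \<in> D; w \<in> D\<rbrakk> \<Longrightarrow> v \<oplus>\<^bsub>M\<^esub> w \<in> D"
    "\<lbrakk>a \<in> carrier k; v \<in> D\<rbrakk> \<Longrightarrow> a \<odot>\<^bsub>M\<^esub> v \<in> D"
  using subgroup.subset[OF submodule.axioms(1)[OF assms]]
    subgroup.one_closed[OF submodule.axioms(1)[OF assms]]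
    subgroup.m_closed[OF submodule.axioms(1)[OF assms]] submodule.smult_closed[OF assms]
  by auto

lemma submoduleI_linear:
  assumes M: "module k M" and "D \<subseteq> carrier M" "\<zero>\<^bsub>M\<^esub> \<in> D"
    and "\<And>v w. \<lbrakk>v \<in> D; w \<in> D\<rbrakk> \<Longrightarrow> v \<oplus>\<^bsub>M\<^esub> w \<in> D"
    and smult: "\<And>a v. \<lbrakk>a \<in> carrier k; v \<in> D\<rbrakk> \<Longrightarrow> a \<odot>\<^bsub>M\<^esub> v \<in> D"
  shows "submodule D k M"
proof -
  interpret M: module k M by fact
  have "\<ominus>\<^bsub>M\<^esub> v \<in> D" if "v \<in> D" for v
  proof -
    have v: "v \<in> carrier M" using that assms(2) by auto
    have "(\<ominus>\<^bsub>k\<^esub> \<one>\<^bsub>k\<^esub>) \<odot>\<^bsub>M\<^esub> v = \<ominus>\<^bsub>M\<^esub> v" using M.smult_l_minus[of "\<one>\<^bsub>k\<^esub>" v] v by simp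
    then show ?thesis using smult[of "\<ominus>\<^bsub>k\<^esub> \<one>\<^bsub>k\<^esub>" v] that by simp
  qed
  then show ?thesis using assms by (intro M.submoduleI) auto
qed

text \<open>A working form of internal direct sums, with linear coordinate maps in place of unique
  finite sums. The last clause asks only that the coordinates separate zero; that every element is
  the sum of its coordinates is derived from it.\<close>

definition projections ::
  "('k, 'r) ring_scheme \<Rightarrow> ('k, 'a) module \<Rightarrow> 'i set \<Rightarrow> ('i \<Rightarrow> 'a set) \<Rightarrow> ('i \<Rightarrow> 'a \<Rightarrow> 'a) \<Rightarrow> bool" where
  "projections k M I D \<pi> \<longleftrightarrow>
     (\<forall>s \<in> I. submodule (D s) k M \<and> linear_map k M M (\<pi> s)) \<and>
     (\<forall>s \<in> I. \<forall>v \<in> carrier M. \<pi> s v \<in> D s) \<and>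
     (\<forall>s \<in> I. \<forall>t \<in> I. \<forall>v \<in> D t. \<pi> s v = (if s = t then v else \<zero>\<^bsub>M\<^esub>)) \<and>
     (\<forall>v \<in> carrier M. finite {s \<in> I. \<pi> s v \<noteq> \<zero>\<^bsub>M\<^esub>}) \<and>
     (\<forall>v \<in> carrier M. (\<forall>s \<in> I. \<pi> s v = \<zero>\<^bsub>M\<^esub>) \<longrightarrow> v = \<zero>\<^bsub>M\<^esub>)"

text \<open>The difference between \<open>v\<close> and the sum of its coordinates has all
  coordinates zero, so it vanishes.\<close>

lemma projections_finsum:
  assumes M: "module k M" and \<pi>: "projections k M I D \<pi>" and v: "v \<in> carrier M"
    and S: "finite S" "S \<subseteq> I" "\<And>s. s \<in> I - S \<Longrightarrow> \<pi> s v = \<zero>\<^bsub>M\<^esub>"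
  shows "v = finsum M (\<lambda>s. \<pi> s v) S"
proof -
  interpret M: module k M by fact
  let ?w = "finsum M (\<lambda>s. \<pi> s v) S"
  have lin: "linear_map k M M (\<pi> s)" and D: "\<pi> s v \<in> D s" "D s \<subseteq> carrier M"
    and diag: "\<And>t u. \<lbrakk>t \<in> I; u \<in> D t\<rbrakk> \<Longrightarrow> \<pi> s u = (if s = t then u else \<zero>\<^bsub>M\<^esub>)"
    if "s \<in> I" for s
    using \<pi> v that submoduleD(1) unfolding projections_def by blast+
  have w: "(\<lambda>s. \<pi> s v) \<in> S \<rightarrow> carrier M" using D S by blast
  then have wc: "?w \<in> carrier M" by (rule M.M.finsum_closed)
  have "\<pi> t (v \<ominus>\<^bsub>M\<^esub> ?w) = \<zero>\<^bsub>M\<^esub>" if t: "t \<in> I" for t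
  proof -
    have "\<pi> t ?w = finsum M (\<lambda>s. \<pi> t (\<pi> s v)) S"
      by (rule linear_map_finsum[OF M M lin[OF t] S(1) w])
    also have "\<dots> = finsum M (\<lambda>s. if t = s then \<pi> s v else \<zero>\<^bsub>M\<^esub>) S"
      by (rule M.M.finsum_cong') (use w diag[OF t] D S in auto)
    also have "\<dots> = \<pi> t v"
    proof (cases "t \<in> S")
      case True
      then show ?thesis using M.M.finsum_singleton[OF True S(1) w] by simp
    next
      case False
      then have "finsum M (\<lambda>s. if t = s then \<pi> s v else \<zero>\<^bsub>M\<^esub>) S = finsum M (\<lambda>s. \<zero>\<^bsub>M\<^esub>) S"
        by (intro M.M.finsum_cong') auto
      then show ?thesis using S(3)[of t] False t by simp
    qed
    finally have eq: "\<pi> t ?w = \<pi> t v" .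
    \<comment> \<open>Additivity is applied to \<open>(v - w) + w = v\<close>; since
      \<open>w\<close> and \<open>v\<close> have the same coordinate at \<open>t\<close>,
      cancellation leaves zero for the difference.\<close>
    have "\<pi> t (v \<ominus>\<^bsub>M\<^esub> ?w) \<oplus>\<^bsub>M\<^esub> \<pi> t ?w = \<pi> t ((v \<ominus>\<^bsub>M\<^esub> ?w) \<oplus>\<^bsub>M\<^esub> ?w)"
      using linear_mapD(2)[OF lin[OF t]] v wc by simp
    also have "(v \<ominus>\<^bsub>M\<^esub> ?w) \<oplus>\<^bsub>M\<^esub> ?w = v"
      using v wc by (simp add: M.M.minus_eq M.M.a_assoc M.M.l_neg)
    finally have "\<pi> t (v \<ominus>\<^bsub>M\<^esub> ?w) \<oplus>\<^bsub>M\<^esub> \<pi> t v = \<pi> t v" unfolding eq .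
    then show ?thesis
      using linear_mapD(1)[OF lin[OF t]] v wc by simp
  qed
  then have "v \<ominus>\<^bsub>M\<^esub> ?w = \<zero>\<^bsub>M\<^esub>" using \<pi> v wc unfolding projections_def by simp
  then have "(v \<ominus>\<^bsub>M\<^esub> ?w) \<oplus>\<^bsub>M\<^esub> ?w = \<zero>\<^bsub>M\<^esub> \<oplus>\<^bsub>M\<^esub> ?w" by (simp only:)
  then show ?thesis using v wc by (simp add: M.M.minus_eq M.M.a_assoc M.M.l_neg)
qed

text \<open>The values \<open>\<pi> s v\<close> give one representation of \<open>v\<close>, and
  applying \<open>\<pi> t\<close> to any representation returns its entry at \<open>t\<close>, hence
  uniqueness.\<close>

lemma projections_imp_internal_direct_sum:
  assumes M: "module k M" and \<pi>: "projections k M I D \<pi>"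
  shows "internal_direct_sum k M I D"
  unfolding internal_direct_sum_def
proof (intro conjI ballI)
  interpret M: module k M by fact
  show "submodule (D s) k M" if "s \<in> I" for s using \<pi> that by (simp add: projections_def)
  fix v assume v: "v \<in> carrier M"
  have lin: "linear_map k M M (\<pi> s)" and D: "\<pi> s v \<in> D s" "D s \<subseteq> carrier M"
    and diag: "\<And>t u. \<lbrakk>t \<in> I; u \<in> D t\<rbrakk> \<Longrightarrow> \<pi> s u = (if s = t then u else \<zero>\<^bsub>M\<^esub>)"
    and fin: "finite {s \<in> I. \<pi> s v \<noteq> \<zero>\<^bsub>M\<^esub>}"
    if "s \<in> I" for s
    using \<pi> v that submoduleD(1) unfolding projections_def by blast+
  let ?f = "\<lambda>s \<in> I. \<pi> s v"
  have supp: "{s \<in> I. ?f s \<noteq> \<zero>\<^bsub>M\<^esub>} = {s \<in> I. \<pi> s v \<noteq> \<zero>\<^bsub>M\<^esub>}" by auto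
  show "\<exists>!f. f \<in> (\<Pi>\<^sub>E s \<in> I. D s) \<and> finite {s \<in> I. f s \<noteq> \<zero>\<^bsub>M\<^esub>} \<and>
      v = finsum M f {s \<in> I. f s \<noteq> \<zero>\<^bsub>M\<^esub>}"
  proof (rule ex1I[of _ ?f])
    have "v = finsum M (\<lambda>s. \<pi> s v) {s \<in> I. \<pi> s v \<noteq> \<zero>\<^bsub>M\<^esub>}"
      using \<pi> v by (intro projections_finsum[OF M \<pi>]) (auto simp: projections_def)
    also have "\<dots> = finsum M ?f {s \<in> I. \<pi> s v \<noteq> \<zero>\<^bsub>M\<^esub>}"
      by (rule M.M.finsum_cong') (use linear_mapD(1)[OF lin] v in auto)
    finally show "?f \<in> (\<Pi>\<^sub>E s \<in> I. D s) \<and> finite {s \<in> I. ?f s \<noteq> \<zero>\<^bsub>M\<^esub>} \<and>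
        v = finsum M ?f {s \<in> I. ?f s \<noteq> \<zero>\<^bsub>M\<^esub>}"
      unfolding supp using D \<pi> v by (auto simp: projections_def)
  next
    fix f assume f: "f \<in> (\<Pi>\<^sub>E s \<in> I. D s) \<and> finite {s \<in> I. f s \<noteq> \<zero>\<^bsub>M\<^esub>} \<and>
      v = finsum M f {s \<in> I. f s \<noteq> \<zero>\<^bsub>M\<^esub>}"
    let ?S = "{s \<in> I. f s \<noteq> \<zero>\<^bsub>M\<^esub>}"
    have fc: "f \<in> ?S \<rightarrow> carrier M" using f D(2) by (auto simp: PiE_iff)
    have "\<pi> t v = f t" if t: "t \<in> I" for t
    proof -
      have "\<pi> t v = \<pi> t (finsum M f ?S)" using f by simp
      also have "\<dots> = finsum M (\<lambda>s. \<pi> t (f s)) ?S"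
        using f by (intro linear_map_finsum[OF M M lin[OF t] _ fc]) simp
      also have "\<dots> = finsum M (\<lambda>s. if t = s then f s else \<zero>\<^bsub>M\<^esub>) ?S"
        by (rule M.M.finsum_cong') (use fc diag[OF t] f in \<open>auto simp: PiE_iff\<close>)
      also have "\<dots> = f t"
      proof (cases "t \<in> ?S")
        case True
        then show ?thesis using M.M.finsum_singleton[OF True _ fc] f by simp
      next
        case False
        then have "finsum M (\<lambda>s. if t = s then f s else \<zero>\<^bsub>M\<^esub>) ?S = finsum M (\<lambda>s. \<zero>\<^bsub>M\<^esub>) ?S"
          by (intro M.M.finsum_cong') auto
        then show ?thesis using False t by simp
      qed
      finally show ?thesis .
    qed
    then show "f = ?f" using f by (auto simp: PiE_iff extensional_def fun_eq_iff)
  qed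
qed

text \<open>The coordinates of \<open>v\<close> are the entries of its unique representation. They
  are linear because the entrywise sum, or scalar multiple, is again a representation and uniqueness
  applies.\<close>

lemma internal_direct_sum_imp_projections:
  assumes M: "module k M" and ids: "internal_direct_sum k M I D"
  obtains \<pi> where "projections k M I D \<pi>"
proof -
  interpret M: module k M by fact
  have D: "submodule (D s) k M" if "s \<in> I" for s using ids that by (simp add: internal_direct_sum_def)
  note Dd = submoduleD[OF D]
  define R where "R v f \<longleftrightarrow> f \<in> (\<Pi>\<^sub>E s \<in> I. D s) \<and> finite {s \<in> I. f s \<noteq> \<zero>\<^bsub>M\<^esub>} \<and>
      v = finsum M f {s \<in> I. f s \<noteq> \<zero>\<^bsub>M\<^esub>}" for v f
  define c where "c v = (THE f. R v f)" for v
  have ex1: "\<exists>!f. R v f" if "v \<in> carrier M" for v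
    using ids that by (auto simp: internal_direct_sum_def R_def)
  then have cR: "R v (c v)" if "v \<in> carrier M" for v
    unfolding c_def using that theI' by metis
  have ceq: "c v = f" if "v \<in> carrier M" "R v f" for v f
    using ex1[OF that(1)] that cR by blast
  have fc: "f \<in> S \<rightarrow> carrier M" if "f \<in> (\<Pi>\<^sub>E s \<in> I. D s)" "S \<subseteq> I" for f S
    using that Dd(1) by (auto simp: PiE_iff)
  \<comment> \<open>\<open>RI\<close> and \<open>RD\<close> pass between the exact support and any
    finite set containing it, so that two elements can be written as sums over a common set.\<close>
  have RI: "R v f" if "f \<in> (\<Pi>\<^sub>E s \<in> I. D s)" "finite S" "S \<subseteq> I" "\<And>s. s \<in> I - S \<Longrightarrow> f s = \<zero>\<^bsub>M\<^esub>"
      "v = finsum M f S" for v f S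
  proof -
    have sub: "{s \<in> I. f s \<noteq> \<zero>\<^bsub>M\<^esub>} \<subseteq> S" using that(4) by blast
    have "finsum M f S = finsum M f {s \<in> I. f s \<noteq> \<zero>\<^bsub>M\<^esub>}"
      using that sub fc[OF that(1,3)]
      by (intro M.M.add.finprod_mono_neutral_cong_right) auto
    then show ?thesis unfolding R_def using that finite_subset[OF sub] by simp
  qed
  have RD: "v = finsum M f S"
    if "R v f" "finite S" "S \<subseteq> I" "\<And>s. s \<in> I - S \<Longrightarrow> f s = \<zero>\<^bsub>M\<^esub>" for v f S
  proof -
    have sub: "{s \<in> I. f s \<noteq> \<zero>\<^bsub>M\<^esub>} \<subseteq> S" using that(4) by blast
    have "finsum M f S = finsum M f {s \<in> I. f s \<noteq> \<zero>\<^bsub>M\<^esub>}"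
      using that sub fc[of f S]
      by (intro M.M.add.finprod_mono_neutral_cong_right) (auto simp: R_def)
    then show ?thesis using that by (simp add: R_def)
  qed
  have cD: "c v s \<in> D s" "c v s \<in> carrier M" if "v \<in> carrier M" "s \<in> I" for v s
    using cR[OF that(1)] that Dd(1)[OF that(2)] by (auto simp: R_def PiE_iff)
  have cfin: "finite {s \<in> I. c v s \<noteq> \<zero>\<^bsub>M\<^esub>}" if "v \<in> carrier M" for v
    using cR[OF that] by (simp add: R_def)
  have add: "c (v \<oplus>\<^bsub>M\<^esub> w) = (\<lambda>s \<in> I. c v s \<oplus>\<^bsub>M\<^esub> c w s)" if v: "v \<in> carrier M" and w: "w \<in> carrier M" for v w
  proof -
    let ?S = "{s \<in> I. c v s \<noteq> \<zero>\<^bsub>M\<^esub>} \<union> {s \<in> I. c w s \<noteq> \<zero>\<^bsub>M\<^esub>}"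
    have S: "finite ?S" using cfin v w by simp
    have cc: "c v \<in> ?S \<rightarrow> carrier M" "c w \<in> ?S \<rightarrow> carrier M" using cD v w by auto
    have "v \<oplus>\<^bsub>M\<^esub> w = finsum M (c v) ?S \<oplus>\<^bsub>M\<^esub> finsum M (c w) ?S"
      by (rule arg_cong2[where f = "add M"]; rule RD[OF cR[OF v] S] RD[OF cR[OF w] S]) auto
    also have "\<dots> = finsum M (\<lambda>s. c v s \<oplus>\<^bsub>M\<^esub> c w s) ?S"
      using M.M.finsum_addf[OF cc] by simp
    also have "\<dots> = finsum M (\<lambda>s \<in> I. c v s \<oplus>\<^bsub>M\<^esub> c w s) ?S"
      by (rule M.M.finsum_cong') (use cD v w in auto)
    finally have eq: "v \<oplus>\<^bsub>M\<^esub> w = finsum M (\<lambda>s \<in> I. c v s \<oplus>\<^bsub>M\<^esub> c w s) ?S" .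
    show ?thesis
      by (rule ceq, use v w in simp, rule RI[OF _ S _ _ eq]) (use cD v w Dd in auto)
  qed
  have smult: "c (a \<odot>\<^bsub>M\<^esub> v) = (\<lambda>s \<in> I. a \<odot>\<^bsub>M\<^esub> c v s)" if a: "a \<in> carrier k" and v: "v \<in> carrier M" for a v
  proof -
    let ?S = "{s \<in> I. c v s \<noteq> \<zero>\<^bsub>M\<^esub>}"
    have S: "finite ?S" using cfin v by simp
    have cc: "c v \<in> ?S \<rightarrow> carrier M" using cD v by auto
    have "a \<odot>\<^bsub>M\<^esub> v = a \<odot>\<^bsub>M\<^esub> finsum M (c v) ?S"
      by (rule arg_cong[where f = "smult M a"], rule RD[OF cR[OF v] S]) auto
    also have "\<dots> = finsum M (\<lambda>s. a \<odot>\<^bsub>M\<^esub> c v s) ?S"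
      using M.finsum_smult_ldistr[OF S a cc] by simp
    also have "\<dots> = finsum M (\<lambda>s \<in> I. a \<odot>\<^bsub>M\<^esub> c v s) ?S"
      by (rule M.M.finsum_cong') (use cD v a in auto)
    finally have eq: "a \<odot>\<^bsub>M\<^esub> v = finsum M (\<lambda>s \<in> I. a \<odot>\<^bsub>M\<^esub> c v s) ?S" .
    show ?thesis
      by (rule ceq, use v a in simp, rule RI[OF _ S _ _ eq]) (use cD v a Dd in auto)
  qed
  have single: "c v s = (if s = t then v else \<zero>\<^bsub>M\<^esub>)" if "s \<in> I" "t \<in> I" "v \<in> D t" for s t v
  proof -
    have v: "v \<in> carrier M" using that Dd by blast
    have "c v = (\<lambda>s \<in> I. if s = t then v else \<zero>\<^bsub>M\<^esub>)"
    proof (rule ceq[OF v], rule RI[of _ "{t}"])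
      have "(\<Oplus>\<^bsub>M\<^esub>s\<in>{t}. (\<lambda>s \<in> I. if s = t then v else \<zero>\<^bsub>M\<^esub>) s) = v \<oplus>\<^bsub>M\<^esub> \<zero>\<^bsub>M\<^esub>"
        by (subst M.M.finsum_insert) (use \<open>t \<in> I\<close> v in simp_all)
      then show "v = (\<Oplus>\<^bsub>M\<^esub>s\<in>{t}. (\<lambda>s \<in> I. if s = t then v else \<zero>\<^bsub>M\<^esub>) s)"
        using v by simp
      show "(\<lambda>s \<in> I. if s = t then v else \<zero>\<^bsub>M\<^esub>) \<in> (\<Pi>\<^sub>E s \<in> I. D s)"
        using \<open>v \<in> D t\<close> Dd(2) by simp
    qed (use \<open>t \<in> I\<close> in auto)
    then show ?thesis using that by simp
  qed
  have "projections k M I D (\<lambda>s v. c v s)"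
    unfolding projections_def
  proof (intro conjI ballI impI)
    fix s assume s: "s \<in> I"
    then show "submodule (D s) k M" by (rule D)
    show "linear_map k M M (\<lambda>v. c v s)"
      by (rule linear_mapI) (use s add smult cD in auto)
  next
    fix v assume v: "v \<in> carrier M" and 0: "\<forall>s \<in> I. c v s = \<zero>\<^bsub>M\<^esub>"
    show "v = \<zero>\<^bsub>M\<^esub>" using RD[OF cR[OF v], of "{}"] 0 by simp
  qed (use cD cfin single in auto)
  then show ?thesis by (rule that)
qed

lemma internal_direct_sum_submodule:
  "\<lbrakk>internal_direct_sum k M I D; s \<in> I\<rbrakk> \<Longrightarrow> submodule (D s) k M"
  by (simp add: internal_direct_sum_def)

text \<open>Reduces statements about all elements to homogeneous ones. Zero is a separate case
  because it is the empty sum, for which \<open>I\<close> need not contain any index.\<close>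

lemma internal_direct_sum_induct [consumes 3, case_names zero add homogeneous]:
  assumes M: "module k M" and ids: "internal_direct_sum k M I D" and v: "v \<in> carrier M"
    and zero: "P \<zero>\<^bsub>M\<^esub>"
    and add: "\<And>v w. \<lbrakk>v \<in> carrier M; w \<in> carrier M; P v; P w\<rbrakk> \<Longrightarrow> P (v \<oplus>\<^bsub>M\<^esub> w)"
    and hom: "\<And>s v. \<lbrakk>s \<in> I; v \<in> D s\<rbrakk> \<Longrightarrow> P v"
  shows "P v"
proof -
  interpret M: module k M by fact
  obtain \<pi> where \<pi>: "projections k M I D \<pi>"
    using internal_direct_sum_imp_projections[OF M ids] .
  have D: "D s \<subseteq> carrier M" if "s \<in> I" for s
    using submoduleD(1)[OF internal_direct_sum_submodule[OF ids that]] .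
  have P: "finsum M f S \<in> carrier M \<and> P (finsum M f S)"
    if "finite S" "S \<subseteq> I" "\<And>s. s \<in> I \<Longrightarrow> f s \<in> D s" for f S
    using that
  proof (induction S rule: finite_induct)
    case empty
    then show ?case using zero by simp
  next
    case (insert s S)
    then have "f s \<in> carrier M" "f \<in> S \<rightarrow> carrier M" using D by blast+
    with insert show ?case
      using add[of "f s" "finsum M f S"] hom[of s "f s"] by (simp add: M.M.finsum_insert)
  qed
  have eq: "v = finsum M (\<lambda>s. \<pi> s v) {s \<in> I. \<pi> s v \<noteq> \<zero>\<^bsub>M\<^esub>}"
    using \<pi> v by (intro projections_finsum[OF M \<pi>]) (auto simp: projections_def)
  have "P (finsum M (\<lambda>s. \<pi> s v) {s \<in> I. \<pi> s v \<noteq> \<zero>\<^bsub>M\<^esub>})"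
    by (rule conjunct2[OF P]) (use \<pi> v in \<open>auto simp: projections_def\<close>)
  with eq show ?thesis by (rule ssubst)
qed

lemma linear_map_eq_on_direct_sum:
  assumes M: "module k M" and N: "module k N" and ids: "internal_direct_sum k M I D"
    and f: "linear_map k M N f" and g: "linear_map k M N g"
    and eq: "\<And>s v. \<lbrakk>s \<in> I; v \<in> D s\<rbrakk> \<Longrightarrow> f v = g v"
    and v: "v \<in> carrier M"
  shows "f v = g v"
  using M ids v
proof (induction rule: internal_direct_sum_induct)
  case zero
  then show ?case using linear_map_zero[OF M N f] linear_map_zero[OF M N g] by simp
next
  case (add v w)
  then show ?case using linear_mapD(2)[OF f] linear_mapD(2)[OF g] by simp
qed (rule eq)

text \<open>The existence half of the universal property of a direct sum: the images of the
  coordinates of \<open>v\<close> are added up.\<close>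

lemma linear_map_extension:
  assumes M: "module k M" and N: "module k N" and ids: "internal_direct_sum k M I D"
    and h: "\<And>s. s \<in> I \<Longrightarrow> linear_map k (M\<lparr>carrier := D s\<rparr>) N (h s)"
  obtains g where "linear_map k M N g" "\<And>s v. \<lbrakk>s \<in> I; v \<in> D s\<rbrakk> \<Longrightarrow> g v = h s v"
proof -
  interpret M: module k M by fact
  interpret N: module k N by fact
  obtain \<pi> where \<pi>: "projections k M I D \<pi>"
    using internal_direct_sum_imp_projections[OF M ids] .
  have D: "submodule (D s) k M" if "s \<in> I" for s
    using internal_direct_sum_submodule[OF ids that] .
  have lin: "linear_map k M M (\<pi> s)"
    and diag: "\<And>t u. \<lbrakk>t \<in> I; u \<in> D t\<rbrakk> \<Longrightarrow> \<pi> s u = (if s = t then u else \<zero>\<^bsub>M\<^esub>)"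
    if "s \<in> I" for s
    using \<pi> that unfolding projections_def by blast+
  have lin': "linear_map k M (M\<lparr>carrier := D s\<rparr>) (\<pi> s)" if "s \<in> I" for s
    using \<pi> that by (auto simp: projections_def linear_map_def)
  have l: "linear_map k M N (\<lambda>v. h s (\<pi> s v))" if "s \<in> I" for s
    by (rule linear_map_compose[OF lin'[OF that] h[OF that]])
  have h0: "h s \<zero>\<^bsub>M\<^esub> = \<zero>\<^bsub>N\<^esub>" if "s \<in> I" for s
    using linear_map_zero[OF submodule.submodule_is_module[OF D[OF that] M] N h[OF that]] by simp
  define S where "S v = {s \<in> I. \<pi> s v \<noteq> \<zero>\<^bsub>M\<^esub>}" for v
  define g where "g v = finsum N (\<lambda>s. h s (\<pi> s v)) (S v)" for v
  have finS: "finite (S v)" if "v \<in> carrier M" for v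
    using that \<pi> by (simp add: S_def projections_def)
  \<comment> \<open>As \<open>h s\<close> sends zero to zero, the sum may run over any finite set
    containing the support. Linearity then compares sums over a common index set.\<close>
  have g: "g v = finsum N (\<lambda>s. h s (\<pi> s v)) U"
    if "v \<in> carrier M" "finite U" "S v \<subseteq> U" "U \<subseteq> I" for v U
    unfolding g_def using that linear_mapD(1)[OF l] h0
    by (intro N.M.add.finprod_mono_neutral_cong_left) (auto simp: S_def)
  have gc: "(\<lambda>s. h s (\<pi> s v)) \<in> U \<rightarrow> carrier N" if "v \<in> carrier M" "U \<subseteq> I" for v U
    using that linear_mapD(1)[OF l] by auto
  have "linear_map k M N g"
  proof (rule linear_mapI)
    fix v assume v: "v \<in> carrier M"
    show "g v \<in> carrier N"
      unfolding g_def by (rule N.M.finsum_closed, rule gc[OF v]) (auto simp: S_def)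
    fix w assume w: "w \<in> carrier M"
    let ?U = "S v \<union> S w \<union> S (v \<oplus>\<^bsub>M\<^esub> w)"
    have U: "finite ?U" "?U \<subseteq> I" using finS v w by (auto simp: S_def)
    have "g (v \<oplus>\<^bsub>M\<^esub> w) = finsum N (\<lambda>s. h s (\<pi> s (v \<oplus>\<^bsub>M\<^esub> w))) ?U"
      using v w U by (intro g) auto
    also have "\<dots> = finsum N (\<lambda>s. h s (\<pi> s v) \<oplus>\<^bsub>N\<^esub> h s (\<pi> s w)) ?U"
      using U v w linear_mapD[OF l] by (intro N.M.finsum_cong') auto
    also have "\<dots> = finsum N (\<lambda>s. h s (\<pi> s v)) ?U \<oplus>\<^bsub>N\<^esub> finsum N (\<lambda>s. h s (\<pi> s w)) ?U"
      using gc U v w by (intro N.M.finsum_addf) auto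
    also have "\<dots> = g v \<oplus>\<^bsub>N\<^esub> g w"
      using g[OF v U(1) _ U(2)] g[OF w U(1) _ U(2)] by (simp add: le_supI1 le_supI2)
    finally show "g (v \<oplus>\<^bsub>M\<^esub> w) = g v \<oplus>\<^bsub>N\<^esub> g w" .
  next
    fix a v assume a: "a \<in> carrier k" and v: "v \<in> carrier M"
    let ?U = "S v \<union> S (a \<odot>\<^bsub>M\<^esub> v)"
    have U: "finite ?U" "?U \<subseteq> I" using finS v a by (auto simp: S_def)
    have "g (a \<odot>\<^bsub>M\<^esub> v) = finsum N (\<lambda>s. h s (\<pi> s (a \<odot>\<^bsub>M\<^esub> v))) ?U"
      using v a U by (intro g) auto
    also have "\<dots> = finsum N (\<lambda>s. a \<odot>\<^bsub>N\<^esub> h s (\<pi> s v)) ?U"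
      using U v a linear_mapD[OF l] by (intro N.M.finsum_cong') auto
    also have "\<dots> = a \<odot>\<^bsub>N\<^esub> finsum N (\<lambda>s. h s (\<pi> s v)) ?U"
      using gc U v a N.finsum_smult_ldistr[of ?U a "\<lambda>s. h s (\<pi> s v)"] by simp
    also have "\<dots> = a \<odot>\<^bsub>N\<^esub> g v"
      using g[OF v, of ?U] U by auto
    finally show "g (a \<odot>\<^bsub>M\<^esub> v) = a \<odot>\<^bsub>N\<^esub> g v" .
  qed
  moreover have "g v = h s v" if s: "s \<in> I" and v: "v \<in> D s" for s v
  proof -
    have vc: "v \<in> carrier M" using v submoduleD(1)[OF D[OF s]] by blast
    have "S v \<subseteq> {s}" using diag[OF _ s v] by (auto simp: S_def split: if_splits)
    then have "g v = finsum N (\<lambda>s. h s (\<pi> s v)) {s}" using g[OF vc, of "{s}"] s by simp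
    then show ?thesis using linear_mapD(1)[OF l[OF s] vc] diag[OF s s v] by simp
  qed
  ultimately show ?thesis by (rule that)
qed

text \<open>The module laws pass along a surjection compatible with the operations. \<open>W\<close>
  is not yet known to be a module, so preservation of zero cannot be derived from linearity and is
  assumed.\<close>

lemma module_linear_image:
  assumes V: "module k V" and n: "linear_map k V W n" "n \<zero>\<^bsub>V\<^esub> = \<zero>\<^bsub>W\<^esub>" "carrier W = n ` carrier V"
  shows "module k W"
proof -
  interpret V: module k V by fact
  note lin = linear_mapD[OF n(1)]
  show ?thesis
  proof (rule moduleI)
    show "cring k" by (rule V.R.is_cring)
    show "abelian_group W"
    proof (rule abelian_groupI)
      fix u v w assume "u \<in> carrier W" "v \<in> carrier W" "w \<in> carrier W"
      then obtain u' v' w' where *: "u' \<in> carrier V" "v' \<in> carrier V" "w' \<in> carrier V"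
        "u = n u'" "v = n v'" "w = n w'" unfolding n(3) by auto
      show "u \<oplus>\<^bsub>W\<^esub> v \<oplus>\<^bsub>W\<^esub> w = u \<oplus>\<^bsub>W\<^esub> (v \<oplus>\<^bsub>W\<^esub> w)"
        using * by (simp add: lin(2)[symmetric] V.M.a_assoc)
    next
      fix u v assume "u \<in> carrier W" "v \<in> carrier W"
      then obtain u' v' where *: "u' \<in> carrier V" "v' \<in> carrier V"
        "u = n u'" "v = n v'" unfolding n(3) by auto
      show "u \<oplus>\<^bsub>W\<^esub> v \<in> carrier W"
        using * lin(1)[of "u' \<oplus>\<^bsub>V\<^esub> v'"] by (simp add: lin(2)[symmetric])
      show "u \<oplus>\<^bsub>W\<^esub> v = v \<oplus>\<^bsub>W\<^esub> u"
        using * by (simp add: lin(2)[symmetric] V.M.a_comm)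
    next
      show "\<zero>\<^bsub>W\<^esub> \<in> carrier W" using lin(1)[of "\<zero>\<^bsub>V\<^esub>"] n(2) by simp
      fix u assume "u \<in> carrier W"
      then obtain u' where *: "u' \<in> carrier V" "u = n u'" unfolding n(3) by auto
      show "\<zero>\<^bsub>W\<^esub> \<oplus>\<^bsub>W\<^esub> u = u"
        using * by (simp add: lin(2)[symmetric] n(2)[symmetric])
      show "\<exists>v \<in> carrier W. v \<oplus>\<^bsub>W\<^esub> u = \<zero>\<^bsub>W\<^esub>"
        using * lin(1)[of "\<ominus>\<^bsub>V\<^esub> u'"]
        by (intro bexI[of _ "n (\<ominus>\<^bsub>V\<^esub> u')"]) (simp_all add: lin(2)[symmetric] n(2) V.M.l_neg)
    qed
    fix a u assume a: "a \<in> carrier k" and "u \<in> carrier W"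
    then obtain u' where *: "u' \<in> carrier V" "u = n u'" unfolding n(3) by auto
    show "a \<odot>\<^bsub>W\<^esub> u \<in> carrier W"
      using * a lin(1)[of "a \<odot>\<^bsub>V\<^esub> u'"] by (simp add: lin(3)[symmetric])
    fix b assume b: "b \<in> carrier k"
    show "(a \<oplus>\<^bsub>k\<^esub> b) \<odot>\<^bsub>W\<^esub> u = a \<odot>\<^bsub>W\<^esub> u \<oplus>\<^bsub>W\<^esub> b \<odot>\<^bsub>W\<^esub> u"
      using * a b by (simp add: lin(2,3)[symmetric] V.smult_l_distr)
    show "a \<otimes>\<^bsub>k\<^esub> b \<odot>\<^bsub>W\<^esub> u = a \<odot>\<^bsub>W\<^esub> (b \<odot>\<^bsub>W\<^esub> u)"
      using * a b by (simp add: lin(3)[symmetric] V.smult_assoc1)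
  next
    fix a u v assume a: "a \<in> carrier k" and "u \<in> carrier W" "v \<in> carrier W"
    then obtain u' v' where *: "u' \<in> carrier V" "u = n u'" "v' \<in> carrier V" "v = n v'"
      unfolding n(3) by auto
    show "a \<odot>\<^bsub>W\<^esub> (u \<oplus>\<^bsub>W\<^esub> v) = a \<odot>\<^bsub>W\<^esub> u \<oplus>\<^bsub>W\<^esub> a \<odot>\<^bsub>W\<^esub> v"
      using * a by (simp add: lin(2,3)[symmetric] V.smult_r_distr)
  next
    fix u assume "u \<in> carrier W"
    then obtain u' where *: "u' \<in> carrier V" "u = n u'" unfolding n(3) by auto
    show "\<one>\<^bsub>k\<^esub> \<odot>\<^bsub>W\<^esub> u = u"
      using * by (simp add: lin(3)[symmetric])
  qed
qed

text \<open>On the carrier the operations agree by assumption, and elsewhere they are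
  \<open>undefined\<close> on both sides. The zeros agree because the identity map is
  linear.\<close>

lemma extensional_module_eqI:
  assumes V: "module k V" and W: "module k W"
    and ext: "extensional_module k V" "extensional_module k W"
    and c: "carrier V = carrier W"
    and add: "\<And>v w. \<lbrakk>v \<in> carrier V; w \<in> carrier V\<rbrakk> \<Longrightarrow> v \<oplus>\<^bsub>V\<^esub> w = v \<oplus>\<^bsub>W\<^esub> w"
    and smult: "\<And>a v. \<lbrakk>a \<in> carrier k; v \<in> carrier V\<rbrakk> \<Longrightarrow> a \<odot>\<^bsub>V\<^esub> v = a \<odot>\<^bsub>W\<^esub> v"
  shows "V = W"
proof (rule module.equality)
  have "linear_map k V W (\<lambda>v. v)"
    by (rule linear_mapI) (simp_all add: c[symmetric] add smult)
  from linear_map_zero[OF V W this] show "\<zero>\<^bsub>V\<^esub> = \<zero>\<^bsub>W\<^esub>" .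
  show "(\<oplus>\<^bsub>V\<^esub>) = (\<oplus>\<^bsub>W\<^esub>)" "(\<odot>\<^bsub>V\<^esub>) = (\<odot>\<^bsub>W\<^esub>)"
    using ext c add smult unfolding extensional_module_def fun_eq_iff by metis+
  show "monoid.mult V = monoid.mult W" "\<one>\<^bsub>V\<^esub> = \<one>\<^bsub>W\<^esub>"
    using ext unfolding extensional_module_def by auto
qed (simp_all add: c)

section \<open>Module categories and transport of structure\<close>

lemma bilinear_mapD:
  assumes "bilinear_map k M N P f"
  shows "v \<in> carrier M \<Longrightarrow> linear_map k N P (f v)"
    "w \<in> carrier N \<Longrightarrow> linear_map k M P (\<lambda>v. f v w)"
    "\<lbrakk>v \<in> carrier M; w \<in> carrier N\<rbrakk> \<Longrightarrow> f v w \<in> carrier P"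
  using assms linear_mapD(1) by (fastforce simp: bilinear_map_def)+

lemma bilinear_map_compose:
  assumes "bilinear_map k M N P f" "linear_map k P Q g"
  shows "bilinear_map k M N Q (\<lambda>v w. g (f v w))"
  unfolding bilinear_map_def
  by (intro conjI ballI linear_map_compose[OF _ assms(2)] bilinear_mapD(1,2)[OF assms(1)])

lemma bilinear_map_precompose:
  assumes "bilinear_map k M N P f" "linear_map k L N h"
  shows "bilinear_map k M L P (\<lambda>v w. f v (h w))"
  unfolding bilinear_map_def
proof (intro conjI ballI)
  show "linear_map k L P (\<lambda>w. f v (h w))" if "v \<in> carrier M" for v
    by (rule linear_map_compose[OF assms(2) bilinear_mapD(1)[OF assms(1) that]])
  show "linear_map k M P (\<lambda>v. f v (h w))" if "w \<in> carrier L" for w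
    by (rule bilinear_mapD(2)[OF assms(1) linear_mapD(1)[OF assms(2) that]])
qed

text \<open>Turns identities of bilinear maps, such as equivariance or associativity of an action,
  into checks on homogeneous arguments. For homogeneous \<open>v\<close> the identity extends in the
  second argument, and then in the first.\<close>

lemma bilinear_map_eq_on_direct_sums:
  assumes M: "module k M" and N: "module k N" and P: "module k P"
    and D: "internal_direct_sum k M I D" and E: "internal_direct_sum k N J E"
    and f: "bilinear_map k M N P f" and g: "bilinear_map k M N P g"
    and eq: "\<And>s t v w. \<lbrakk>s \<in> I; t \<in> J; v \<in> D s; w \<in> E t\<rbrakk> \<Longrightarrow> f v w = g v w"
    and v: "v \<in> carrier M" and w: "w \<in> carrier N"
  shows "f v w = g v w"
proof (rule linear_map_eq_on_direct_sum[OF M P D bilinear_mapD(2)[OF f w] bilinear_mapD(2)[OF g w] _ v])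
  fix s v assume s: "s \<in> I" and v: "v \<in> D s"
  then have "v \<in> carrier M" using submoduleD(1)[OF internal_direct_sum_submodule[OF D s]] by blast
  then show "f v w = g v w"
    using linear_map_eq_on_direct_sum[OF N P E bilinear_mapD(1)[OF f] bilinear_mapD(1)[OF g] _ w]
      eq[OF s _ v] by blast
qed

text \<open>Morphisms without the convention on values outside the fibres, and with different
  element types allowed. This admits the maps that code families by single elements and those that
  evaluate families.\<close>

definition equivariant ::
  "('k, 'r) ring_scheme \<Rightarrow> ('o, 'k, 'b, 'y) kcat_scheme \<Rightarrow> ('o, 'k, 'b, 'm, 'z) lmod_scheme
     \<Rightarrow> ('o, 'k, 'b, 'n, 'w) lmod_scheme \<Rightarrow> ('o \<Rightarrow> 'm \<Rightarrow> 'n) \<Rightarrow> bool" where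
  "equivariant k C M N \<eta> \<longleftrightarrow>
     (\<forall>x \<in> objs C. linear_map k (fib M x) (fib N x) (\<eta> x)) \<and>
     (\<forall>x \<in> objs C. \<forall>y \<in> objs C. \<forall>b \<in> carrier (mor C y x). \<forall>v \<in> carrier (fib M x).
        \<eta> y (act M y x b v) = act N y x b (\<eta> x v))"

lemma equivariantD:
  assumes "equivariant k C M N \<eta>"
  shows "x \<in> objs C \<Longrightarrow> linear_map k (fib M x) (fib N x) (\<eta> x)"
    "\<lbrakk>x \<in> objs C; v \<in> carrier (fib M x)\<rbrakk> \<Longrightarrow> \<eta> x v \<in> carrier (fib N x)"
    "\<lbrakk>x \<in> objs C; y \<in> objs C; b \<in> carrier (mor C y x); v \<in> carrier (fib M x)\<rbrakk>
      \<Longrightarrow> \<eta> y (act M y x b v) = act N y x b (\<eta> x v)"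
  using assms linear_mapD(1) by (fastforce simp: equivariant_def)+

lemma module_morphisms_iff:
  "\<eta> \<in> module_morphisms k C M N \<longleftrightarrow> \<eta> \<in> extensional (objs C) \<and>
     (\<forall>x \<in> objs C. \<eta> x \<in> extensional (carrier (fib M x))) \<and> equivariant k C M N \<eta>"
  by (auto simp: module_morphisms_def equivariant_def)

lemma left_moduleD:
  assumes "left_module k C M"
  shows "x \<in> objs C \<Longrightarrow> module k (fib M x)"
    "\<lbrakk>x \<in> objs C; y \<in> objs C\<rbrakk> \<Longrightarrow> bilinear_map k (mor C y x) (fib M x) (fib M y) (act M y x)"
    "\<lbrakk>x \<in> objs C; y \<in> objs C; b \<in> carrier (mor C y x); v \<in> carrier (fib M x)\<rbrakk>
      \<Longrightarrow> act M y x b v \<in> carrier (fib M y)"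
    "\<lbrakk>x \<in> objs C; y \<in> objs C; z \<in> objs C; c \<in> carrier (mor C z y); b \<in> carrier (mor C y x);
      v \<in> carrier (fib M x)\<rbrakk> \<Longrightarrow> act M z x (mcomp C z y x c b) v = act M z y c (act M y x b v)"
    "\<lbrakk>x \<in> objs C; v \<in> carrier (fib M x)\<rbrakk> \<Longrightarrow> act M x x (ident C x) v = v"
proof -
  show "act M y x b v \<in> carrier (fib M y)"
    if "x \<in> objs C" "y \<in> objs C" "b \<in> carrier (mor C y x)" "v \<in> carrier (fib M x)"
    by (rule bilinear_mapD(3)[where k = k, OF _ that(3,4)]) (use assms that in \<open>simp add: left_module_def\<close>)
qed (use assms in \<open>auto simp: left_module_def\<close>)

lemma category_over_mcomp:
  "\<lbrakk>category_over k C; x \<in> objs C; y \<in> objs C; z \<in> objs C; c \<in> carrier (mor C z y);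
    b \<in> carrier (mor C y x)\<rbrakk> \<Longrightarrow> mcomp C z y x c b \<in> carrier (mor C z x)"
  by (rule bilinear_mapD(3)[where k = k and f = "mcomp C z y x"]) (simp_all add: category_over_def)

lemma category_over_ident:
  "\<lbrakk>category_over k C; x \<in> objs C\<rbrakk> \<Longrightarrow> ident C x \<in> carrier (mor C x x)"
  by (simp add: category_over_def category_def underlying_cat_def)

lemma equivariant_id: "left_module k C M \<Longrightarrow> equivariant k C M M (\<lambda>x v. v)"
  by (auto simp: equivariant_def linear_map_def)

lemma equivariant_compose:
  assumes "equivariant k C M N \<eta>" "equivariant k C N P \<theta>"
  shows "equivariant k C M P (\<lambda>x v. \<theta> x (\<eta> x v))"
  unfolding equivariant_def
  using linear_map_compose[OF equivariantD(1)[OF assms(1)] equivariantD(1)[OF assms(2)]]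
    equivariantD(2,3)[OF assms(1)] equivariantD(3)[OF assms(2)] by simp

lemma equivariant_cong:
  assumes M: "left_module k C M"
    and eq: "\<And>x v. \<lbrakk>x \<in> objs C; v \<in> carrier (fib M x)\<rbrakk> \<Longrightarrow> \<eta> x v = \<theta> x v"
  shows "equivariant k C M N \<eta> \<longleftrightarrow> equivariant k C M N \<theta>"
  unfolding equivariant_def
  using linear_map_cong[OF left_moduleD(1)[OF M] eq] eq left_moduleD(3)[OF M]
  by (intro arg_cong2[where f = "(\<and>)"] ball_cong refl) simp_all

text \<open>The normal form of an equivariant family: restriction to the fibres turns it into an
  arrow of the module category, and every arrow is its own restriction.\<close>

definition restrict_family ::
  "('o, 'k, 'b, 'y) kcat_scheme \<Rightarrow> ('o, 'k, 'b, 'm, 'z) lmod_scheme \<Rightarrow> ('o \<Rightarrow> 'm \<Rightarrow> 'n)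
     \<Rightarrow> 'o \<Rightarrow> 'm \<Rightarrow> 'n" where
  "restrict_family C M \<eta> = (\<lambda>x \<in> objs C. \<lambda>v \<in> carrier (fib M x). \<eta> x v)"

lemma restrict_family_apply [simp]:
  "\<lbrakk>x \<in> objs C; v \<in> carrier (fib M x)\<rbrakk> \<Longrightarrow> restrict_family C M \<eta> x v = \<eta> x v"
  by (simp add: restrict_family_def)

lemma restrict_family_cong:
  "(\<And>x v. \<lbrakk>x \<in> objs C; v \<in> carrier (fib M x)\<rbrakk> \<Longrightarrow> \<eta> x v = \<theta> x v)
     \<Longrightarrow> restrict_family C M \<eta> = restrict_family C M \<theta>"
  unfolding restrict_family_def by (intro restrict_ext)

lemma restrict_family_morphism:
  assumes "left_module k C M" "equivariant k C M N \<eta>"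
  shows "restrict_family C M \<eta> \<in> module_morphisms k C M N"
proof -
  have "equivariant k C M N (restrict_family C M \<eta>)"
    using assms(2) by (subst equivariant_cong[OF assms(1), where \<theta> = \<eta>]) simp_all
  then show ?thesis by (simp add: module_morphisms_iff) (simp add: restrict_family_def)
qed

lemma restrict_family_of_morphism:
  "\<eta> \<in> module_morphisms k C M N \<Longrightarrow> restrict_family C M \<eta> = \<eta>"
  unfolding module_morphisms_iff restrict_family_def extensional_def by (auto simp: fun_eq_iff)

lemma identity_morphism_eq: "identity_morphism C M = restrict_family C M (\<lambda>x v. v)"
  by (simp add: identity_morphism_def restrict_family_def)

lemma compose_morphisms_eq:
  "compose_morphisms C M \<theta> \<eta> = restrict_family C M (\<lambda>x v. \<theta> x (\<eta> x v))"
  by (simp add: compose_morphisms_def restrict_family_def compose_def)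

lemma identity_morphism_mem:
  "left_module k C M \<Longrightarrow> identity_morphism C M \<in> module_morphisms k C M M"
  unfolding identity_morphism_eq by (intro restrict_family_morphism equivariant_id)

lemma compose_morphisms_mem:
  "\<lbrakk>left_module k C M; \<eta> \<in> module_morphisms k C M N; \<theta> \<in> module_morphisms k C N P\<rbrakk>
     \<Longrightarrow> compose_morphisms C M \<theta> \<eta> \<in> module_morphisms k C M P"
  unfolding compose_morphisms_eq
  by (rule restrict_family_morphism, assumption, rule equivariant_compose[of k C M N \<eta> P \<theta>])
    (simp_all add: module_morphisms_iff)

lemma compose_identity_morphism:
  assumes "\<eta> \<in> module_morphisms k C M N"
  shows "compose_morphisms C M \<eta> (identity_morphism C M) = \<eta>"
    "compose_morphisms C M (identity_morphism C N) \<eta> = \<eta>"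
proof -
  have e: "equivariant k C M N \<eta>" using assms by (simp add: module_morphisms_iff)
  have "compose_morphisms C M \<eta> (identity_morphism C M) = restrict_family C M \<eta>"
    "compose_morphisms C M (identity_morphism C N) \<eta> = restrict_family C M \<eta>"
    unfolding compose_morphisms_eq identity_morphism_eq
    by (rule restrict_family_cong; simp add: equivariantD(2)[OF e])+
  then show "compose_morphisms C M \<eta> (identity_morphism C M) = \<eta>"
    "compose_morphisms C M (identity_morphism C N) \<eta> = \<eta>"
    using restrict_family_of_morphism[OF assms] by simp_all
qed

lemma compose_morphisms_assoc:
  assumes "\<eta> \<in> module_morphisms k C M N"
  shows "compose_morphisms C M \<zeta> (compose_morphisms C M \<theta> \<eta>)
    = compose_morphisms C M (compose_morphisms C N \<zeta> \<theta>) \<eta>"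
proof -
  have e: "equivariant k C M N \<eta>" using assms by (simp add: module_morphisms_iff)
  show ?thesis
    unfolding compose_morphisms_eq
    by (rule restrict_family_cong) (simp add: equivariantD(2)[OF e])
qed

lemma category_module_category: "category (module_category k C)"
  unfolding category_def module_category_def
  by (auto intro: identity_morphism_mem compose_morphisms_mem
      simp: compose_identity_morphism compose_morphisms_assoc)

lemma category_graded_module_category: "category (graded_module_category k G B)"
proof -
  have id: "identity_morphism B N \<in> graded_morphisms k G B N N" if N: "graded_module k G B N" for N
  proof -
    have "deg N x s \<subseteq> carrier (fib N x)" if "x \<in> objs B" "s \<in> carrier G" for x s
      using N that internal_direct_sum_submodule submoduleD(1) unfolding graded_module_def by metis
    then show ?thesis
      using N identity_morphism_mem[of k B N]
      by (auto simp: graded_morphisms_def graded_module_def identity_morphism_def)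
  qed
  have comp: "compose_morphisms B N \<theta> \<eta> \<in> graded_morphisms k G B N Q"
    if N: "graded_module k G B N" and \<eta>: "\<eta> \<in> graded_morphisms k G B N P"
      and \<theta>: "\<theta> \<in> graded_morphisms k G B P Q" for N P Q \<eta> \<theta>
  proof -
    have "deg N x s \<subseteq> carrier (fib N x)" if "x \<in> objs B" "s \<in> carrier G" for x s
      using N that internal_direct_sum_submodule submoduleD(1) unfolding graded_module_def by metis
    then have "compose_morphisms B N \<theta> \<eta> x v = \<theta> x (\<eta> x v)"
      if "x \<in> objs B" "s \<in> carrier G" "v \<in> deg N x s" for x s v
      using that unfolding compose_morphisms_eq by (intro restrict_family_apply) auto
    moreover have "compose_morphisms B N \<theta> \<eta> \<in> module_morphisms k B N Q"
      using compose_morphisms_mem[of k B N \<eta> P \<theta> Q] N \<eta> \<theta>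
      by (simp add: graded_module_def graded_morphisms_def)
    ultimately show ?thesis
      using \<eta> \<theta> unfolding graded_morphisms_def by (auto simp: image_subset_iff)
  qed
  have mm: "\<eta> \<in> module_morphisms k B N P" if "\<eta> \<in> graded_morphisms k G B N P" for \<eta> N P
    using that by (simp add: graded_morphisms_def)
  show ?thesis
    unfolding category_def graded_module_category_def
    by (auto intro: id comp
        simp: compose_identity_morphism[OF mm] compose_morphisms_assoc[OF mm])
qed

lemma equivariant_inv:
  assumes M: "left_module k C M" and N: "left_module k C N" and \<eta>: "equivariant k C M N \<eta>"
    and bij: "\<And>x. x \<in> objs C \<Longrightarrow> bij_betw (\<eta> x) (carrier (fib M x)) (carrier (fib N x))"
  shows "equivariant k C N M (\<lambda>x. inv_into (carrier (fib M x)) (\<eta> x))"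
proof -
  let ?\<iota> = "\<lambda>x. inv_into (carrier (fib M x)) (\<eta> x)"
  have \<iota>: "?\<iota> x w \<in> carrier (fib M x)" "\<eta> x (?\<iota> x w) = w"
    if "x \<in> objs C" "w \<in> carrier (fib N x)" for x w
    using bij[OF that(1)] that(2) by (auto simp: bij_betw_def inv_into_into f_inv_into_f)
  have \<iota>I: "?\<iota> x w = v" if "x \<in> objs C" "v \<in> carrier (fib M x)" "w = \<eta> x v" for x v w
    using bij[OF that(1)] that(2,3) by (simp add: bij_betw_inv_into_left)
  show ?thesis
    unfolding equivariant_def
  proof (intro conjI ballI)
    fix x assume x: "x \<in> objs C"
    interpret M: module k "fib M x" by (rule left_moduleD(1)[OF M x])
    show "linear_map k (fib N x) (fib M x) (?\<iota> x)"
      by (rule linear_mapI) (use x \<iota> linear_mapD[OF equivariantD(1)[OF \<eta> x]] in \<open>auto intro!: \<iota>I\<close>)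
  next
    fix x y b w
    assume *: "x \<in> objs C" "y \<in> objs C" "b \<in> carrier (mor C y x)" "w \<in> carrier (fib N x)"
    then show "?\<iota> y (act N y x b w) = act M y x b (?\<iota> x w)"
      using \<iota> left_moduleD(3)[OF M] equivariantD(3)[OF \<eta>] by (intro \<iota>I) auto
  qed
qed

lemma isomorphic_in_module_category:
  assumes M: "left_module k C M" and N: "left_module k C N" and \<eta>: "equivariant k C M N \<eta>"
    and bij: "\<And>x. x \<in> objs C \<Longrightarrow> bij_betw (\<eta> x) (carrier (fib M x)) (carrier (fib N x))"
  shows "isomorphic_in (module_category k C) M N" "isomorphic_in (module_category k C) N M"
proof -
  let ?\<iota> = "\<lambda>x. inv_into (carrier (fib M x)) (\<eta> x)"
  let ?f = "restrict_family C M \<eta>" and ?g = "restrict_family C N ?\<iota>"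
  have e: "equivariant k C N M ?\<iota>" by (rule equivariant_inv[OF M N \<eta> bij])
  have fg: "?f \<in> module_morphisms k C M N" "?g \<in> module_morphisms k C N M"
    using restrict_family_morphism M N \<eta> e by blast+
  have gf: "compose_morphisms C M ?g ?f = identity_morphism C M"
    unfolding compose_morphisms_eq identity_morphism_eq
    by (intro restrict_family_cong)
      (simp add: equivariantD(2)[OF \<eta>] bij_betw_inv_into_left[OF bij])
  have fg': "compose_morphisms C N ?f ?g = identity_morphism C N"
    unfolding compose_morphisms_eq identity_morphism_eq
    by (intro restrict_family_cong)
      (simp add: equivariantD(2)[OF e] bij_betw_inv_into_right[OF bij])
  show "isomorphic_in (module_category k C) M N" "isomorphic_in (module_category k C) N M"
    unfolding isomorphic_in_def module_category_def using fg gf fg' by auto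
qed

text \<open>Only the fields \<open>fib\<close> and \<open>act\<close> are compared, so that the
  criterion also serves records extended by a grading. Inside the domains the identity map transfers
  the operations; outside, both records are \<open>undefined\<close>.\<close>

lemma extensional_lmod_eqI:
  assumes M: "left_module k C M" "extensional_lmod k C M"
    and N: "left_module k C N" "extensional_lmod k C N"
    and c: "\<And>x. x \<in> objs C \<Longrightarrow> carrier (fib M x) = carrier (fib N x)"
    and id: "equivariant k C M N (\<lambda>x v. v)"
  shows "fib M = fib N" "act M = act N"
proof -
  have "fib M x = fib N x" if x: "x \<in> objs C" for x
    by (rule extensional_module_eqI[OF left_moduleD(1)[OF M(1) x] left_moduleD(1)[OF N(1) x] _ _ c[OF x]])
      (use x M(2) N(2) linear_mapD[OF equivariantD(1)[OF id x]] in \<open>auto simp: extensional_lmod_def\<close>)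
  then show "fib M = fib N"
    using M(2) N(2) unfolding extensional_lmod_def by (blast intro: extensionalityI)
  have "act M y x b v = act N y x b v" for y x b v
  proof (cases "x \<in> objs C \<and> y \<in> objs C \<and> b \<in> carrier (mor C y x) \<and> v \<in> carrier (fib M x)")
    case True
    then show ?thesis using equivariantD(3)[OF id] by blast
  next
    case False
    then have "act M y x b v = undefined" using M(2) unfolding extensional_lmod_def by blast
    moreover have "act N y x b v = undefined"
      using False c N(2) unfolding extensional_lmod_def by blast
    ultimately show ?thesis by simp
  qed
  then show "act M = act N" by (simp add: fun_eq_iff)
qed

section \<open>Transport of structure along injective renamings\<close>

definition transport_module ::
  "('k, 'r) ring_scheme \<Rightarrow> ('m \<Rightarrow> 'n) \<Rightarrow> ('k, 'm) module \<Rightarrow> ('k, 'n) module" where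
  "transport_module k n V =
     (let V' = n ` carrier V; i = inv_into (carrier V) n in
      \<lparr>carrier = V', monoid.mult = undefined, monoid.one = undefined, ring.zero = n \<zero>\<^bsub>V\<^esub>,
       ring.add = (\<lambda>v w. if v \<in> V' \<and> w \<in> V' then n (i v \<oplus>\<^bsub>V\<^esub> i w) else undefined),
       smult = (\<lambda>a v. if a \<in> carrier k \<and> v \<in> V' then n (a \<odot>\<^bsub>V\<^esub> i v) else undefined)\<rparr>)"

lemma carrier_transport_module [simp]: "carrier (transport_module k n V) = n ` carrier V"
  by (simp add: transport_module_def Let_def)

lemma extensional_transport_module: "extensional_module k (transport_module k n V)"
  by (auto simp: extensional_module_def transport_module_def Let_def)

lemma linear_map_transport_module:
  assumes "module k V" "inj_on n (carrier V)"
  shows "linear_map k V (transport_module k n V) n"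
proof -
  interpret V: module k V by fact
  show ?thesis
    using assms(2) by (intro linear_mapI) (auto simp: transport_module_def Let_def)
qed

lemma module_transport_module:
  assumes "module k V" "inj_on n (carrier V)"
  shows "module k (transport_module k n V)"
  by (rule module_linear_image[OF assms(1) linear_map_transport_module[OF assms]])
    (simp_all add: transport_module_def Let_def)

definition transport ::
  "('k, 'r) ring_scheme \<Rightarrow> ('o, 'k, 'b, 'y) kcat_scheme \<Rightarrow> ('o \<Rightarrow> 'm \<Rightarrow> 'n)
     \<Rightarrow> ('o, 'k, 'b, 'm, 'z) lmod_scheme \<Rightarrow> ('o, 'k, 'b, 'n) lmod" where
  "transport k C n M =
     \<lparr>fib = (\<lambda>x \<in> objs C. transport_module k (n x) (fib M x)),
      act = (\<lambda>y x b v.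
        if x \<in> objs C \<and> y \<in> objs C \<and> b \<in> carrier (mor C y x) \<and> v \<in> n x ` carrier (fib M x)
        then n y (act M y x b (inv_into (carrier (fib M x)) (n x) v)) else undefined)\<rparr>"

lemma carrier_fib_transport [simp]:
  "x \<in> objs C \<Longrightarrow> carrier (fib (transport k C n M) x) = n x ` carrier (fib M x)"
  by (simp add: transport_def)

lemma equivariant_transport:
  assumes M: "left_module k C M" and n: "\<And>x. x \<in> objs C \<Longrightarrow> inj_on (n x) (carrier (fib M x))"
  shows "equivariant k C M (transport k C n M) n"
  using linear_map_transport_module[OF left_moduleD(1)[OF M] n] n
  by (auto simp: equivariant_def transport_def)

text \<open>Every element of \<open>N\<close> is the image under \<open>n\<close> of an element of
  \<open>M\<close>, so the laws of the action are inherited. Of \<open>N\<close> itself it is only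
  assumed that its fibres are modules.\<close>

lemma left_module_image:
  assumes C: "category_over k C" and M: "left_module k C M" and n: "equivariant k C M N n"
    and N: "\<And>x. x \<in> objs C \<Longrightarrow> module k (fib N x)"
    and img: "\<And>x. x \<in> objs C \<Longrightarrow> carrier (fib N x) = n x ` carrier (fib M x)"
  shows "left_module k C N"
  unfolding left_module_def
proof (intro conjI ballI)
  fix x assume x: "x \<in> objs C"
  then show "module k (fib N x)" by (rule N)
  fix v assume "v \<in> carrier (fib N x)"
  then obtain v' where "v' \<in> carrier (fib M x)" "v = n x v'" using img[OF x] by auto
  then show "act N x x (ident C x) v = v"
    using equivariantD(3)[OF n x x] category_over_ident[OF C x] left_moduleD(5)[OF M x] by metis
next
  fix x y z b c v
  assume *: "x \<in> objs C" "y \<in> objs C" "z \<in> objs C" "c \<in> carrier (mor C z y)"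
    "b \<in> carrier (mor C y x)" and "v \<in> carrier (fib N x)"
  then obtain v' where v: "v' \<in> carrier (fib M x)" "v = n x v'" using img[of x] by auto
  have "act N z y c (act N y x b v) = n z (act M z y c (act M y x b v'))"
    using * v left_moduleD(3)[OF M] by (simp add: equivariantD(3)[OF n, symmetric])
  also have "\<dots> = act N z x (mcomp C z y x c b) v"
    using * v category_over_mcomp[OF C] left_moduleD(4)[OF M]
    by (simp add: equivariantD(3)[OF n, symmetric])
  finally show "act N z x (mcomp C z y x c b) v = act N z y c (act N y x b v)" by simp
next
  fix x y assume x: "x \<in> objs C" and y: "y \<in> objs C"
  interpret X: module k "mor C y x" using C x y by (simp add: category_over_def)
  interpret M: module k "fib M x" by (rule left_moduleD(1)[OF M x])
  have lin: "linear_map k (mor C y x) (fib N y) (\<lambda>b. act N y x b (n x v))"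
    if v: "v \<in> carrier (fib M x)" for v
  proof -
    have "linear_map k (mor C y x) (fib N y) (\<lambda>b. n y (act M y x b v))"
      by (rule linear_map_compose[OF bilinear_mapD(2)[OF left_moduleD(2)[OF M x y] v] equivariantD(1)[OF n y]])
    then show ?thesis
      using equivariantD(3)[OF n x y _ v]
      by (subst linear_map_cong[OF X.module_axioms, where g = "\<lambda>b. n y (act M y x b v)"]) simp_all
  qed
  show "bilinear_map k (mor C y x) (fib N x) (fib N y) (act N y x)"
    unfolding bilinear_map_def
  proof (intro conjI ballI)
    fix w assume "w \<in> carrier (fib N x)"
    then show "linear_map k (mor C y x) (fib N y) (\<lambda>b. act N y x b w)" using lin img[OF x] by auto
  next
    fix b assume b: "b \<in> carrier (mor C y x)"
    note m = linear_mapD[OF bilinear_mapD(1)[OF left_moduleD(2)[OF M x y] b]]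
    note nx = linear_mapD[OF equivariantD(1)[OF n x]] and ny = linear_mapD[OF equivariantD(1)[OF n y]]
    note e = equivariantD(3)[OF n x y b, symmetric]
    show "linear_map k (fib N x) (fib N y) (act N y x b)"
    proof (rule linear_mapI)
      fix v assume "v \<in> carrier (fib N x)"
      then obtain v' where v: "v' \<in> carrier (fib M x)" "v = n x v'" using img[OF x] by auto
      show "act N y x b v \<in> carrier (fib N y)" using v e m ny by simp
      show "act N y x b (a \<odot>\<^bsub>fib N x\<^esub> v) = a \<odot>\<^bsub>fib N y\<^esub> act N y x b v" if "a \<in> carrier k" for a
        using v that m ny by (simp add: e nx(3)[symmetric])
      fix w assume "w \<in> carrier (fib N x)"
      then obtain w' where w: "w' \<in> carrier (fib M x)" "w = n x w'" using img[OF x] by auto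
      show "act N y x b (v \<oplus>\<^bsub>fib N x\<^esub> w) = act N y x b v \<oplus>\<^bsub>fib N y\<^esub> act N y x b w"
        using v w m ny by (simp add: e nx(2)[symmetric])
    qed
  qed
qed

lemma left_module_transport:
  assumes C: "category_over k C" and M: "left_module k C M"
    and n: "\<And>x. x \<in> objs C \<Longrightarrow> inj_on (n x) (carrier (fib M x))"
  shows "left_module k C (transport k C n M)"
proof (rule left_module_image[OF C M equivariant_transport[OF M n]])
  show "module k (fib (transport k C n M) x)" if "x \<in> objs C" for x
    using that module_transport_module[OF left_moduleD(1)[OF M that] n[OF that]]
    by (simp add: transport_def)
qed simp_all

lemma extensional_lmod_transport: "extensional_lmod k C (transport k C n M)"
  by (auto simp: extensional_lmod_def transport_def extensional_transport_module)

lemma isomorphic_in_transport: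
  assumes C: "category_over k C" and M: "left_module k C M"
    and n: "\<And>x. x \<in> objs C \<Longrightarrow> inj_on (n x) (carrier (fib M x))"
  shows "isomorphic_in (module_category k C) M (transport k C n M)"
  by (rule isomorphic_in_module_category(1)[OF M left_module_transport[OF C M n]
        equivariant_transport[OF M n]])
    (simp_all add: bij_betw_def n)

text \<open>One retraction \<open>r\<close> reads the original element off its new name for both
  labellings, so equal transports come from equal carriers and the labellings agree element by
  element. A label may thus carry further information, which the third conclusion recovers.\<close>

lemma transport_eq_imp_eq:
  assumes C: "category_over k C"
    and M: "left_module k C M" "extensional_lmod k C M" and N: "left_module k C N" "extensional_lmod k C N"
    and m: "\<And>x v. \<lbrakk>x \<in> objs C; v \<in> carrier (fib M x)\<rbrakk> \<Longrightarrow> r x (m x v) = v"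
    and n: "\<And>x v. \<lbrakk>x \<in> objs C; v \<in> carrier (fib N x)\<rbrakk> \<Longrightarrow> r x (n x v) = v"
    and eq: "transport k C m M = transport k C n N"
  shows "fib M = fib N" "act M = act N"
    "\<And>x v. \<lbrakk>x \<in> objs C; v \<in> carrier (fib M x)\<rbrakk> \<Longrightarrow> m x v = n x v"
proof -
  have mi: "inj_on (m x) (carrier (fib M x))" and ni: "inj_on (n x) (carrier (fib N x))"
    if "x \<in> objs C" for x
    using m[OF that] n[OF that] by (metis inj_onI)+
  have img: "m x ` carrier (fib M x) = n x ` carrier (fib N x)" if "x \<in> objs C" for x
    using arg_cong[OF eq, of "\<lambda>T. carrier (fib T x)"] that by simp
  have c: "carrier (fib M x) = carrier (fib N x)" if x: "x \<in> objs C" for x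
  proof -
    have "carrier (fib M x) = r x ` (m x ` carrier (fib M x))"
      using m[OF x] by (force simp: image_image)
    also have "\<dots> = carrier (fib N x)"
      unfolding img[OF x] using n[OF x] by (force simp: image_image)
    finally show ?thesis .
  qed
  show mn: "m x v = n x v" if x: "x \<in> objs C" and v: "v \<in> carrier (fib M x)" for x v
  proof -
    obtain w where w: "w \<in> carrier (fib N x)" "m x v = n x w" using img[OF x] v by blast
    then have "v = w" using m[OF x v] n[OF x w(1)] by simp
    then show ?thesis using w by simp
  qed
  \<comment> \<open>Renaming by \<open>m\<close> and undoing \<open>n\<close> leads from
    \<open>M\<close> to \<open>N\<close> through the common transport. This equivariant map is the
    identity because the two names of each element agree.\<close>
  have "equivariant k C (transport k C n N) N (\<lambda>x. inv_into (carrier (fib N x)) (n x))"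
    by (rule equivariant_inv[OF N(1) left_module_transport[OF C N(1) ni] equivariant_transport[OF N(1) ni]])
      (simp_all add: bij_betw_def ni)
  from equivariant_compose[OF equivariant_transport[OF M(1) mi, unfolded eq] this]
  have "equivariant k C M N (\<lambda>x v. inv_into (carrier (fib N x)) (n x) (m x v))" by simp
  then have "equivariant k C M N (\<lambda>x v. v)"
    using mn c ni by (subst equivariant_cong[OF M(1),
          where \<theta> = "\<lambda>x v. inv_into (carrier (fib N x)) (n x) (m x v)"]) auto
  from extensional_lmod_eqI[OF M N c this] show "fib M = fib N" "act M = act N" by simp_all
qed

section \<open>Homogeneous components\<close>

text \<open>The projections of \<open>V\<close>, conjugated by the bijection \<open>n\<close>, are
  projections of \<open>W\<close>.\<close>

lemma internal_direct_sum_image: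
  assumes V: "module k V" and W: "module k W" and n: "linear_map k V W n"
    and bij: "bij_betw n (carrier V) (carrier W)" and ids: "internal_direct_sum k V I D"
    and E: "\<And>s. s \<in> I \<Longrightarrow> E s = n ` D s"
  shows "internal_direct_sum k W I E"
proof -
  interpret V: module k V by fact
  interpret W: module k W by fact
  obtain \<pi> where \<pi>: "projections k V I D \<pi>"
    using internal_direct_sum_imp_projections[OF V ids] .
  let ?i = "inv_into (carrier V) n"
  have i: "?i w \<in> carrier V" "n (?i w) = w" if "w \<in> carrier W" for w
    using bij that by (auto simp: bij_betw_def inv_into_into f_inv_into_f)
  have iI: "?i w = v" if "v \<in> carrier V" "w = n v" for v w
    using bij that by (simp add: bij_betw_inv_into_left)
  have li: "linear_map k W V ?i"
    by (rule linear_mapI) (use i linear_mapD[OF n] in \<open>auto intro!: iI\<close>)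
  have n0: "n \<zero>\<^bsub>V\<^esub> = \<zero>\<^bsub>W\<^esub>" by (rule linear_map_zero[OF V W n])
  have D: "submodule (D s) k V" and lin: "linear_map k V V (\<pi> s)"
    and \<pi>D: "\<And>v. v \<in> carrier V \<Longrightarrow> \<pi> s v \<in> D s"
    and diag: "\<And>t u. \<lbrakk>t \<in> I; u \<in> D t\<rbrakk> \<Longrightarrow> \<pi> s u = (if s = t then u else \<zero>\<^bsub>V\<^esub>)"
    if "s \<in> I" for s
    using \<pi> that unfolding projections_def by blast+
  note Ds = submoduleD[OF D]
  have nz: "n v = \<zero>\<^bsub>W\<^esub> \<longleftrightarrow> v = \<zero>\<^bsub>V\<^esub>" if "v \<in> carrier V" for v
    using bij_betw_imp_inj_on[OF bij] that n0 inj_on_eq_iff[of n "carrier V" v "\<zero>\<^bsub>V\<^esub>"] by simp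
  have \<pi>c: "\<pi> s v \<in> carrier V" if "s \<in> I" "v \<in> carrier V" for s v
    using linear_mapD(1)[OF lin] that by blast
  have "projections k W I E (\<lambda>s w. n (\<pi> s (?i w)))"
    unfolding projections_def
  proof (intro conjI ballI impI)
    fix s assume s: "s \<in> I"
    show "linear_map k W W (\<lambda>w. n (\<pi> s (?i w)))"
      by (rule linear_map_compose[OF linear_map_compose[OF li lin[OF s]] n])
    show "submodule (E s) k W"
      unfolding E[OF s]
    proof (rule submoduleI_linear[OF W])
      show "n ` D s \<subseteq> carrier W" using Ds(1)[OF s] linear_mapD(1)[OF n] by blast
      show "\<zero>\<^bsub>W\<^esub> \<in> n ` D s" using Ds(2)[OF s] n0 by force
      fix v assume "v \<in> n ` D s"
      then obtain v' where v: "v' \<in> D s" "v = n v'" by auto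
      then have vc: "v' \<in> carrier V" using Ds(1)[OF s] by blast
      show "a \<odot>\<^bsub>W\<^esub> v \<in> n ` D s" if "a \<in> carrier k" for a
        using v Ds(4)[OF s that v(1)] linear_mapD(3)[OF n that vc] by force
      fix w assume "w \<in> n ` D s"
      then obtain w' where w: "w' \<in> D s" "w = n w'" by auto
      then have wc: "w' \<in> carrier V" using Ds(1)[OF s] by blast
      show "v \<oplus>\<^bsub>W\<^esub> w \<in> n ` D s"
        using v w Ds(3)[OF s v(1) w(1)] linear_mapD(2)[OF n vc wc] by force
    qed
    show "n (\<pi> s (?i w)) \<in> E s" if "w \<in> carrier W" for w
      using E[OF s] \<pi>D[OF s i(1)[OF that]] by simp
    show "n (\<pi> s (?i w)) = (if s = t then w else \<zero>\<^bsub>W\<^esub>)" if t: "t \<in> I" and w: "w \<in> E t" for t w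
    proof -
      obtain v where v: "v \<in> D t" "w = n v" using w E[OF t] by auto
      then have "?i w = v" using Ds(1)[OF t] by (intro iI) auto
      then show ?thesis using diag[OF s t v(1)] v n0 by simp
    qed
  next
    fix w assume w: "w \<in> carrier W"
    have "{s \<in> I. n (\<pi> s (?i w)) \<noteq> \<zero>\<^bsub>W\<^esub>} = {s \<in> I. \<pi> s (?i w) \<noteq> \<zero>\<^bsub>V\<^esub>}"
      using nz \<pi>c i(1)[OF w] by auto
    then show "finite {s \<in> I. n (\<pi> s (?i w)) \<noteq> \<zero>\<^bsub>W\<^esub>}"
      using \<pi> i(1)[OF w] by (simp add: projections_def)
    assume "\<forall>s \<in> I. n (\<pi> s (?i w)) = \<zero>\<^bsub>W\<^esub>"
    then have "\<forall>s \<in> I. \<pi> s (?i w) = \<zero>\<^bsub>V\<^esub>" using nz \<pi>c i(1)[OF w] by auto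
    then have "?i w = \<zero>\<^bsub>V\<^esub>" using \<pi> i(1)[OF w] unfolding projections_def by blast
    then show "w = \<zero>\<^bsub>W\<^esub>" using i(2)[OF w] n0 by simp
  qed
  then show ?thesis by (rule projections_imp_internal_direct_sum[OF W])
qed

section \<open>Graded categories and the components of graded modules\<close>

locale graded_category =
  fixes k :: "('k, 'r) ring_scheme" and G :: "('g, 'h) monoid_scheme"
    and B :: "('o, 'g, 'k, 'b) graded_kcat"
  assumes cring: "cring k" and group: "group G" and graded: "graded_category_over k G B"
begin

sublocale G: group G by (rule group)

abbreviation smash :: "('o \<times> 'g, 'k, 'b) kcat" where "smash \<equiv> smash_product G B"

lemma objs_smash [simp]: "objs smash = objs B \<times> carrier G"
  by (simp add: smash_product_def)

lemma mor_smash [simp]: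
  "mor smash q p = (mor B (fst q) (fst p))
     \<lparr>carrier := homog B (fst q) (fst p) (inv\<^bsub>G\<^esub> snd q \<otimes>\<^bsub>G\<^esub> snd p)\<rparr>"
  by (simp add: smash_product_def split_beta)

lemma mcomp_smash [simp]: "mcomp smash r q p = mcomp B (fst r) (fst q) (fst p)"
  by (simp add: smash_product_def split_beta)

lemma ident_smash [simp]: "ident smash p = ident B (fst p)"
  by (simp add: smash_product_def split_beta)

lemma category_over: "category_over k B"
  using graded by (simp add: graded_category_over_def)

lemma category_over_smash: "category_over k smash"
  by (rule category_over_smash_product[OF group graded])

lemma mor_direct_sum:
  "\<lbrakk>x \<in> objs B; y \<in> objs B\<rbrakk> \<Longrightarrow> internal_direct_sum k (mor B y x) (carrier G) (homog B y x)"
  using graded by (simp add: graded_category_over_def)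

lemma mor_module: "\<lbrakk>x \<in> objs B; y \<in> objs B\<rbrakk> \<Longrightarrow> module k (mor B y x)"
  using category_over by (simp add: category_over_def)

lemma homog_submodule:
  "\<lbrakk>x \<in> objs B; y \<in> objs B; s \<in> carrier G\<rbrakk> \<Longrightarrow> submodule (homog B y x s) k (mor B y x)"
  by (rule internal_direct_sum_submodule[OF mor_direct_sum])

lemma homog_subset:
  "\<lbrakk>x \<in> objs B; y \<in> objs B; s \<in> carrier G\<rbrakk> \<Longrightarrow> homog B y x s \<subseteq> carrier (mor B y x)"
  by (rule submoduleD(1)[OF homog_submodule])

lemma mor_smash_subset:
  assumes "b \<in> carrier (mor smash q p)" "p \<in> objs smash" "q \<in> objs smash"
  shows "b \<in> carrier (mor B (fst q) (fst p))"
proof -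
  have "homog B (fst q) (fst p) (inv\<^bsub>G\<^esub> snd q \<otimes>\<^bsub>G\<^esub> snd p) \<subseteq> carrier (mor B (fst q) (fst p))"
    using assms(2,3) by (intro homog_subset) auto
  then show ?thesis using assms(1) by auto
qed

lemma inv_mult_cancel:
  assumes "s \<in> carrier G" "t \<in> carrier G"
  shows "inv\<^bsub>G\<^esub> s \<otimes>\<^bsub>G\<^esub> (s \<otimes>\<^bsub>G\<^esub> t) = t" "s \<otimes>\<^bsub>G\<^esub> (inv\<^bsub>G\<^esub> s \<otimes>\<^bsub>G\<^esub> t) = t"
    "(t \<otimes>\<^bsub>G\<^esub> s) \<otimes>\<^bsub>G\<^esub> inv\<^bsub>G\<^esub> s = t" "(t \<otimes>\<^bsub>G\<^esub> inv\<^bsub>G\<^esub> s) \<otimes>\<^bsub>G\<^esub> s = t"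
  using assms by (simp_all add: G.m_assoc[symmetric]) (simp_all add: G.m_assoc)

lemma graded_moduleD:
  assumes "graded_module k G B N"
  shows "left_module k B N"
    "x \<in> objs B \<Longrightarrow> internal_direct_sum k (fib N x) (carrier G) (deg N x)"
    "\<lbrakk>x \<in> objs B; s \<in> carrier G\<rbrakk> \<Longrightarrow> submodule (deg N x s) k (fib N x)"
    "\<lbrakk>x \<in> objs B; s \<in> carrier G\<rbrakk> \<Longrightarrow> deg N x s \<subseteq> carrier (fib N x)"
    "\<lbrakk>x \<in> objs B; y \<in> objs B; s \<in> carrier G; t \<in> carrier G; b \<in> homog B y x t; v \<in> deg N x s\<rbrakk>
      \<Longrightarrow> act N y x b v \<in> deg N y (t \<otimes>\<^bsub>G\<^esub> s)"
proof -
  show ids: "internal_direct_sum k (fib N x) (carrier G) (deg N x)" if "x \<in> objs B" for x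
    using assms that by (simp add: graded_module_def)
  show sub: "submodule (deg N x s) k (fib N x)" if "x \<in> objs B" "s \<in> carrier G" for x s
    by (rule internal_direct_sum_submodule[OF ids[OF that(1)] that(2)])
  show "deg N x s \<subseteq> carrier (fib N x)" if "x \<in> objs B" "s \<in> carrier G" for x s
    by (rule submoduleD(1)[OF sub[OF that]])
qed (use assms in \<open>simp_all add: graded_module_def\<close>)

text \<open>The \<open>smash\<close>-module of a graded module. The degree is inverted: \<open>inv t \<otimes> s\<close>, the degree of the
  morphisms from \<open>(x, s)\<close> to \<open>(y, t)\<close>, takes degree \<open>inv s\<close> to degree \<open>inv t\<close>.\<close>

definition homogeneous_parts ::
  "('o, 'g, 'k, 'b, 'm) graded_lmod \<Rightarrow> ('o \<times> 'g, 'k, 'b, 'm) lmod" where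
  "homogeneous_parts N =
     \<lparr>fib = (\<lambda>p. (fib N (fst p))\<lparr>carrier := deg N (fst p) (inv\<^bsub>G\<^esub> snd p)\<rparr>),
      act = (\<lambda>q p. act N (fst q) (fst p))\<rparr>"

lemma fib_homogeneous_parts [simp]:
  "fib (homogeneous_parts N) p = (fib N (fst p))\<lparr>carrier := deg N (fst p) (inv\<^bsub>G\<^esub> snd p)\<rparr>"
  by (simp add: homogeneous_parts_def)

lemma act_homogeneous_parts [simp]:
  "act (homogeneous_parts N) q p = act N (fst q) (fst p)"
  by (simp add: homogeneous_parts_def)

lemma homogeneous_parts_subset:
  assumes "graded_module k G B N" "v \<in> carrier (fib (homogeneous_parts N) p)" "p \<in> objs smash"
  shows "v \<in> carrier (fib N (fst p))"
proof -
  have "deg N (fst p) (inv\<^bsub>G\<^esub> snd p) \<subseteq> carrier (fib N (fst p))"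
    using assms(3) by (intro graded_moduleD(4)[OF assms(1)]) auto
  then show ?thesis using assms(2) by auto
qed

lemma left_module_homogeneous_parts:
  assumes N: "graded_module k G B N"
  shows "left_module k smash (homogeneous_parts N)"
proof -
  note Nd = graded_moduleD[OF N] and Nl = left_moduleD[OF graded_moduleD(1)[OF N]]
  \<comment> \<open>The degrees multiply as
    \<open>(inv t \<otimes> s) \<otimes> inv s = inv t\<close>, which is where the inversion of
    degrees is used.\<close>
  have closed: "act N y x b v \<in> deg N y (inv\<^bsub>G\<^esub> t)"
    if "x \<in> objs B" "y \<in> objs B" "s \<in> carrier G" "t \<in> carrier G"
      "b \<in> homog B y x (inv\<^bsub>G\<^esub> t \<otimes>\<^bsub>G\<^esub> s)" "v \<in> deg N x (inv\<^bsub>G\<^esub> s)" for x y s t b v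
    using Nd(5)[OF that(1,2) _ _ that(5,6)] that by (simp add: inv_mult_cancel)
  show ?thesis
    unfolding left_module_def
  proof (intro conjI ballI)
    fix p assume p: "p \<in> objs smash"
    then have x: "fst p \<in> objs B" and s: "inv\<^bsub>G\<^esub> snd p \<in> carrier G" by auto
    show "module k (fib (homogeneous_parts N) p)"
      using submodule.submodule_is_module[OF Nd(3)[OF x s] Nl(1)[OF x]] by simp
    show "act (homogeneous_parts N) p p (ident smash p) v = v"
      if "v \<in> carrier (fib (homogeneous_parts N) p)" for v
      using that Nl(5)[OF x] Nd(4)[OF x s] by auto
  next
    fix p q r c b v
    assume p: "p \<in> objs smash" and q: "q \<in> objs smash" and r: "r \<in> objs smash"
      and c: "c \<in> carrier (mor smash r q)" and b: "b \<in> carrier (mor smash q p)"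
      and v: "v \<in> carrier (fib (homogeneous_parts N) p)"
    have "c \<in> carrier (mor B (fst r) (fst q))" "b \<in> carrier (mor B (fst q) (fst p))"
      using c b p q r by (blast intro: mor_smash_subset)+
    moreover have "v \<in> carrier (fib N (fst p))" using v p by (rule homogeneous_parts_subset[OF N])
    ultimately show "act (homogeneous_parts N) r p (mcomp smash r q p c b) v
      = act (homogeneous_parts N) r q c (act (homogeneous_parts N) q p b v)"
      using p q r Nl(4) by auto
  next
    fix p q assume p: "p \<in> objs smash" and q: "q \<in> objs smash"
    then have bil: "bilinear_map k (mor B (fst q) (fst p)) (fib N (fst p)) (fib N (fst q)) (act N (fst q) (fst p))"
      by (intro Nl(2)) auto
    have h: "homog B (fst q) (fst p) (inv\<^bsub>G\<^esub> snd q \<otimes>\<^bsub>G\<^esub> snd p) \<subseteq> carrier (mor B (fst q) (fst p))"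
      using p q by (intro homog_subset) auto
    have d: "deg N (fst p) (inv\<^bsub>G\<^esub> snd p) \<subseteq> carrier (fib N (fst p))" using p by (intro Nd(4)) auto
    have cl: "act N (fst q) (fst p) b v \<in> deg N (fst q) (inv\<^bsub>G\<^esub> snd q)"
      if "b \<in> homog B (fst q) (fst p) (inv\<^bsub>G\<^esub> snd q \<otimes>\<^bsub>G\<^esub> snd p)" "v \<in> deg N (fst p) (inv\<^bsub>G\<^esub> snd p)" for b v
      using p q that by (intro closed[of _ _ "snd p"]) auto
    show "bilinear_map k (mor smash q p) (fib (homogeneous_parts N) p) (fib (homogeneous_parts N) q)
        (act (homogeneous_parts N) q p)"
      using bil h d cl unfolding bilinear_map_def linear_map_def by (auto simp: subset_iff)
  qed
qed

text \<open>Transport along the identity moves no element but makes the record extensional: in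
  \<open>homogeneous_parts\<close> the operations are still those of the whole of
  \<open>fib N x\<close>, with values outside the component.\<close>

definition smash_module ::
  "('o, 'g, 'k, 'b, 'm) graded_lmod \<Rightarrow> ('o \<times> 'g, 'k, 'b, 'm) lmod" where
  "smash_module N = transport k smash (\<lambda>_ v. v) (homogeneous_parts N)"

definition smash_map ::
  "('o, 'g, 'k, 'b, 'm) graded_lmod \<Rightarrow> ('o \<Rightarrow> 'm \<Rightarrow> 'm) \<Rightarrow> ('o \<times> 'g \<Rightarrow> 'm \<Rightarrow> 'm)" where
  "smash_map N \<eta> = restrict_family smash (smash_module N) (\<lambda>p. \<eta> (fst p))"

lemma carrier_smash_module [simp]:
  "\<lbrakk>x \<in> objs B; s \<in> carrier G\<rbrakk> \<Longrightarrow> carrier (fib (smash_module N) (x, s)) = deg N x (inv\<^bsub>G\<^esub> s)"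
  unfolding smash_module_def by (subst carrier_fib_transport) simp_all

lemma left_module_smash_module:
  "graded_module k G B N \<Longrightarrow> left_module k smash (smash_module N)"
  unfolding smash_module_def
  by (rule left_module_transport[OF category_over_smash left_module_homogeneous_parts]) simp_all

lemma extensional_lmod_smash_module: "extensional_lmod k smash (smash_module N)"
  unfolding smash_module_def by (rule extensional_lmod_transport)

lemma equivariant_to_smash_module:
  "graded_module k G B N \<Longrightarrow> equivariant k smash (homogeneous_parts N) (smash_module N) (\<lambda>_ v. v)"
  unfolding smash_module_def
  by (rule equivariant_transport[OF left_module_homogeneous_parts]) simp_all

lemma equivariant_of_smash_module:
  assumes N: "graded_module k G B N"
  shows "equivariant k smash (smash_module N) (homogeneous_parts N) (\<lambda>_ v. v)"
proof -
  have "equivariant k smash (smash_module N) (homogeneous_parts N)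
      (\<lambda>p. inv_into (carrier (fib (homogeneous_parts N) p)) (\<lambda>v. v))"
    by (rule equivariant_inv[OF left_module_homogeneous_parts[OF N] left_module_smash_module[OF N]
          equivariant_to_smash_module[OF N]])
      (auto simp: bij_betw_def)
  then show ?thesis
    by (subst equivariant_cong[OF left_module_smash_module[OF N],
          where \<theta> = "\<lambda>p. inv_into (carrier (fib (homogeneous_parts N) p)) (\<lambda>v. v)"])
      (auto simp: inv_into_f_f[of "\<lambda>v. v", simplified])
qed

text \<open>Allows morphisms of smash modules to be computed with the operations of the graded
  modules themselves.\<close>

lemma equivariant_smash_module_iff:
  assumes N: "graded_module k G B N" and P: "graded_module k G B P"
  shows "equivariant k smash (smash_module N) (smash_module P) \<xi>
    \<longleftrightarrow> equivariant k smash (homogeneous_parts N) (homogeneous_parts P) \<xi>"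
  using equivariant_compose[OF equivariant_compose[OF equivariant_to_smash_module[OF N]]
      equivariant_of_smash_module[OF P], of \<xi>]
    equivariant_compose[OF equivariant_compose[OF equivariant_of_smash_module[OF N]]
      equivariant_to_smash_module[OF P], of \<xi>]
  by auto

lemma equivariant_homogeneous_parts:
  assumes N: "graded_module k G B N" and \<eta>: "equivariant k B N P \<eta>"
    and deg: "\<And>x s. \<lbrakk>x \<in> objs B; s \<in> carrier G\<rbrakk> \<Longrightarrow> \<eta> x ` deg N x s \<subseteq> deg P x s"
  shows "equivariant k smash (homogeneous_parts N) (homogeneous_parts P) (\<lambda>p. \<eta> (fst p))"
  unfolding equivariant_def
proof (intro conjI ballI)
  fix p assume p: "p \<in> objs smash"
  then have "deg N (fst p) (inv\<^bsub>G\<^esub> snd p) \<subseteq> carrier (fib N (fst p))"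
    by (intro graded_moduleD(4)[OF N]) auto
  then show "linear_map k (fib (homogeneous_parts N) p) (fib (homogeneous_parts P) p) (\<eta> (fst p))"
    using linear_mapD(2,3)[OF equivariantD(1)[OF \<eta>, of "fst p"]] deg[of "fst p" "inv\<^bsub>G\<^esub> snd p"] p
    by (intro linear_mapI) (auto simp: subset_iff image_subset_iff)
next
  fix p q b v
  assume p: "p \<in> objs smash" and q: "q \<in> objs smash" and b: "b \<in> carrier (mor smash q p)"
    and v: "v \<in> carrier (fib (homogeneous_parts N) p)"
  have "b \<in> carrier (mor B (fst q) (fst p))" using b p q by (rule mor_smash_subset)
  moreover have "v \<in> carrier (fib N (fst p))" using v p by (rule homogeneous_parts_subset[OF N])
  ultimately show "\<eta> (fst q) (act (homogeneous_parts N) q p b v)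
      = act (homogeneous_parts P) q p b (\<eta> (fst p) v)"
    using p q equivariantD(3)[OF \<eta>] by auto
qed

text \<open>The core of fullness. The maps on the components at \<open>x\<close> extend linearly to
  \<open>fib N x\<close>; both sides of the equivariance law are bilinear in the morphism and the
  element, so homogeneous arguments suffice.\<close>

lemma equivariant_extension:
  assumes N: "graded_module k G B N" and P: "graded_module k G B P"
    and \<xi>: "equivariant k smash (homogeneous_parts N) (homogeneous_parts P) \<xi>"
  obtains \<eta> where "equivariant k B N P \<eta>"
    "\<And>x s v. \<lbrakk>x \<in> objs B; s \<in> carrier G; v \<in> deg N x s\<rbrakk> \<Longrightarrow> \<eta> x v = \<xi> (x, inv\<^bsub>G\<^esub> s) v"
proof -
  note Nd = graded_moduleD[OF N] and Nl = left_moduleD[OF graded_moduleD(1)[OF N]]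
  note Pd = graded_moduleD[OF P] and Pl = left_moduleD[OF graded_moduleD(1)[OF P]]
  have "\<exists>g. linear_map k (fib N x) (fib P x) g \<and>
      (\<forall>s \<in> carrier G. \<forall>v \<in> deg N x s. g v = \<xi> (x, inv\<^bsub>G\<^esub> s) v)" if x: "x \<in> objs B" for x
  proof -
    have "linear_map k ((fib N x)\<lparr>carrier := deg N x s\<rparr>) (fib P x) (\<xi> (x, inv\<^bsub>G\<^esub> s))"
      if s: "s \<in> carrier G" for s
      using linear_mapD[OF equivariantD(1)[OF \<xi>, of "(x, inv\<^bsub>G\<^esub> s)"]] x s Pd(4)[OF x s]
      by (intro linear_mapI) (auto simp: subset_iff)
    then obtain g where "linear_map k (fib N x) (fib P x) g"
      "\<And>s v. \<lbrakk>s \<in> carrier G; v \<in> deg N x s\<rbrakk> \<Longrightarrow> g v = \<xi> (x, inv\<^bsub>G\<^esub> s) v"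
      using linear_map_extension[OF Nl(1)[OF x] Pl(1)[OF x] Nd(2)[OF x],
          where h = "\<lambda>s. \<xi> (x, inv\<^bsub>G\<^esub> s)"] by blast
    then show ?thesis by blast
  qed
  then obtain \<eta> where lin: "\<And>x. x \<in> objs B \<Longrightarrow> linear_map k (fib N x) (fib P x) (\<eta> x)"
    and \<eta>: "\<And>x s v. \<lbrakk>x \<in> objs B; s \<in> carrier G; v \<in> deg N x s\<rbrakk> \<Longrightarrow> \<eta> x v = \<xi> (x, inv\<^bsub>G\<^esub> s) v"
    by metis
  have "\<eta> y (act N y x b v) = act P y x b (\<eta> x v)"
    if x: "x \<in> objs B" and y: "y \<in> objs B" and b: "b \<in> carrier (mor B y x)"
      and v: "v \<in> carrier (fib N x)" for x y b v
  proof (rule bilinear_map_eq_on_direct_sums[OF mor_module[OF x y] Nl(1)[OF x] Pl(1)[OF y]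
        mor_direct_sum[OF x y] Nd(2)[OF x] bilinear_map_compose[OF Nl(2)[OF x y] lin[OF y]]
        bilinear_map_precompose[OF Pl(2)[OF x y] lin[OF x]] _ b v])
    fix t s b v assume t: "t \<in> carrier G" and s: "s \<in> carrier G"
      and b: "b \<in> homog B y x t" and v: "v \<in> deg N x s"
    have "\<eta> y (act N y x b v) = \<xi> (y, inv\<^bsub>G\<^esub> (t \<otimes>\<^bsub>G\<^esub> s)) (act N y x b v)"
      using Nd(5)[OF x y s t b v] s t y by (intro \<eta>) auto
    \<comment> \<open>A morphism \<open>b\<close> of degree \<open>t\<close> is an arrow of the
      smash product from \<open>(x, inv s)\<close> to \<open>(y, inv (t \<otimes> s))\<close>,
      because \<open>(t \<otimes> s) \<otimes> inv s = t\<close>; there \<open>\<xi>\<close> is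
      equivariant.\<close>
    also have "\<dots> = act P y x b (\<xi> (x, inv\<^bsub>G\<^esub> s) v)"
      using equivariantD(3)[OF \<xi>, of "(x, inv\<^bsub>G\<^esub> s)" "(y, inv\<^bsub>G\<^esub> (t \<otimes>\<^bsub>G\<^esub> s))" b v] x y s t b v
      by (simp add: inv_mult_cancel)
    finally show "\<eta> y (act N y x b v) = act P y x b (\<eta> x v)" using \<eta>[OF x s v] by simp
  qed
  with lin have "equivariant k B N P \<eta>" by (simp add: equivariant_def)
  with \<eta> show ?thesis using that by blast
qed

section \<open>Functoriality and full faithfulness\<close>

lemma is_functor_smash:
  "is_functor
     (graded_module_category k G B :: (('o, 'g, 'k, 'b, 'm) graded_lmod, 'o \<Rightarrow> 'm \<Rightarrow> 'm) cat)
     (module_category k smash) smash_module (\<lambda>N P. smash_map N)"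
  (is "is_functor ?A ?C _ _")
proof -
  have eq: "equivariant k smash (smash_module N) (smash_module P) (\<lambda>p. \<eta> (fst p))"
    if "graded_module k G B N" "graded_module k G B P" "\<eta> \<in> graded_morphisms k G B N P" for N P \<eta>
    using that unfolding equivariant_smash_module_iff[OF that(1,2)]
    by (intro equivariant_homogeneous_parts) (auto simp: graded_morphisms_def module_morphisms_iff)
  have sub: "v \<in> carrier (fib N (fst p))"
    if "graded_module k G B N" "p \<in> objs smash" "v \<in> carrier (fib (smash_module N) p)"
    for N :: "('o, 'g, 'k, 'b, 'm) graded_lmod" and p v
    using graded_moduleD(4)[OF that(1), of "fst p" "inv\<^bsub>G\<^esub> snd p"] that(2,3) by auto
  show ?thesis
    unfolding is_functor_def
  proof (intro conjI ballI Pi_I)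
    show "smash_module N \<in> obj ?C" if "N \<in> obj ?A" for N
      using that
      by (simp add: graded_module_category_def module_category_def
          left_module_smash_module extensional_lmod_smash_module)
    show "smash_map N \<eta> \<in> arr ?C (smash_module N) (smash_module P)"
      if "N \<in> obj ?A" "P \<in> obj ?A" "\<eta> \<in> arr ?A N P" for N P \<eta>
      using that unfolding smash_map_def module_category_def graded_module_category_def
      by (simp add: restrict_family_morphism left_module_smash_module eq)
    show "smash_map N (idt ?A N) = idt ?C (smash_module N)" if "N \<in> obj ?A" for N
    proof -
      have N: "graded_module k G B N" using that by (simp add: graded_module_category_def)
      have "restrict_family B N (\<lambda>x v. v) (fst p) v = v"
        if "p \<in> objs smash" "v \<in> carrier (fib (smash_module N) p)" for p v
        using sub[OF N that] that(1) by (intro restrict_family_apply) auto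
      then show ?thesis
        unfolding smash_map_def module_category_def graded_module_category_def
        by (auto simp: identity_morphism_eq intro!: restrict_family_cong)
    qed
    fix N P Q \<eta> \<theta>
    assume N: "N \<in> obj ?A" "P \<in> obj ?A" "Q \<in> obj ?A" and "\<eta> \<in> arr ?A N P" "\<theta> \<in> arr ?A P Q"
    then have e: "\<eta> \<in> graded_morphisms k G B N P" and g: "graded_module k G B N" "graded_module k G B P"
      by (simp_all add: graded_module_category_def)
    have pt: "smash_map P \<theta> p (smash_map N \<eta> p v) = compose_morphisms B N \<theta> \<eta> (fst p) v"
      if p: "p \<in> objs smash" and v: "v \<in> carrier (fib (smash_module N) p)" for p v
    proof -
      have "smash_map N \<eta> p v = \<eta> (fst p) v"
        using p v unfolding smash_map_def by (rule restrict_family_apply)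
      \<comment> \<open>Preservation of degrees puts this value into the fibre of the next smash
        module, where the restricted \<open>\<theta>\<close> agrees with
        \<open>\<theta>\<close>.\<close>
      moreover have "\<eta> (fst p) v \<in> carrier (fib (smash_module P) p)"
        using e p v by (auto simp: graded_morphisms_def image_subset_iff)
      then have "smash_map P \<theta> p (\<eta> (fst p) v) = \<theta> (fst p) (\<eta> (fst p) v)"
        using p unfolding smash_map_def by (intro restrict_family_apply)
      moreover have "compose_morphisms B N \<theta> \<eta> (fst p) v = \<theta> (fst p) (\<eta> (fst p) v)"
        using sub[OF g(1) p v] p unfolding compose_morphisms_eq by (intro restrict_family_apply) auto
      ultimately show ?thesis by simp
    qed
    show "smash_map N (cmp ?A N P Q \<theta> \<eta>)
      = cmp ?C (smash_module N) (smash_module P) (smash_module Q) (smash_map P \<theta>) (smash_map N \<eta>)"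
      unfolding smash_map_def[of N "cmp ?A N P Q \<theta> \<eta>"]
      by (simp add: module_category_def graded_module_category_def compose_morphisms_eq[of smash])
        (rule restrict_family_cong, rule pt[symmetric], simp_all)
  qed
qed

text \<open>Faithful because homogeneous elements generate each \<open>fib N x\<close>. Full by
  linear extension of equivariant families; the extension preserves degrees since the fibre at
  \<open>(x, inv s)\<close> is the component of degree \<open>s\<close>.\<close>

lemma bij_betw_smash_map:
  fixes N P :: "('o, 'g, 'k, 'b, 'm) graded_lmod"
  assumes N: "graded_module k G B N" and P: "graded_module k G B P"
  shows "bij_betw (smash_map N) (graded_morphisms k G B N P)
    (module_morphisms k smash (smash_module N) (smash_module P))"
proof (rule bij_betw_imageI)
  note Nd = graded_moduleD[OF N] and Nl = left_moduleD[OF graded_moduleD(1)[OF N]]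
  note Pl = left_moduleD[OF graded_moduleD(1)[OF P]]
  have smash_map: "smash_map N \<eta> (x, inv\<^bsub>G\<^esub> s) v = \<eta> x v"
    if "x \<in> objs B" "s \<in> carrier G" "v \<in> deg N x s" for \<eta> :: "'o \<Rightarrow> 'm \<Rightarrow> 'm" and x s v
    unfolding smash_map_def using that by (subst restrict_family_apply) simp_all
  show "inj_on (smash_map N) (graded_morphisms k G B N P)"
  proof (rule inj_onI)
    fix \<eta> \<theta> assume \<eta>: "\<eta> \<in> graded_morphisms k G B N P" and \<theta>: "\<theta> \<in> graded_morphisms k G B N P"
      and eq: "smash_map N \<eta> = smash_map N \<theta>"
    have m: "\<eta> \<in> module_morphisms k B N P" "\<theta> \<in> module_morphisms k B N P"
      using \<eta> \<theta> by (simp_all add: graded_morphisms_def)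
    have "\<eta> x v = \<theta> x v" if x: "x \<in> objs B" and v: "v \<in> carrier (fib N x)" for x v
    proof (rule linear_map_eq_on_direct_sum[OF Nl(1)[OF x] Pl(1)[OF x] Nd(2)[OF x] _ _ _ v])
      show "linear_map k (fib N x) (fib P x) (\<eta> x)" "linear_map k (fib N x) (fib P x) (\<theta> x)"
        using m x by (simp_all add: module_morphisms_def)
      show "\<eta> x v = \<theta> x v" if "s \<in> carrier G" "v \<in> deg N x s" for s v
        using smash_map[OF x that] smash_map[OF x that] eq by metis
    qed
    then have "restrict_family B N \<eta> = restrict_family B N \<theta>" by (rule restrict_family_cong)
    then show "\<eta> = \<theta>" using m restrict_family_of_morphism by metis
  qed
  show "smash_map N ` graded_morphisms k G B N P = module_morphisms k smash (smash_module N) (smash_module P)"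
  proof (intro equalityI subsetI)
    fix \<xi> assume "\<xi> \<in> smash_map N ` graded_morphisms k G B N P"
    then obtain \<eta> where \<eta>: "\<eta> \<in> graded_morphisms k G B N P" "\<xi> = smash_map N \<eta>" by auto
    then have "equivariant k smash (smash_module N) (smash_module P) (\<lambda>p. \<eta> (fst p))"
      unfolding equivariant_smash_module_iff[OF N P]
      by (intro equivariant_homogeneous_parts[OF N]) (auto simp: graded_morphisms_def module_morphisms_iff)
    then show "\<xi> \<in> module_morphisms k smash (smash_module N) (smash_module P)"
      unfolding \<eta>(2) smash_map_def by (rule restrict_family_morphism[OF left_module_smash_module[OF N]])
  next
    fix \<xi> assume \<xi>: "\<xi> \<in> module_morphisms k smash (smash_module N) (smash_module P)"
    then have e: "equivariant k smash (homogeneous_parts N) (homogeneous_parts P) \<xi>"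
      using equivariant_smash_module_iff[OF N P] by (simp add: module_morphisms_iff)
    obtain \<eta> where \<eta>: "equivariant k B N P \<eta>"
      and \<eta>\<xi>: "\<And>x s v. \<lbrakk>x \<in> objs B; s \<in> carrier G; v \<in> deg N x s\<rbrakk> \<Longrightarrow> \<eta> x v = \<xi> (x, inv\<^bsub>G\<^esub> s) v"
      using equivariant_extension[OF N P e] by blast
    let ?\<eta> = "restrict_family B N \<eta>"
    have \<eta>': "?\<eta> x v = \<xi> (x, inv\<^bsub>G\<^esub> s) v" if "x \<in> objs B" "s \<in> carrier G" "v \<in> deg N x s" for x s v
      using \<eta>\<xi>[OF that] Nd(4)[OF that(1,2)] that by auto
    have "?\<eta> \<in> module_morphisms k B N P" by (rule restrict_family_morphism[OF Nd(1) \<eta>])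
    moreover have "\<xi> (x, inv\<^bsub>G\<^esub> s) v \<in> deg P x s" if "x \<in> objs B" "s \<in> carrier G" "v \<in> deg N x s" for x s v
      using equivariantD(2)[OF e, of "(x, inv\<^bsub>G\<^esub> s)" v] that by simp
    ultimately have "?\<eta> \<in> graded_morphisms k G B N P"
      using \<eta>' by (auto simp: graded_morphisms_def)
    moreover have "smash_map N ?\<eta> = restrict_family smash (smash_module N) \<xi>"
      unfolding smash_map_def
    proof (rule restrict_family_cong)
      fix p v assume "p \<in> objs smash" "v \<in> carrier (fib (smash_module N) p)"
      then show "?\<eta> (fst p) v = \<xi> p v"
        using \<eta>'[of "fst p" "inv\<^bsub>G\<^esub> snd p" v] by auto
    qed
    ultimately show "\<xi> \<in> smash_map N ` graded_morphisms k G B N P"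
      using restrict_family_of_morphism[OF \<xi>] by (metis imageI)
  qed
qed

text \<open>Equal smash modules give a map \<open>\<eta>\<close> that fixes every homogeneous
  element, but it may rename elements of mixed degree, so \<open>N = P\<close> does not follow from
  \<open>eq\<close> alone. The assumption \<open>names\<close> rules such a renaming out.\<close>

lemma graded_lmod_eqI:
  assumes N: "N \<in> obj (graded_module_category k G B)" and P: "P \<in> obj (graded_module_category k G B)"
    and eq: "smash_module N = smash_module P"
    and names: "\<And>x \<eta> v. \<lbrakk>x \<in> objs B; linear_map k (fib N x) (fib P x) \<eta>;
        \<And>s w. \<lbrakk>s \<in> carrier G; w \<in> deg N x s\<rbrakk> \<Longrightarrow> \<eta> w = w; v \<in> carrier (fib N x)\<rbrakk> \<Longrightarrow> \<eta> v = v"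
  shows "N = P"
proof -
  have Ng: "graded_module k G B N" and Pg: "graded_module k G B P"
    and Ne: "extensional_lmod k B N" "extensional_grading G B N"
    and Pe: "extensional_lmod k B P" "extensional_grading G B P"
    using N P by (simp_all add: graded_module_category_def)
  note Nd = graded_moduleD[OF Ng] and Pd = graded_moduleD[OF Pg]
  have deg: "deg N x s = deg P x s" if "x \<in> objs B" "s \<in> carrier G" for x s
    using carrier_smash_module[of x "inv\<^bsub>G\<^esub> s" N] carrier_smash_module[of x "inv\<^bsub>G\<^esub> s" P] eq that by simp
  have "equivariant k smash (smash_module N) (smash_module P) (\<lambda>_ v. v)"
    unfolding eq by (rule equivariant_id[OF left_module_smash_module[OF Pg]])
  then have "equivariant k smash (homogeneous_parts N) (homogeneous_parts P) (\<lambda>_ v. v)"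
    by (simp only: equivariant_smash_module_iff[OF Ng Pg])
  then obtain \<eta> where \<eta>: "equivariant k B N P \<eta>"
    and fixed: "\<And>x s v. \<lbrakk>x \<in> objs B; s \<in> carrier G; v \<in> deg N x s\<rbrakk> \<Longrightarrow> \<eta> x v = v"
    using equivariant_extension[OF Ng Pg] by metis
  have id: "\<eta> x v = v" if "x \<in> objs B" "v \<in> carrier (fib N x)" for x v
    using names[OF that(1) equivariantD(1)[OF \<eta> that(1)] fixed[OF that(1)] that(2)] .
  \<comment> \<open>The image of \<open>\<eta> x\<close> contains the components, which both modules
    share, and is closed under sums, so it is all of the fibre of \<open>P\<close>. Since
    \<open>\<eta> x\<close> moves nothing, this is an inclusion of carriers.\<close>
  have sub: "carrier (fib P x) \<subseteq> carrier (fib N x)" if x: "x \<in> objs B" for x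
  proof
    interpret N: module k "fib N x" by (rule left_moduleD(1)[OF Nd(1) x])
    note lin = equivariantD(1)[OF \<eta> x]
    fix v assume "v \<in> carrier (fib P x)"
    with left_moduleD(1)[OF Pd(1) x] Pd(2)[OF x] have "v \<in> \<eta> x ` carrier (fib N x)"
    proof (induction v rule: internal_direct_sum_induct)
      case zero
      then show ?case
        using linear_map_zero[OF N.module_axioms left_moduleD(1)[OF Pd(1) x] lin]
        by (metis N.M.zero_closed imageI)
    next
      case (add v w)
      then obtain v' w' where "v' \<in> carrier (fib N x)" "v = \<eta> x v'"
        "w' \<in> carrier (fib N x)" "w = \<eta> x w'" by auto
      then show ?case using linear_mapD(2)[OF lin, of v' w'] by (metis N.M.a_closed imageI)
    next
      case (homogeneous s v)
      then have v: "v \<in> deg N x s" using deg[OF x] by simp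
      then have "v \<in> carrier (fib N x)" using Nd(4)[OF x] homogeneous(1) by blast
      with fixed[OF x homogeneous(1) v] show ?case by (metis imageI)
    qed
    then show "v \<in> carrier (fib N x)" using id[OF x] by auto
  qed
  have "carrier (fib N x) = carrier (fib P x)" if x: "x \<in> objs B" for x
    using sub[OF x] id[OF x] equivariantD(2)[OF \<eta> x] by (metis subsetI subset_antisym)
  moreover have "equivariant k B N P (\<lambda>_ v. v)"
    using \<eta> id by (subst equivariant_cong[OF Nd(1), where \<theta> = \<eta>]) simp_all
  ultimately have "fib N = fib P" "act N = act P"
    using extensional_lmod_eqI[OF Nd(1) Ne(1) Pd(1) Pe(1)] by blast+
  moreover have "deg N = deg P"
  proof (intro ext)
    show "deg N x s = deg P x s" for x s
      using deg Ne(2) Pe(2) unfolding extensional_grading_def by (cases "x \<in> objs B \<and> s \<in> carrier G") auto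
  qed
  ultimately show ?thesis by (intro graded_lmod.equality) simp_all
qed

section \<open>Renaming the elements of a graded module\<close>

definition graded_transport ::
  "('o \<Rightarrow> 'm \<Rightarrow> 'n) \<Rightarrow> ('o, 'g, 'k, 'b, 'm) graded_lmod \<Rightarrow> ('o, 'g, 'k, 'b, 'n) graded_lmod" where
  "graded_transport n N =
     \<lparr>fib = fib (transport k B n N), act = act (transport k B n N),
      deg = (\<lambda>x s. if x \<in> objs B \<and> s \<in> carrier G then n x ` deg N x s else undefined)\<rparr>"

lemma
  assumes N: "graded_module k G B N" and n: "\<And>x. x \<in> objs B \<Longrightarrow> inj_on (n x) (carrier (fib N x))"
  shows graded_transport_object: "graded_transport n N \<in> obj (graded_module_category k G B)"
    and equivariant_graded_transport: "equivariant k B N (graded_transport n N) n"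
proof -
  let ?T = "transport k B n N" and ?P = "graded_transport n N"
  note Nd = graded_moduleD[OF N]
  have eT: "equivariant k B N ?T n" by (rule equivariant_transport[OF Nd(1) n])
  have lT: "left_module k B ?T" by (rule left_module_transport[OF category_over Nd(1) n])
  show e: "equivariant k B N ?P n" using eT by (simp add: equivariant_def graded_transport_def)
  have l: "left_module k B ?P" using lT by (simp add: left_module_def graded_transport_def)
  have c: "carrier (fib ?P x) = n x ` carrier (fib N x)" if "x \<in> objs B" for x
    using that by (simp add: graded_transport_def)
  have "graded_module k G B ?P"
    unfolding graded_module_def
  proof (intro conjI ballI)
    show "internal_direct_sum k (fib ?P x) (carrier G) (deg ?P x)" if x: "x \<in> objs B" for x
      by (rule internal_direct_sum_image[OF left_moduleD(1)[OF Nd(1) x] left_moduleD(1)[OF l x]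
            equivariantD(1)[OF e x] _ Nd(2)[OF x]])
        (use x c n in \<open>auto simp: bij_betw_def graded_transport_def\<close>)
    fix x y s t b v assume *: "x \<in> objs B" "y \<in> objs B" "s \<in> carrier G" "t \<in> carrier G"
      "b \<in> homog B y x t" and "v \<in> deg ?P x s"
    then obtain w where w: "w \<in> deg N x s" "v = n x w" by (auto simp: graded_transport_def)
    have "b \<in> carrier (mor B y x)" "w \<in> carrier (fib N x)"
      using * w homog_subset Nd(4) by blast+
    then have "act ?P y x b v = n y (act N y x b w)" using equivariantD(3)[OF e] * w by simp
    then show "act ?P y x b v \<in> deg ?P y (t \<otimes>\<^bsub>G\<^esub> s)"
      using Nd(5)[OF *(1-5) w(1)] * by (simp add: graded_transport_def)
  qed (rule l)
  moreover have "extensional_lmod k B ?P"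
    using extensional_lmod_transport[of k B n N] by (simp add: extensional_lmod_def graded_transport_def)
  moreover have "extensional_grading G B ?P"
    by (simp add: extensional_grading_def graded_transport_def)
  ultimately show "?P \<in> obj (graded_module_category k G B)"
    by (simp add: graded_module_category_def)
qed

end

section \<open>The direct sum of a module over the smash product\<close>

text \<open>The external direct sum. Its elements are extensional functions on \<open>I\<close>, so
  that a code for such functions names them injectively. The operations are not fixed outside the
  carrier; this is left to the later transport.\<close>

definition family_module ::
  "('k, 'r) ring_scheme \<Rightarrow> 'i set \<Rightarrow> ('i \<Rightarrow> ('k, 'm) module) \<Rightarrow> ('k, 'i \<Rightarrow> 'm) module" where
  "family_module k I V =
     \<lparr>carrier = {\<phi> \<in> \<Pi>\<^sub>E i \<in> I. carrier (V i). finite {i \<in> I. \<phi> i \<noteq> \<zero>\<^bsub>V i\<^esub>}},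
      monoid.mult = undefined, monoid.one = undefined,
      ring.zero = (\<lambda>i \<in> I. \<zero>\<^bsub>V i\<^esub>), ring.add = (\<lambda>\<phi> \<psi>. \<lambda>i \<in> I. \<phi> i \<oplus>\<^bsub>V i\<^esub> \<psi> i),
      smult = (\<lambda>a \<phi>. \<lambda>i \<in> I. a \<odot>\<^bsub>V i\<^esub> \<phi> i)\<rparr>"

definition supported_families ::
  "('k, 'r) ring_scheme \<Rightarrow> 'i set \<Rightarrow> ('i \<Rightarrow> ('k, 'm) module) \<Rightarrow> 'i \<Rightarrow> ('i \<Rightarrow> 'm) set" where
  "supported_families k I V s =
     {\<phi> \<in> carrier (family_module k I V). \<forall>i \<in> I - {s}. \<phi> i = \<zero>\<^bsub>V i\<^esub>}"

lemma family_module_simps: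
  "\<zero>\<^bsub>family_module k I V\<^esub> = (\<lambda>i \<in> I. \<zero>\<^bsub>V i\<^esub>)"
  "\<phi> \<oplus>\<^bsub>family_module k I V\<^esub> \<psi> = (\<lambda>i \<in> I. \<phi> i \<oplus>\<^bsub>V i\<^esub> \<psi> i)"
  "a \<odot>\<^bsub>family_module k I V\<^esub> \<phi> = (\<lambda>i \<in> I. a \<odot>\<^bsub>V i\<^esub> \<phi> i)"
  by (simp_all add: family_module_def)

lemma family_moduleD:
  assumes "\<phi> \<in> carrier (family_module k I V)"
  shows "i \<in> I \<Longrightarrow> \<phi> i \<in> carrier (V i)" "\<phi> \<in> extensional I" "finite {i \<in> I. \<phi> i \<noteq> \<zero>\<^bsub>V i\<^esub>}"
  using assms by (auto simp: family_module_def PiE_iff)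

lemma family_moduleI:
  assumes "\<phi> \<in> extensional I" "\<And>i. i \<in> I \<Longrightarrow> \<phi> i \<in> carrier (V i)"
    "finite S" "\<And>i. i \<in> I - S \<Longrightarrow> \<phi> i = \<zero>\<^bsub>V i\<^esub>"
  shows "\<phi> \<in> carrier (family_module k I V)"
proof -
  have "finite {i \<in> I. \<phi> i \<noteq> \<zero>\<^bsub>V i\<^esub>}"
    using assms(4) by (intro finite_subset[OF _ assms(3)]) blast
  then show ?thesis using assms(1,2) by (simp add: family_module_def PiE_iff)
qed

section \<open>Finitely supported families as a direct sum\<close>

context
  fixes k :: "('k, 'r) ring_scheme" and I :: "'i set" and V :: "'i \<Rightarrow> ('k, 'm) module"
  assumes k: "cring k" and V: "\<And>i. i \<in> I \<Longrightarrow> module k (V i)"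
begin

private abbreviation "W \<equiv> family_module k I V"

lemma family_add_closed:
  assumes "\<phi> \<in> carrier W" "\<psi> \<in> carrier W" shows "\<phi> \<oplus>\<^bsub>W\<^esub> \<psi> \<in> carrier W"
proof (rule family_moduleI)
  show "finite ({i \<in> I. \<phi> i \<noteq> \<zero>\<^bsub>V i\<^esub>} \<union> {i \<in> I. \<psi> i \<noteq> \<zero>\<^bsub>V i\<^esub>})"
    using family_moduleD(3)[OF assms(1)] family_moduleD(3)[OF assms(2)] by simp
  fix i
  show "(\<phi> \<oplus>\<^bsub>W\<^esub> \<psi>) i \<in> carrier (V i)" if "i \<in> I"
  proof -
    interpret Vi: module k "V i" by (rule V[OF that])
    show ?thesis using that family_moduleD(1)[OF assms(1) that] family_moduleD(1)[OF assms(2) that]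
      by (simp add: family_module_simps)
  qed
  show "(\<phi> \<oplus>\<^bsub>W\<^esub> \<psi>) i = \<zero>\<^bsub>V i\<^esub>"
    if "i \<in> I - ({i \<in> I. \<phi> i \<noteq> \<zero>\<^bsub>V i\<^esub>} \<union> {i \<in> I. \<psi> i \<noteq> \<zero>\<^bsub>V i\<^esub>})"
  proof -
    have i: "i \<in> I" using that by simp
    interpret Vi: module k "V i" by (rule V[OF i])
    show ?thesis using that by (auto simp: family_module_simps)
  qed
qed (simp add: family_module_simps)

lemma family_smult_closed:
  assumes a: "a \<in> carrier k" and "\<phi> \<in> carrier W" shows "a \<odot>\<^bsub>W\<^esub> \<phi> \<in> carrier W"
proof (rule family_moduleI)
  show "finite {i \<in> I. \<phi> i \<noteq> \<zero>\<^bsub>V i\<^esub>}" by (rule family_moduleD(3)[OF assms(2)])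
  fix i
  show "(a \<odot>\<^bsub>W\<^esub> \<phi>) i \<in> carrier (V i)" if "i \<in> I"
  proof -
    interpret Vi: module k "V i" by (rule V[OF that])
    show ?thesis using that a family_moduleD(1)[OF assms(2) that] by (simp add: family_module_simps)
  qed
  show "(a \<odot>\<^bsub>W\<^esub> \<phi>) i = \<zero>\<^bsub>V i\<^esub>" if "i \<in> I - {i \<in> I. \<phi> i \<noteq> \<zero>\<^bsub>V i\<^esub>}"
  proof -
    have i: "i \<in> I" using that by simp
    interpret Vi: module k "V i" by (rule V[OF i])
    show ?thesis using that a by (auto simp: family_module_simps)
  qed
qed (simp add: family_module_simps)

lemma single_closed:
  assumes "s \<in> I" "v \<in> carrier (V s)"
  shows "(\<lambda>i \<in> I. if i = s then v else \<zero>\<^bsub>V i\<^esub>) \<in> carrier W"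
proof (rule family_moduleI[where S = "{s}"])
  show "(\<lambda>i \<in> I. if i = s then v else \<zero>\<^bsub>V i\<^esub>) i \<in> carrier (V i)" if "i \<in> I" for i
  proof -
    interpret Vi: module k "V i" by (rule V[OF that])
    show ?thesis using that assms(2) by simp
  qed
qed auto

text \<open>The laws hold coordinatewise. Additive inverses are obtained as multiples by minus one,
  so closure under scalars covers them.\<close>

lemma module_family_module: "module k W"
proof (rule moduleI[OF k])
  have zero: "\<zero>\<^bsub>W\<^esub> \<in> carrier W"
  proof (rule family_moduleI[where S = "{}"])
    show "\<zero>\<^bsub>W\<^esub> i \<in> carrier (V i)" if "i \<in> I" for i
    proof -
      interpret Vi: module k "V i" by (rule V[OF that])
      show ?thesis using that by (simp add: family_module_simps)
    qed
  qed (simp_all add: family_module_simps)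
  show "abelian_group W"
  proof (rule abelian_groupI)
    fix \<phi> \<psi> \<chi> assume c: "\<phi> \<in> carrier W" "\<psi> \<in> carrier W" "\<chi> \<in> carrier W"
    show "\<phi> \<oplus>\<^bsub>W\<^esub> \<psi> \<oplus>\<^bsub>W\<^esub> \<chi> = \<phi> \<oplus>\<^bsub>W\<^esub> (\<psi> \<oplus>\<^bsub>W\<^esub> \<chi>)"
      unfolding family_module_simps
    proof (rule restrict_ext)
      fix i assume i: "i \<in> I"
      interpret Vi: module k "V i" by (rule V[OF i])
      show "(\<lambda>i \<in> I. \<phi> i \<oplus>\<^bsub>V i\<^esub> \<psi> i) i \<oplus>\<^bsub>V i\<^esub> \<chi> i = \<phi> i \<oplus>\<^bsub>V i\<^esub> (\<lambda>i \<in> I. \<psi> i \<oplus>\<^bsub>V i\<^esub> \<chi> i) i"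
        using i family_moduleD(1)[OF c(1) i] family_moduleD(1)[OF c(2) i] family_moduleD(1)[OF c(3) i]
        by (simp add: Vi.M.a_assoc)
    qed
  next
    fix \<phi> \<psi> assume c: "\<phi> \<in> carrier W" "\<psi> \<in> carrier W"
    then show "\<phi> \<oplus>\<^bsub>W\<^esub> \<psi> \<in> carrier W" by (rule family_add_closed)
    show "\<phi> \<oplus>\<^bsub>W\<^esub> \<psi> = \<psi> \<oplus>\<^bsub>W\<^esub> \<phi>"
      unfolding family_module_simps
    proof (rule restrict_ext)
      fix i assume i: "i \<in> I"
      interpret Vi: module k "V i" by (rule V[OF i])
      show "\<phi> i \<oplus>\<^bsub>V i\<^esub> \<psi> i = \<psi> i \<oplus>\<^bsub>V i\<^esub> \<phi> i"
        using i family_moduleD(1)[OF c(1) i] family_moduleD(1)[OF c(2) i] by (simp add: Vi.M.a_comm)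
    qed
  next
    show "\<zero>\<^bsub>W\<^esub> \<in> carrier W" by (rule zero)
    fix \<phi> assume c: "\<phi> \<in> carrier W"
    show "\<zero>\<^bsub>W\<^esub> \<oplus>\<^bsub>W\<^esub> \<phi> = \<phi>"
    proof (rule extensionalityI[OF _ family_moduleD(2)[OF c]])
      fix i assume i: "i \<in> I"
      interpret Vi: module k "V i" by (rule V[OF i])
      show "(\<zero>\<^bsub>W\<^esub> \<oplus>\<^bsub>W\<^esub> \<phi>) i = \<phi> i"
        using i family_moduleD(1)[OF c i] by (simp add: family_module_simps)
    qed (simp add: family_module_simps)
    have "\<ominus>\<^bsub>k\<^esub> \<one>\<^bsub>k\<^esub> \<in> carrier k"
      using k by (simp add: cring.axioms(1) ring.ring_simprules(3) ring.ring_simprules(6))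
    then have "(\<ominus>\<^bsub>k\<^esub> \<one>\<^bsub>k\<^esub>) \<odot>\<^bsub>W\<^esub> \<phi> \<in> carrier W" using c by (rule family_smult_closed)
    moreover have "(\<ominus>\<^bsub>k\<^esub> \<one>\<^bsub>k\<^esub>) \<odot>\<^bsub>W\<^esub> \<phi> \<oplus>\<^bsub>W\<^esub> \<phi> = \<zero>\<^bsub>W\<^esub>"
      unfolding family_module_simps
    proof (rule restrict_ext)
      fix i assume i: "i \<in> I"
      interpret Vi: module k "V i" by (rule V[OF i])
      show "(\<lambda>i \<in> I. \<ominus>\<^bsub>k\<^esub> \<one>\<^bsub>k\<^esub> \<odot>\<^bsub>V i\<^esub> \<phi> i) i \<oplus>\<^bsub>V i\<^esub> \<phi> i = \<zero>\<^bsub>V i\<^esub>"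
        using i family_moduleD(1)[OF c i] Vi.smult_l_minus[of "\<one>\<^bsub>k\<^esub>" "\<phi> i"] by (simp add: Vi.M.l_neg)
    qed
    ultimately show "\<exists>\<psi> \<in> carrier W. \<psi> \<oplus>\<^bsub>W\<^esub> \<phi> = \<zero>\<^bsub>W\<^esub>" by blast
  qed
  fix a \<phi> assume a: "a \<in> carrier k" and c: "\<phi> \<in> carrier W"
  then show "a \<odot>\<^bsub>W\<^esub> \<phi> \<in> carrier W" by (rule family_smult_closed)
  fix b assume b: "b \<in> carrier k"
  show "(a \<oplus>\<^bsub>k\<^esub> b) \<odot>\<^bsub>W\<^esub> \<phi> = a \<odot>\<^bsub>W\<^esub> \<phi> \<oplus>\<^bsub>W\<^esub> b \<odot>\<^bsub>W\<^esub> \<phi>"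
    unfolding family_module_simps
  proof (rule restrict_ext)
    fix i assume i: "i \<in> I"
    interpret Vi: module k "V i" by (rule V[OF i])
    show "(a \<oplus>\<^bsub>k\<^esub> b) \<odot>\<^bsub>V i\<^esub> \<phi> i = (\<lambda>i \<in> I. a \<odot>\<^bsub>V i\<^esub> \<phi> i) i \<oplus>\<^bsub>V i\<^esub> (\<lambda>i \<in> I. b \<odot>\<^bsub>V i\<^esub> \<phi> i) i"
      using i a b family_moduleD(1)[OF c i] by (simp add: Vi.smult_l_distr)
  qed
  show "a \<otimes>\<^bsub>k\<^esub> b \<odot>\<^bsub>W\<^esub> \<phi> = a \<odot>\<^bsub>W\<^esub> (b \<odot>\<^bsub>W\<^esub> \<phi>)"
    unfolding family_module_simps
  proof (rule restrict_ext)
    fix i assume i: "i \<in> I"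
    interpret Vi: module k "V i" by (rule V[OF i])
    show "a \<otimes>\<^bsub>k\<^esub> b \<odot>\<^bsub>V i\<^esub> \<phi> i = a \<odot>\<^bsub>V i\<^esub> (\<lambda>i \<in> I. b \<odot>\<^bsub>V i\<^esub> \<phi> i) i"
      using i a b family_moduleD(1)[OF c i] by (simp add: Vi.smult_assoc1)
  qed
next
  fix a \<phi> \<psi> assume a: "a \<in> carrier k" and c: "\<phi> \<in> carrier W" "\<psi> \<in> carrier W"
  show "a \<odot>\<^bsub>W\<^esub> (\<phi> \<oplus>\<^bsub>W\<^esub> \<psi>) = a \<odot>\<^bsub>W\<^esub> \<phi> \<oplus>\<^bsub>W\<^esub> a \<odot>\<^bsub>W\<^esub> \<psi>"
    unfolding family_module_simps
  proof (rule restrict_ext)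
    fix i assume i: "i \<in> I"
    interpret Vi: module k "V i" by (rule V[OF i])
    show "a \<odot>\<^bsub>V i\<^esub> (\<lambda>i \<in> I. \<phi> i \<oplus>\<^bsub>V i\<^esub> \<psi> i) i
        = (\<lambda>i \<in> I. a \<odot>\<^bsub>V i\<^esub> \<phi> i) i \<oplus>\<^bsub>V i\<^esub> (\<lambda>i \<in> I. a \<odot>\<^bsub>V i\<^esub> \<psi> i) i"
      using i a family_moduleD(1)[OF c(1) i] family_moduleD(1)[OF c(2) i] by (simp add: Vi.smult_r_distr)
  qed
next
  fix \<phi> assume c: "\<phi> \<in> carrier W"
  show "\<one>\<^bsub>k\<^esub> \<odot>\<^bsub>W\<^esub> \<phi> = \<phi>"
  proof (rule extensionalityI[OF _ family_moduleD(2)[OF c]])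
    fix i assume i: "i \<in> I"
    interpret Vi: module k "V i" by (rule V[OF i])
    show "(\<one>\<^bsub>k\<^esub> \<odot>\<^bsub>W\<^esub> \<phi>) i = \<phi> i"
      using i family_moduleD(1)[OF c i] by (simp add: family_module_simps)
  qed (simp add: family_module_simps)
qed

lemma internal_direct_sum_family_module:
  "internal_direct_sum k W I (supported_families k I V)"
proof -
  let ?\<pi> = "\<lambda>s \<phi>. \<lambda>i \<in> I. if i = s then \<phi> i else \<zero>\<^bsub>V i\<^esub>"
  have \<pi>: "?\<pi> s \<phi> \<in> carrier W" if "s \<in> I" "\<phi> \<in> carrier W" for s \<phi>
  proof -
    have "?\<pi> s \<phi> = (\<lambda>i \<in> I. if i = s then \<phi> s else \<zero>\<^bsub>V i\<^esub>)" by (rule restrict_ext) auto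
    then show ?thesis using single_closed[OF that(1) family_moduleD(1)[OF that(2,1)]] by simp
  qed
  have "projections k W I (supported_families k I V) ?\<pi>"
    unfolding projections_def
  proof (intro conjI ballI impI)
    fix s assume s: "s \<in> I"
    interpret W: module k W by (rule module_family_module)
    show "submodule (supported_families k I V s) k W"
    proof (rule submoduleI_linear[OF module_family_module])
      fix a \<phi> \<psi> assume \<phi>: "\<phi> \<in> supported_families k I V s"
      show "\<phi> \<oplus>\<^bsub>W\<^esub> \<psi> \<in> supported_families k I V s" if \<psi>: "\<psi> \<in> supported_families k I V s"
      proof -
        have "(\<phi> \<oplus>\<^bsub>W\<^esub> \<psi>) i = \<zero>\<^bsub>V i\<^esub>" if i: "i \<in> I - {s}" for i
        proof -
          interpret Vi: module k "V i" by (rule V) (use i in simp)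
          show ?thesis using \<phi> \<psi> i by (simp add: supported_families_def family_module_simps)
        qed
        then show ?thesis using \<phi> \<psi> by (simp add: supported_families_def)
      qed
      show "a \<odot>\<^bsub>W\<^esub> \<phi> \<in> supported_families k I V s" if a: "a \<in> carrier k"
      proof -
        have "(a \<odot>\<^bsub>W\<^esub> \<phi>) i = \<zero>\<^bsub>V i\<^esub>" if i: "i \<in> I - {s}" for i
        proof -
          interpret Vi: module k "V i" by (rule V) (use i in simp)
          show ?thesis using \<phi> a i by (simp add: supported_families_def family_module_simps)
        qed
        then show ?thesis using \<phi> a by (simp add: supported_families_def)
      qed
    next
      show "\<zero>\<^bsub>W\<^esub> \<in> supported_families k I V s"
        using W.M.zero_closed by (simp add: supported_families_def) (simp add: family_module_simps)
    qed (auto simp: supported_families_def)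
    show "linear_map k W W (?\<pi> s)"
    proof (rule linear_mapI)
      fix \<phi> \<psi> assume "\<phi> \<in> carrier W" "\<psi> \<in> carrier W"
      show "?\<pi> s (\<phi> \<oplus>\<^bsub>W\<^esub> \<psi>) = ?\<pi> s \<phi> \<oplus>\<^bsub>W\<^esub> ?\<pi> s \<psi>"
        unfolding family_module_simps
      proof (rule restrict_ext)
        fix i assume i: "i \<in> I"
        interpret Vi: module k "V i" by (rule V[OF i])
        show "(if i = s then (\<lambda>i \<in> I. \<phi> i \<oplus>\<^bsub>V i\<^esub> \<psi> i) i else \<zero>\<^bsub>V i\<^esub>) = ?\<pi> s \<phi> i \<oplus>\<^bsub>V i\<^esub> ?\<pi> s \<psi> i"
          using i s by simp
      qed
    next
      fix a \<phi> assume a: "a \<in> carrier k"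
      show "?\<pi> s (a \<odot>\<^bsub>W\<^esub> \<phi>) = a \<odot>\<^bsub>W\<^esub> ?\<pi> s \<phi>"
        unfolding family_module_simps
      proof (rule restrict_ext)
        fix i assume i: "i \<in> I"
        interpret Vi: module k "V i" by (rule V[OF i])
        show "(if i = s then (\<lambda>i \<in> I. a \<odot>\<^bsub>V i\<^esub> \<phi> i) i else \<zero>\<^bsub>V i\<^esub>) = a \<odot>\<^bsub>V i\<^esub> ?\<pi> s \<phi> i"
          using i s a by simp
      qed
    qed (rule \<pi>[OF s])
    show "?\<pi> s \<phi> \<in> supported_families k I V s" if "\<phi> \<in> carrier W" for \<phi>
      using \<pi>[OF s that] by (auto simp: supported_families_def)
    show "?\<pi> s \<phi> = (if s = t then \<phi> else \<zero>\<^bsub>W\<^esub>)" if "t \<in> I" "\<phi> \<in> supported_families k I V t" for t \<phi>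
      using that family_moduleD(2)[of \<phi> k I V]
      by (auto simp: supported_families_def family_module_simps extensional_def fun_eq_iff)
  next
    fix \<phi> assume \<phi>: "\<phi> \<in> carrier W"
    have sub: "{s \<in> I. ?\<pi> s \<phi> \<noteq> \<zero>\<^bsub>W\<^esub>} \<subseteq> {s \<in> I. \<phi> s \<noteq> \<zero>\<^bsub>V s\<^esub>}"
      by (auto simp: family_module_simps fun_eq_iff split: if_splits)
    show "finite {s \<in> I. ?\<pi> s \<phi> \<noteq> \<zero>\<^bsub>W\<^esub>}"
      by (rule finite_subset[OF sub family_moduleD(3)[OF \<phi>]])
    assume 0: "\<forall>s \<in> I. ?\<pi> s \<phi> = \<zero>\<^bsub>W\<^esub>"
    show "\<phi> = \<zero>\<^bsub>W\<^esub>"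
    proof (rule extensionalityI[OF family_moduleD(2)[OF \<phi>]])
      fix i assume i: "i \<in> I"
      then have "?\<pi> i \<phi> i = \<zero>\<^bsub>W\<^esub> i" using 0 by simp
      then show "\<phi> i = \<zero>\<^bsub>W\<^esub> i" using i by simp
    qed (simp add: family_module_simps)
  qed
  then show ?thesis by (rule projections_imp_internal_direct_sum[OF module_family_module])
qed

end

section \<open>Assembling a graded module from a module over the smash product\<close>

context graded_category begin

context
  fixes M :: "('o \<times> 'g, 'k, 'b, 'm) lmod"
  assumes M: "left_module k smash M"
begin

text \<open>The inverse matches \<open>homogeneous_parts\<close>: the fibre of \<open>M\<close> at
  \<open>(x, inv s)\<close> is to become the component of degree \<open>s\<close>.\<close>

abbreviation parts :: "'o \<Rightarrow> 'g \<Rightarrow> ('k, 'm) module" where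
  "parts x s \<equiv> fib M (x, inv\<^bsub>G\<^esub> s)"

abbreviation sum_fib :: "'o \<Rightarrow> ('k, 'g \<Rightarrow> 'm) module" where
  "sum_fib x \<equiv> family_module k (carrier G) (parts x)"

text \<open>An element \<open>b\<close> of degree \<open>t\<close> moves coordinate \<open>s\<close>
  to coordinate \<open>t \<otimes> s\<close>; read backwards, coordinate \<open>u\<close> comes from
  \<open>inv t \<otimes> u\<close>. Between these two fibres \<open>b\<close> is an arrow of the
  smash product, since \<open>u \<otimes> inv (inv t \<otimes> u) = t\<close>.\<close>

definition homog_act :: "'o \<Rightarrow> 'o \<Rightarrow> 'g \<Rightarrow> 'b \<Rightarrow> ('g \<Rightarrow> 'm) \<Rightarrow> 'g \<Rightarrow> 'm" where
  "homog_act y x t b \<phi> = (\<lambda>u \<in> carrier G.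
     act M (y, inv\<^bsub>G\<^esub> u) (x, inv\<^bsub>G\<^esub> (inv\<^bsub>G\<^esub> t \<otimes>\<^bsub>G\<^esub> u)) b (\<phi> (inv\<^bsub>G\<^esub> t \<otimes>\<^bsub>G\<^esub> u)))"

lemma parts_module: "\<lbrakk>x \<in> objs B; s \<in> carrier G\<rbrakk> \<Longrightarrow> module k (parts x s)"
  by (rule left_moduleD(1)[OF M]) simp

lemma sum_fib_module: "x \<in> objs B \<Longrightarrow> module k (sum_fib x)"
  by (rule module_family_module[OF cring parts_module])

lemma parts_bilinear:
  assumes "x \<in> objs B" "y \<in> objs B" "t \<in> carrier G" "u \<in> carrier G"
  shows "bilinear_map k ((mor B y x)\<lparr>carrier := homog B y x t\<rparr>)
    (parts x (inv\<^bsub>G\<^esub> t \<otimes>\<^bsub>G\<^esub> u)) (parts y u) (act M (y, inv\<^bsub>G\<^esub> u) (x, inv\<^bsub>G\<^esub> (inv\<^bsub>G\<^esub> t \<otimes>\<^bsub>G\<^esub> u)))"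
proof -
  have "u \<otimes>\<^bsub>G\<^esub> inv\<^bsub>G\<^esub> (inv\<^bsub>G\<^esub> t \<otimes>\<^bsub>G\<^esub> u) = t"
    using assms by (simp add: G.inv_mult_group inv_mult_cancel)
  then show ?thesis
    using left_moduleD(2)[OF M, of "(x, inv\<^bsub>G\<^esub> (inv\<^bsub>G\<^esub> t \<otimes>\<^bsub>G\<^esub> u))" "(y, inv\<^bsub>G\<^esub> u)"] assms by simp
qed

lemma homog_act_bilinear:
  assumes x: "x \<in> objs B" and y: "y \<in> objs B" and t: "t \<in> carrier G"
  shows "bilinear_map k ((mor B y x)\<lparr>carrier := homog B y x t\<rparr>) (sum_fib x) (sum_fib y) (homog_act y x t)"
proof -
  note bil = parts_bilinear[OF x y t]
  have u: "inv\<^bsub>G\<^esub> t \<otimes>\<^bsub>G\<^esub> u \<in> carrier G" if "u \<in> carrier G" for u using t that by simp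
  have cl: "homog_act y x t b \<phi> \<in> carrier (sum_fib y)"
    if b: "b \<in> homog B y x t" and \<phi>: "\<phi> \<in> carrier (sum_fib x)" for b \<phi>
  \<comment> \<open>The support of the product lies in the translate by \<open>t\<close> of the
    support of \<open>\<phi>\<close>, which keeps it finite.\<close>
  proof (rule family_moduleI[where S = "(\<lambda>s. t \<otimes>\<^bsub>G\<^esub> s) ` {s \<in> carrier G. \<phi> s \<noteq> \<zero>\<^bsub>parts x s\<^esub>}"])
    show "finite ((\<lambda>s. t \<otimes>\<^bsub>G\<^esub> s) ` {s \<in> carrier G. \<phi> s \<noteq> \<zero>\<^bsub>parts x s\<^esub>})"
      by (rule finite_imageI[OF family_moduleD(3)[OF \<phi>]])
    show "homog_act y x t b \<phi> u \<in> carrier (parts y u)" if "u \<in> carrier G" for u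
      unfolding homog_act_def using that b
      by (simp add: bilinear_mapD(3)[OF bil[OF that] _ family_moduleD(1)[OF \<phi> u[OF that]]])
    fix s assume s: "s \<in> carrier G - (\<lambda>s. t \<otimes>\<^bsub>G\<^esub> s) ` {s \<in> carrier G. \<phi> s \<noteq> \<zero>\<^bsub>parts x s\<^esub>}"
    then have sG: "s \<in> carrier G" by simp
    have "\<phi> (inv\<^bsub>G\<^esub> t \<otimes>\<^bsub>G\<^esub> s) = \<zero>\<^bsub>parts x (inv\<^bsub>G\<^esub> t \<otimes>\<^bsub>G\<^esub> s)\<^esub>"
    proof (rule ccontr)
      assume "\<phi> (inv\<^bsub>G\<^esub> t \<otimes>\<^bsub>G\<^esub> s) \<noteq> \<zero>\<^bsub>parts x (inv\<^bsub>G\<^esub> t \<otimes>\<^bsub>G\<^esub> s)\<^esub>"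
      then have "t \<otimes>\<^bsub>G\<^esub> (inv\<^bsub>G\<^esub> t \<otimes>\<^bsub>G\<^esub> s) \<in> (\<lambda>s. t \<otimes>\<^bsub>G\<^esub> s) ` {s \<in> carrier G. \<phi> s \<noteq> \<zero>\<^bsub>parts x s\<^esub>}"
        using u[OF sG] by blast
      then show False using s t by (simp add: inv_mult_cancel)
    qed
    then show "homog_act y x t b \<phi> s = \<zero>\<^bsub>parts y s\<^esub>"
      using linear_map_zero[OF parts_module[OF x u[OF sG]] parts_module[OF y sG]
          bilinear_mapD(1)[OF bil[OF sG]]] b sG
      by (simp add: homog_act_def)
  qed (simp add: homog_act_def)
  show ?thesis
    unfolding bilinear_map_def
  proof (intro conjI ballI)
    fix b assume "b \<in> carrier ((mor B y x)\<lparr>carrier := homog B y x t\<rparr>)"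
    then have b: "b \<in> homog B y x t" by simp
    show "linear_map k (sum_fib x) (sum_fib y) (homog_act y x t b)"
    proof (rule linear_mapI)
      fix \<phi> \<psi> a assume \<phi>: "\<phi> \<in> carrier (sum_fib x)"
      show "homog_act y x t b \<phi> \<in> carrier (sum_fib y)" by (rule cl[OF b \<phi>])
      show "homog_act y x t b (a \<odot>\<^bsub>sum_fib x\<^esub> \<phi>) = a \<odot>\<^bsub>sum_fib y\<^esub> homog_act y x t b \<phi>" if "a \<in> carrier k"
        unfolding family_module_simps
        by (subst homog_act_def, rule restrict_ext)
          (use that b t \<phi> in \<open>simp add: homog_act_def linear_mapD(3)[OF bilinear_mapD(1)[OF bil]]
            family_moduleD(1)[OF \<phi>]\<close>)
      assume \<psi>: "\<psi> \<in> carrier (sum_fib x)"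
      show "homog_act y x t b (\<phi> \<oplus>\<^bsub>sum_fib x\<^esub> \<psi>)
          = homog_act y x t b \<phi> \<oplus>\<^bsub>sum_fib y\<^esub> homog_act y x t b \<psi>"
        unfolding family_module_simps
        by (subst homog_act_def, rule restrict_ext)
          (use b t \<phi> \<psi> in \<open>simp add: homog_act_def linear_mapD(2)[OF bilinear_mapD(1)[OF bil]]
            family_moduleD(1)[OF \<phi>] family_moduleD(1)[OF \<psi>]\<close>)
    qed
  next
    fix \<phi> assume \<phi>: "\<phi> \<in> carrier (sum_fib x)"
    have lin: "linear_map k ((mor B y x)\<lparr>carrier := homog B y x t\<rparr>) (parts y u)
        (\<lambda>b. act M (y, inv\<^bsub>G\<^esub> u) (x, inv\<^bsub>G\<^esub> (inv\<^bsub>G\<^esub> t \<otimes>\<^bsub>G\<^esub> u)) b (\<phi> (inv\<^bsub>G\<^esub> t \<otimes>\<^bsub>G\<^esub> u)))"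
      if "u \<in> carrier G" for u
      by (rule bilinear_mapD(2)[OF bil[OF that] family_moduleD(1)[OF \<phi> u[OF that]]])
    show "linear_map k ((mor B y x)\<lparr>carrier := homog B y x t\<rparr>) (sum_fib y) (\<lambda>b. homog_act y x t b \<phi>)"
    proof (rule linear_mapI)
      fix b c a assume b: "b \<in> carrier ((mor B y x)\<lparr>carrier := homog B y x t\<rparr>)"
      show "homog_act y x t b \<phi> \<in> carrier (sum_fib y)" by (rule cl[OF _ \<phi>]) (use b in simp)
      show "homog_act y x t (a \<odot>\<^bsub>(mor B y x)\<lparr>carrier := homog B y x t\<rparr>\<^esub> b) \<phi>
          = a \<odot>\<^bsub>sum_fib y\<^esub> homog_act y x t b \<phi>" if "a \<in> carrier k"
        unfolding family_module_simps
        by (subst homog_act_def, rule restrict_ext)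
          (simp add: homog_act_def linear_mapD(3)[OF lin that b, simplified])
      assume c: "c \<in> carrier ((mor B y x)\<lparr>carrier := homog B y x t\<rparr>)"
      show "homog_act y x t (b \<oplus>\<^bsub>(mor B y x)\<lparr>carrier := homog B y x t\<rparr>\<^esub> c) \<phi>
          = homog_act y x t b \<phi> \<oplus>\<^bsub>sum_fib y\<^esub> homog_act y x t c \<phi>"
        unfolding family_module_simps
        by (subst homog_act_def, rule restrict_ext)
          (simp add: homog_act_def linear_mapD(2)[OF lin b c, simplified])
    qed
  qed
qed

text \<open>An arbitrary \<open>b\<close> acts through its homogeneous components. For each
  \<open>\<phi>\<close> the action is chosen as a linear map in \<open>b\<close> that extends
  \<open>homog_act\<close>, which spares an explicit sum over components.\<close>

definition sum_act :: "'o \<Rightarrow> 'o \<Rightarrow> 'b \<Rightarrow> ('g \<Rightarrow> 'm) \<Rightarrow> 'g \<Rightarrow> 'm" where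
  "sum_act y x b \<phi> = (SOME g. linear_map k (mor B y x) (sum_fib y) g \<and>
     (\<forall>t \<in> carrier G. \<forall>b \<in> homog B y x t. g b = homog_act y x t b \<phi>)) b"

lemma sum_act:
  assumes x: "x \<in> objs B" and y: "y \<in> objs B" and \<phi>: "\<phi> \<in> carrier (sum_fib x)"
  shows sum_act_linear: "linear_map k (mor B y x) (sum_fib y) (\<lambda>b. sum_act y x b \<phi>)"
    and sum_act_homog: "\<lbrakk>t \<in> carrier G; b \<in> homog B y x t\<rbrakk> \<Longrightarrow> sum_act y x b \<phi> = homog_act y x t b \<phi>"
proof -
  have "\<exists>g. linear_map k (mor B y x) (sum_fib y) g \<and>
      (\<forall>t \<in> carrier G. \<forall>b \<in> homog B y x t. g b = homog_act y x t b \<phi>)"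
    using linear_map_extension[OF mor_module[OF x y] sum_fib_module[OF y] mor_direct_sum[OF x y],
        where h = "\<lambda>t b. homog_act y x t b \<phi>"] bilinear_mapD(2)[OF homog_act_bilinear[OF x y] \<phi>]
    by metis
  from someI_ex[OF this]
  show "linear_map k (mor B y x) (sum_fib y) (\<lambda>b. sum_act y x b \<phi>)"
    "\<lbrakk>t \<in> carrier G; b \<in> homog B y x t\<rbrakk> \<Longrightarrow> sum_act y x b \<phi> = homog_act y x t b \<phi>"
    unfolding sum_act_def by auto
qed

text \<open>Linearity in \<open>b\<close> holds by construction. Linearity in \<open>\<phi>\<close>
  follows by induction over \<open>b\<close>: it is known for homogeneous \<open>b\<close>, and a
  sum of linear maps is linear.\<close>

lemma sum_act_bilinear:
  assumes x: "x \<in> objs B" and y: "y \<in> objs B"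
  shows "bilinear_map k (mor B y x) (sum_fib x) (sum_fib y) (sum_act y x)"
  unfolding bilinear_map_def
proof (intro conjI ballI)
  note Wx = sum_fib_module[OF x] and Wy = sum_fib_module[OF y]
  fix b assume "b \<in> carrier (mor B y x)"
  with mor_module[OF x y] mor_direct_sum[OF x y]
  show "linear_map k (sum_fib x) (sum_fib y) (sum_act y x b)"
  proof (induction rule: internal_direct_sum_induct)
    case zero
    show ?case
      using linear_map_zero[OF mor_module[OF x y] Wy sum_act_linear[OF x y]] linear_map_const_zero[OF Wy]
      by (subst linear_map_cong[OF Wx, where g = "\<lambda>\<phi>. \<zero>\<^bsub>sum_fib y\<^esub>"]) auto
  next
    case (add b c)
    show ?case
      using linear_mapD(2)[OF sum_act_linear[OF x y] add(1,2)] linear_map_add[OF Wy add(3,4)]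
      by (subst linear_map_cong[OF Wx, where g = "\<lambda>\<phi>. sum_act y x b \<phi> \<oplus>\<^bsub>sum_fib y\<^esub> sum_act y x c \<phi>"]) auto
  next
    case (homogeneous t b)
    show ?case
      using sum_act_homog[OF x y _ homogeneous]
        bilinear_mapD(1)[OF homog_act_bilinear[OF x y homogeneous(1)], of b] homogeneous
      by (subst linear_map_cong[OF Wx, where g = "homog_act y x t b"]) auto
  qed
qed (rule sum_act_linear[OF x y])

definition direct_sum :: "('o, 'g, 'k, 'b, 'g \<Rightarrow> 'm) graded_lmod" where
  "direct_sum = \<lparr>fib = sum_fib, act = sum_act,
     deg = (\<lambda>x. supported_families k (carrier G) (parts x))\<rparr>"

lemma left_module_direct_sum: "left_module k B direct_sum"
  unfolding left_module_def
proof (intro conjI ballI)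
  fix x assume x: "x \<in> objs B"
  show "module k (fib direct_sum x)" using sum_fib_module[OF x] by (simp add: direct_sum_def)
  fix \<phi> assume "\<phi> \<in> carrier (fib direct_sum x)"
  then have \<phi>: "\<phi> \<in> carrier (sum_fib x)" by (simp add: direct_sum_def)
  have i: "ident B x \<in> homog B x x \<one>\<^bsub>G\<^esub>" using graded x by (simp add: graded_category_over_def)
  have "homog_act x x \<one>\<^bsub>G\<^esub> (ident B x) \<phi> = \<phi>"
  proof (rule extensionalityI[OF _ family_moduleD(2)[OF \<phi>]])
    fix u assume u: "u \<in> carrier G"
    then show "homog_act x x \<one>\<^bsub>G\<^esub> (ident B x) \<phi> u = \<phi> u"
      using left_moduleD(5)[OF M, of "(x, inv\<^bsub>G\<^esub> u)" "\<phi> u"] family_moduleD(1)[OF \<phi> u] x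
      by (simp add: homog_act_def)
  qed (simp add: homog_act_def)
  then show "act direct_sum x x (ident B x) \<phi> = \<phi>"
    using sum_act_homog[OF x x \<phi> _ i] by (simp add: direct_sum_def)
next
  fix x y assume "x \<in> objs B" "y \<in> objs B"
  then show "bilinear_map k (mor B y x) (fib direct_sum x) (fib direct_sum y) (act direct_sum y x)"
    using sum_act_bilinear by (simp add: direct_sum_def)
next
  fix x y z c b \<phi>
  assume x: "x \<in> objs B" and y: "y \<in> objs B" and z: "z \<in> objs B" and c: "c \<in> carrier (mor B z y)"
    and b: "b \<in> carrier (mor B y x)" and "\<phi> \<in> carrier (fib direct_sum x)"
  then have \<phi>: "\<phi> \<in> carrier (sum_fib x)" by (simp add: direct_sum_def)
  have bil: "bilinear_map k (mor B z y) (mor B y x) (mor B z x) (mcomp B z y x)"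
    using category_over x y z by (simp add: category_over_def)
  \<comment> \<open>Both sides are bilinear in \<open>c\<close> and \<open>b\<close>, so homogeneous
    morphisms suffice.\<close>
  have "sum_act z x (mcomp B z y x c b) \<phi> = sum_act z y c (sum_act y x b \<phi>)"
  proof (rule bilinear_map_eq_on_direct_sums[OF mor_module[OF y z] mor_module[OF x y] sum_fib_module[OF z]
        mor_direct_sum[OF y z] mor_direct_sum[OF x y]
        bilinear_map_compose[OF bil sum_act_linear[OF x z \<phi>]]
        bilinear_map_precompose[OF sum_act_bilinear[OF y z] sum_act_linear[OF x y \<phi>]] _ c b])
    fix s t c b assume s: "s \<in> carrier G" and t: "t \<in> carrier G"
      and c: "c \<in> homog B z y s" and b: "b \<in> homog B y x t"
    have cb: "mcomp B z y x c b \<in> homog B z x (s \<otimes>\<^bsub>G\<^esub> t)"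
      using graded x y z s t c b by (simp add: graded_category_over_def)
    have b\<phi>: "homog_act y x t b \<phi> \<in> carrier (sum_fib y)"
      using bilinear_mapD(3)[OF homog_act_bilinear[OF x y t] _ \<phi>] b by simp
    have "homog_act z x (s \<otimes>\<^bsub>G\<^esub> t) (mcomp B z y x c b) \<phi> = homog_act z y s c (homog_act y x t b \<phi>)"
    proof (rule extensionalityI)
      fix u assume u: "u \<in> carrier G"
      \<comment> \<open>In the smash product \<open>b\<close> goes from \<open>(x, inv ?w)\<close>
        to \<open>(y, inv ?v)\<close> and \<open>c\<close> from there to \<open>(z, inv u)\<close>,
        so that associativity in \<open>M\<close> gives the claim coordinate by coordinate.\<close>
      let ?v = "inv\<^bsub>G\<^esub> s \<otimes>\<^bsub>G\<^esub> u" and ?w = "inv\<^bsub>G\<^esub> t \<otimes>\<^bsub>G\<^esub> (inv\<^bsub>G\<^esub> s \<otimes>\<^bsub>G\<^esub> u)"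
      have v: "?v \<in> carrier G" and w: "?w \<in> carrier G" using s t u by simp_all
      have st: "inv\<^bsub>G\<^esub> (s \<otimes>\<^bsub>G\<^esub> t) \<otimes>\<^bsub>G\<^esub> u = ?w" using s t u by (simp add: G.inv_mult_group G.m_assoc)
      have "u \<otimes>\<^bsub>G\<^esub> inv\<^bsub>G\<^esub> ?v = s" "?v \<otimes>\<^bsub>G\<^esub> inv\<^bsub>G\<^esub> ?w = t"
        using s t u v by (simp_all add: G.inv_mult_group inv_mult_cancel)
          (simp add: G.m_assoc inv_mult_cancel)
      then have "act M (z, inv\<^bsub>G\<^esub> u) (x, inv\<^bsub>G\<^esub> ?w) (mcomp B z y x c b) (\<phi> ?w)
        = act M (z, inv\<^bsub>G\<^esub> u) (y, inv\<^bsub>G\<^esub> ?v) c (act M (y, inv\<^bsub>G\<^esub> ?v) (x, inv\<^bsub>G\<^esub> ?w) b (\<phi> ?w))"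
        using left_moduleD(4)[OF M, of "(x, inv\<^bsub>G\<^esub> ?w)" "(y, inv\<^bsub>G\<^esub> ?v)" "(z, inv\<^bsub>G\<^esub> u)" c b "\<phi> ?w"]
          x y z u v w c b family_moduleD(1)[OF \<phi> w] by simp
      then show "homog_act z x (s \<otimes>\<^bsub>G\<^esub> t) (mcomp B z y x c b) \<phi> u
          = homog_act z y s c (homog_act y x t b \<phi>) u"
        using u v by (simp add: homog_act_def st)
    qed (simp_all add: homog_act_def)
    then show "sum_act z x (mcomp B z y x c b) \<phi> = sum_act z y c (sum_act y x b \<phi>)"
      using sum_act_homog[OF x z \<phi> _ cb] sum_act_homog[OF x y \<phi> t b] sum_act_homog[OF y z b\<phi> s c] s t
      by simp
  qed
  then show "act direct_sum z x (mcomp B z y x c b) \<phi> = act direct_sum z y c (act direct_sum y x b \<phi>)"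
    by (simp add: direct_sum_def)
qed

lemma graded_module_direct_sum: "graded_module k G B direct_sum"
  unfolding graded_module_def
proof (intro conjI ballI)
  show "internal_direct_sum k (fib direct_sum x) (carrier G) (deg direct_sum x)" if "x \<in> objs B" for x
    using internal_direct_sum_family_module[OF cring parts_module[OF that]]
    by (simp add: direct_sum_def)
  fix x y s t b \<phi> assume x: "x \<in> objs B" and y: "y \<in> objs B" and s: "s \<in> carrier G" and t: "t \<in> carrier G"
    and b: "b \<in> homog B y x t" and "\<phi> \<in> deg direct_sum x s"
  then have \<phi>: "\<phi> \<in> carrier (sum_fib x)" "\<And>u. u \<in> carrier G - {s} \<Longrightarrow> \<phi> u = \<zero>\<^bsub>parts x u\<^esub>"
    by (simp_all add: direct_sum_def supported_families_def)
  have "homog_act y x t b \<phi> u = \<zero>\<^bsub>parts y u\<^esub>" if "u \<in> carrier G - {t \<otimes>\<^bsub>G\<^esub> s}" for u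
  proof -
    have u: "u \<in> carrier G" "inv\<^bsub>G\<^esub> t \<otimes>\<^bsub>G\<^esub> u \<in> carrier G" using that t by simp_all
    have "inv\<^bsub>G\<^esub> t \<otimes>\<^bsub>G\<^esub> u \<noteq> s" using that t u by (auto simp: inv_mult_cancel)
    then have "\<phi> (inv\<^bsub>G\<^esub> t \<otimes>\<^bsub>G\<^esub> u) = \<zero>\<^bsub>parts x (inv\<^bsub>G\<^esub> t \<otimes>\<^bsub>G\<^esub> u)\<^esub>" using \<phi>(2) u by simp
    then show ?thesis
      using linear_map_zero[OF parts_module[OF x u(2)] parts_module[OF y u(1)]
          bilinear_mapD(1)[OF parts_bilinear[OF x y t u(1)]]] b u
      by (simp add: homog_act_def)
  qed
  then show "act direct_sum y x b \<phi> \<in> deg direct_sum y (t \<otimes>\<^bsub>G\<^esub> s)"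
    using sum_act_homog[OF x y \<phi>(1) t b] bilinear_mapD(3)[OF homog_act_bilinear[OF x y t] _ \<phi>(1)] b
    by (simp add: direct_sum_def supported_families_def)
qed (rule left_module_direct_sum)

lemma carrier_direct_sum_extensional:
  "\<lbrakk>x \<in> objs B; \<phi> \<in> carrier (fib direct_sum x)\<rbrakk> \<Longrightarrow> \<phi> \<in> carrier G \<rightarrow>\<^sub>E UNIV"
  using family_moduleD(2)[of \<phi> k "carrier G" "parts x"] by (simp add: direct_sum_def PiE_iff)

text \<open>Evaluation takes place at the only coordinate that may be nonzero. The component at
  \<open>p\<close> has degree \<open>inv (snd p)\<close>, and the part of that degree is
  \<open>fib M p\<close> because inversion is an involution.\<close>

lemma equivariant_direct_sum_parts:
  "equivariant k smash (homogeneous_parts direct_sum) M (\<lambda>p \<phi>. \<phi> (inv\<^bsub>G\<^esub> snd p))"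
  unfolding equivariant_def
proof (intro conjI ballI)
  fix p assume p: "p \<in> objs smash"
  then show "linear_map k (fib (homogeneous_parts direct_sum) p) (fib M p) (\<lambda>\<phi>. \<phi> (inv\<^bsub>G\<^esub> snd p))"
    using family_moduleD(1)[of _ k "carrier G" "parts (fst p)" "inv\<^bsub>G\<^esub> snd p"]
    by (intro linear_mapI) (auto simp: direct_sum_def supported_families_def family_module_simps)
next
  fix p q b \<phi> assume p: "p \<in> objs smash" and q: "q \<in> objs smash" and "b \<in> carrier (mor smash q p)"
    and "\<phi> \<in> carrier (fib (homogeneous_parts direct_sum) p)"
  then have b: "b \<in> homog B (fst q) (fst p) (inv\<^bsub>G\<^esub> snd q \<otimes>\<^bsub>G\<^esub> snd p)"
    and \<phi>: "\<phi> \<in> carrier (sum_fib (fst p))"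
    by (simp_all add: direct_sum_def supported_families_def)
  have "inv\<^bsub>G\<^esub> (inv\<^bsub>G\<^esub> snd q \<otimes>\<^bsub>G\<^esub> snd p) \<otimes>\<^bsub>G\<^esub> inv\<^bsub>G\<^esub> snd q = inv\<^bsub>G\<^esub> snd p"
    using p q by (auto simp: G.inv_mult_group inv_mult_cancel)
  then have "homog_act (fst q) (fst p) (inv\<^bsub>G\<^esub> snd q \<otimes>\<^bsub>G\<^esub> snd p) b \<phi> (inv\<^bsub>G\<^esub> snd q)
      = act M q p b (\<phi> (inv\<^bsub>G\<^esub> snd p))"
    using p q by (auto simp: homog_act_def)
  then show "act (homogeneous_parts direct_sum) q p b \<phi> (inv\<^bsub>G\<^esub> snd q) = act M q p b (\<phi> (inv\<^bsub>G\<^esub> snd p))"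
    using sum_act_homog[OF _ _ \<phi> _ b] p q by (auto simp: direct_sum_def)
qed

text \<open>A family supported at one index is determined by its value there, and every value
  occurs.\<close>

lemma bij_betw_direct_sum_parts:
  assumes p: "p \<in> objs smash"
  shows "bij_betw (\<lambda>\<phi>. \<phi> (inv\<^bsub>G\<^esub> snd p)) (carrier (fib (homogeneous_parts direct_sum) p)) (carrier (fib M p))"
proof (rule bij_betw_imageI)
  have x: "fst p \<in> objs B" and s: "inv\<^bsub>G\<^esub> snd p \<in> carrier G" and i: "inv\<^bsub>G\<^esub> (inv\<^bsub>G\<^esub> snd p) = snd p"
    using p by auto
  show "inj_on (\<lambda>\<phi>. \<phi> (inv\<^bsub>G\<^esub> snd p)) (carrier (fib (homogeneous_parts direct_sum) p))"
  proof (rule inj_onI)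
    fix \<phi> \<psi> assume *: "\<phi> \<in> carrier (fib (homogeneous_parts direct_sum) p)"
      "\<psi> \<in> carrier (fib (homogeneous_parts direct_sum) p)" "\<phi> (inv\<^bsub>G\<^esub> snd p) = \<psi> (inv\<^bsub>G\<^esub> snd p)"
    then have "\<phi> \<in> supported_families k (carrier G) (parts (fst p)) (inv\<^bsub>G\<^esub> snd p)"
      "\<psi> \<in> supported_families k (carrier G) (parts (fst p)) (inv\<^bsub>G\<^esub> snd p)"
      by (simp_all add: direct_sum_def)
    then have **: "\<phi> \<in> carrier (sum_fib (fst p))" "\<psi> \<in> carrier (sum_fib (fst p))"
      "\<And>u. \<lbrakk>u \<in> carrier G; u \<noteq> inv\<^bsub>G\<^esub> snd p\<rbrakk> \<Longrightarrow> \<phi> u = \<psi> u"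
      by (auto simp: supported_families_def)
    show "\<phi> = \<psi>"
    proof (rule extensionalityI[OF family_moduleD(2)[OF **(1)] family_moduleD(2)[OF **(2)]])
      show "\<phi> u = \<psi> u" if "u \<in> carrier G" for u
        using **(3)[OF that] *(3) by (cases "u = inv\<^bsub>G\<^esub> snd p") simp_all
    qed
  qed
  show "(\<lambda>\<phi>. \<phi> (inv\<^bsub>G\<^esub> snd p)) ` carrier (fib (homogeneous_parts direct_sum) p) = carrier (fib M p)"
  proof (intro equalityI subsetI)
    fix v assume "v \<in> (\<lambda>\<phi>. \<phi> (inv\<^bsub>G\<^esub> snd p)) ` carrier (fib (homogeneous_parts direct_sum) p)"
    then show "v \<in> carrier (fib M p)"
      using equivariantD(2)[OF equivariant_direct_sum_parts p] by auto
  next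
    fix v assume v: "v \<in> carrier (fib M p)"
    let ?\<phi> = "\<lambda>u \<in> carrier G. if u = inv\<^bsub>G\<^esub> snd p then v else \<zero>\<^bsub>parts (fst p) u\<^esub>"
    have "v \<in> carrier (parts (fst p) (inv\<^bsub>G\<^esub> snd p))" unfolding i using v by simp
    then have "?\<phi> \<in> carrier (sum_fib (fst p))"
      using single_closed[where V = "parts (fst p)", OF cring parts_module[OF x] s] by blast
    then have "?\<phi> \<in> carrier (fib (homogeneous_parts direct_sum) p)"
      by (simp add: direct_sum_def supported_families_def)
    moreover have "v = ?\<phi> (inv\<^bsub>G\<^esub> snd p)" using s by simp
    ultimately show "v \<in> (\<lambda>\<phi>. \<phi> (inv\<^bsub>G\<^esub> snd p)) ` carrier (fib (homogeneous_parts direct_sum) p)"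
      by (intro image_eqI[where x = ?\<phi>])
  qed
qed

end

end

section \<open>Counting names\<close>

lemma infinite_times_lepoll: "infinite A \<Longrightarrow> A \<times> A \<lesssim> A"
  using card_of_Times_same_infinite eqpoll_iff_card_of_ordIso eqpoll_imp_lepoll by blast

text \<open>Each further argument costs one factor \<open>UNIV\<close>, which an infinite set
  absorbs.\<close>

lemma finite_funcset_lepoll:
  assumes Q: "finite Q" and U: "infinite (UNIV :: 'm set)"
  shows "(Q \<rightarrow>\<^sub>E (UNIV :: 'm set)) \<lesssim> (UNIV :: 'm set)"
  using Q
proof (induction Q rule: finite_induct)
  case empty
  then show ?case by (intro finite_lepoll_infinite[OF U]) simp
next
  case (insert a Q)
  then obtain f :: "('a \<Rightarrow> 'm) \<Rightarrow> 'm" where f: "inj_on f (Q \<rightarrow>\<^sub>E UNIV)" by (auto simp: lepoll_def)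
  have "inj_on (\<lambda>g. (g a, f (restrict g Q))) (insert a Q \<rightarrow>\<^sub>E UNIV)"
  proof (rule inj_onI)
    fix g h :: "'a \<Rightarrow> 'm"
    assume g: "g \<in> insert a Q \<rightarrow>\<^sub>E UNIV" and h: "h \<in> insert a Q \<rightarrow>\<^sub>E UNIV"
      and "(g a, f (restrict g Q)) = (h a, f (restrict h Q))"
    then have a: "g a = h a" and eq: "f (restrict g Q) = f (restrict h Q)" by auto
    have "restrict g Q = restrict h Q" by (rule inj_onD[OF f, OF eq]) auto
    then have "g q = h q" if "q \<in> Q" for q using that by (metis restrict_apply')
    then show "g = h" using a by (intro PiE_ext[OF g h]) auto
  qed
  then have "(insert a Q \<rightarrow>\<^sub>E (UNIV :: 'm set)) \<lesssim> (UNIV :: 'm set) \<times> (UNIV :: 'm set)"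
    unfolding lepoll_def by blast
  then show ?case using infinite_times_lepoll[OF U] by (rule lepoll_trans)
qed

section \<open>Coding direct sums in the universe\<close>

context graded_category begin

text \<open>Families over \<open>carrier G\<close> embed into families over
  \<open>objs B \<times> carrier G\<close> as those independent of the object. This takes an object;
  without objects there are no fibres to code, hence the conditional conclusion.\<close>

lemma closed_under_families_code:
  assumes "closed_under_families (objs B \<times> carrier G) TYPE('m)"
  obtains e :: "('g \<Rightarrow> 'm) \<Rightarrow> 'm" where "objs B \<noteq> {} \<Longrightarrow> inj_on e (carrier G \<rightarrow>\<^sub>E UNIV)"
proof (cases "objs B = {}")
  case False
  then obtain x where x: "x \<in> objs B" by blast
  obtain f :: "('o \<times> 'g \<Rightarrow> 'm) \<Rightarrow> 'm" where f: "inj_on f (objs B \<times> carrier G \<rightarrow>\<^sub>E UNIV)"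
    using assms unfolding closed_under_families_def lepoll_def by blast
  have "inj_on (\<lambda>\<phi>. f (\<lambda>p \<in> objs B \<times> carrier G. \<phi> (snd p))) (carrier G \<rightarrow>\<^sub>E UNIV)"
  proof (rule inj_onI)
    fix \<phi> \<psi> :: "'g \<Rightarrow> 'm"
    assume \<phi>: "\<phi> \<in> carrier G \<rightarrow>\<^sub>E UNIV" and \<psi>: "\<psi> \<in> carrier G \<rightarrow>\<^sub>E UNIV"
      and "f (\<lambda>p \<in> objs B \<times> carrier G. \<phi> (snd p)) = f (\<lambda>p \<in> objs B \<times> carrier G. \<psi> (snd p))"
    then have eq: "(\<lambda>p \<in> objs B \<times> carrier G. \<phi> (snd p)) = (\<lambda>p \<in> objs B \<times> carrier G. \<psi> (snd p))"
      by (intro inj_onD[OF f]) auto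
    show "\<phi> = \<psi>"
    proof (rule PiE_ext[OF \<phi> \<psi>])
      show "\<phi> u = \<psi> u" if "u \<in> carrier G" for u
        using fun_cong[OF eq, of "(x, u)"] x that by simp
    qed
  qed
  then show ?thesis using that by blast
qed (use that in blast)

context
  fixes e :: "('g \<Rightarrow> 'm) \<Rightarrow> 'm"
  assumes e: "objs B \<noteq> {} \<Longrightarrow> inj_on e (carrier G \<rightarrow>\<^sub>E UNIV)"
begin

definition coded_sum :: "('o \<times> 'g, 'k, 'b, 'm) lmod \<Rightarrow> ('o, 'g, 'k, 'b, 'm) graded_lmod" where
  "coded_sum M = graded_transport (\<lambda>_. e) (direct_sum M)"

lemma inj_on_code:
  assumes M: "left_module k smash M" and x: "x \<in> objs B"
  shows "inj_on e (carrier (fib (direct_sum M) x))"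
  using carrier_direct_sum_extensional[OF M x] e x by (blast intro: inj_on_subset)

lemma coded_sum_object:
  "left_module k smash M \<Longrightarrow> coded_sum M \<in> obj (graded_module_category k G B)"
  unfolding coded_sum_def by (rule graded_transport_object[OF graded_module_direct_sum inj_on_code])

lemma equivariant_code:
  "left_module k smash M \<Longrightarrow> equivariant k B (direct_sum M) (coded_sum M) (\<lambda>_. e)"
  unfolding coded_sum_def by (rule equivariant_graded_transport[OF graded_module_direct_sum inj_on_code])

lemma deg_coded_sum:
  "\<lbrakk>x \<in> objs B; s \<in> carrier G\<rbrakk> \<Longrightarrow> deg (coded_sum M) x s = e ` deg (direct_sum M) x s"
  by (simp add: coded_sum_def graded_transport_def)

lemma
  assumes M: "left_module k smash M"
  shows equivariant_code_parts:
      "equivariant k smash (homogeneous_parts (direct_sum M)) (homogeneous_parts (coded_sum M)) (\<lambda>_. e)"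
    and bij_betw_code_parts: "p \<in> objs smash \<Longrightarrow> bij_betw e
      (carrier (fib (homogeneous_parts (direct_sum M)) p)) (carrier (fib (homogeneous_parts (coded_sum M)) p))"
proof -
  show "equivariant k smash (homogeneous_parts (direct_sum M)) (homogeneous_parts (coded_sum M)) (\<lambda>_. e)"
    using equivariant_homogeneous_parts[OF graded_module_direct_sum[OF M] equivariant_code[OF M]]
    by (simp add: deg_coded_sum)
  assume p: "p \<in> objs smash"
  then have "fst p \<in> objs B" "inv\<^bsub>G\<^esub> snd p \<in> carrier G" by auto
  moreover have "carrier (fib (homogeneous_parts (direct_sum M)) p) \<subseteq> carrier (fib (direct_sum M) (fst p))"
    using homogeneous_parts_subset[OF graded_module_direct_sum[OF M] _ p] by blast
  ultimately show "bij_betw e (carrier (fib (homogeneous_parts (direct_sum M)) p))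
      (carrier (fib (homogeneous_parts (coded_sum M)) p))"
    using inj_on_code[OF M] by (auto simp: bij_betw_def deg_coded_sum intro: inj_on_subset)
qed

lemma isomorphic_in_coded_sum:
  assumes M: "left_module k smash M"
  shows "isomorphic_in (module_category k smash) (smash_module (coded_sum M)) M"
proof -
  let ?S = "homogeneous_parts (direct_sum M)" and ?T = "homogeneous_parts (coded_sum M)"
  have g: "graded_module k G B (coded_sum M)"
    using coded_sum_object[OF M] by (simp add: graded_module_category_def)
  have S: "left_module k smash ?S" by (rule left_module_homogeneous_parts[OF graded_module_direct_sum[OF M]])
  let ?i = "\<lambda>p. inv_into (carrier (fib ?S p)) (\<lambda>\<phi>. \<phi> (inv\<^bsub>G\<^esub> snd p))"
  have i: "equivariant k smash M ?S ?i"
    by (rule equivariant_inv[OF S M equivariant_direct_sum_parts[OF M] bij_betw_direct_sum_parts[OF M]])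
  have ibij: "bij_betw (?i p) (carrier (fib M p)) (carrier (fib ?S p))" if "p \<in> objs smash" for p
    by (rule bij_betw_inv_into[OF bij_betw_direct_sum_parts[OF M that]])
  show ?thesis
  proof (rule isomorphic_in_module_category(2)[OF M left_module_smash_module[OF g]])
    show "equivariant k smash M (smash_module (coded_sum M)) (\<lambda>p m. e (?i p m))"
      using equivariant_compose[OF equivariant_compose[OF i equivariant_code_parts[OF M]]
          equivariant_to_smash_module[OF g]] .
    fix p assume p: "p \<in> objs smash"
    have "bij_betw (\<lambda>m. e (?i p m)) (carrier (fib M p)) (carrier (fib ?T p))"
      using bij_betw_trans[OF ibij[OF p] bij_betw_code_parts[OF M p]] by (simp add: comp_def)
    then show "bij_betw (\<lambda>m. e (?i p m)) (carrier (fib M p)) (carrier (fib (smash_module (coded_sum M)) p))"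
      using p by auto
  qed
qed

text \<open>The elements of \<open>M\<close> can be read off its coded sum: an element becomes a
  family with one coordinate, then a code, which is decoded and evaluated in \<open>N\<close>. The
  composite is equivariant and returns the same element.\<close>

lemma coded_sum_eq_imp_equivariant:
  assumes M: "left_module k smash M" and N: "left_module k smash N" and eq: "coded_sum M = coded_sum N"
  shows "equivariant k smash M N (\<lambda>_ v. v)"
proof -
  let ?S = "homogeneous_parts (direct_sum M)" and ?T = "homogeneous_parts (direct_sum N)"
  have S: "left_module k smash ?S" and T: "left_module k smash ?T"
    by (rule left_module_homogeneous_parts[OF graded_module_direct_sum], fact)+
  let ?C = "homogeneous_parts (coded_sum N)"
  have C: "left_module k smash ?C"
    using coded_sum_object[OF N] by (intro left_module_homogeneous_parts) (simp add: graded_module_category_def)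
  let ?i = "\<lambda>p. inv_into (carrier (fib ?S p)) (\<lambda>\<phi>. \<phi> (inv\<^bsub>G\<^esub> snd p))"
  let ?j = "\<lambda>p. inv_into (carrier (fib ?T p)) e"
  have i: "equivariant k smash M ?S ?i"
    by (rule equivariant_inv[OF S M equivariant_direct_sum_parts[OF M] bij_betw_direct_sum_parts[OF M]])
  have j: "equivariant k smash ?C ?T ?j"
    by (rule equivariant_inv[OF T C equivariant_code_parts[OF N] bij_betw_code_parts[OF N]])
  have "equivariant k smash M N (\<lambda>p m. ?j p (e (?i p m)) (inv\<^bsub>G\<^esub> snd p))"
    using equivariant_compose[OF equivariant_compose[OF equivariant_compose[OF i
            equivariant_code_parts[OF M, unfolded eq]] j] equivariant_direct_sum_parts[OF N]] .
  moreover have "?j p (e (?i p m)) (inv\<^bsub>G\<^esub> snd p) = m" if p: "p \<in> objs smash" and m: "m \<in> carrier (fib M p)" for p m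
  proof -
    have x: "fst p \<in> objs B" using p by auto
    have im: "?i p m \<in> carrier (fib ?S p)" by (rule equivariantD(2)[OF i p m])
    then have "e (?i p m) \<in> e ` carrier (fib ?T p)"
      using bij_betw_code_parts[OF M p] bij_betw_code_parts[OF N p] eq by (auto simp: bij_betw_def)
    then obtain \<phi> where \<phi>: "\<phi> \<in> carrier (fib ?T p)" "e (?i p m) = e \<phi>" by auto
    have sub: "?i p m \<in> carrier G \<rightarrow>\<^sub>E UNIV" "\<phi> \<in> carrier G \<rightarrow>\<^sub>E UNIV"
      using carrier_direct_sum_extensional[OF M x] carrier_direct_sum_extensional[OF N x]
        homogeneous_parts_subset[OF graded_module_direct_sum[OF M] im p]
        homogeneous_parts_subset[OF graded_module_direct_sum[OF N] \<phi>(1) p] by blast+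
    \<comment> \<open>\<open>?i p m\<close> and \<open>\<phi>\<close> come from different direct
      sums; they are comparable because \<open>e\<close> is injective on all families and not just
      on the carrier of one sum.\<close>
    have ie: "inj_on e (carrier G \<rightarrow>\<^sub>E UNIV)" using e x by blast
    have "?i p m = \<phi>" by (rule inj_onD[OF ie, OF \<phi>(2) sub])
    moreover have "?j p (e \<phi>) = \<phi>" by (rule bij_betw_inv_into_left[OF bij_betw_code_parts[OF N p] \<phi>(1)])
    moreover have "?i p m (inv\<^bsub>G\<^esub> snd p) = m"
      by (rule bij_betw_inv_into_right[OF bij_betw_direct_sum_parts[OF M p] m])
    ultimately show ?thesis by simp
  qed
  ultimately show ?thesis
    by (subst equivariant_cong[OF M, where \<theta> = "\<lambda>p m. ?j p (e (?i p m)) (inv\<^bsub>G\<^esub> snd p)"]) simp_all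
qed

lemma inj_on_coded_sum: "inj_on coded_sum (obj (module_category k smash))"
proof (rule inj_onI)
  fix M N assume "M \<in> obj (module_category k smash)" "N \<in> obj (module_category k smash)"
    and eq: "coded_sum M = coded_sum N"
  then have M: "left_module k smash M" "extensional_lmod k smash M"
    and N: "left_module k smash N" "extensional_lmod k smash N"
    by (simp_all add: module_category_def)
  have MN: "equivariant k smash M N (\<lambda>_ v. v)" and NM: "equivariant k smash N M (\<lambda>_ v. v)"
    using coded_sum_eq_imp_equivariant M N eq by simp_all
  have "carrier (fib M p) = carrier (fib N p)" if "p \<in> objs smash" for p
    using equivariantD(2)[OF MN that] equivariantD(2)[OF NM that] by blast
  then show "M = N"
    using extensional_lmod_eqI[OF M N _ MN] by (intro lmod.equality) simp_all
qed

end

section \<open>Tables of names\<close>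

definition elements :: "('o \<times> 'g, 'k, 'b, 'm) lmod \<Rightarrow> (('o \<times> 'g) \<times> 'm) set" where
  "elements M = Sigma (objs smash) (\<lambda>p. carrier (fib M p))"

definition homogeneous_sums :: "('o \<times> 'g, 'k, 'b, 'm) lmod \<Rightarrow> ('o \<times> (('o \<times> 'g) \<times> 'm) set) set" where
  "homogeneous_sums M = objs B \<times> Fpow (elements M)"

text \<open>The index set depends only on the smash module, so graded modules with the same
  components have tables over the same set. The homogeneous elements are tagged with object and
  group element because the fibres may overlap.\<close>

definition name_table ::
  "('o, 'g, 'k, 'b, 'm) graded_lmod \<Rightarrow> 'o \<times> (('o \<times> 'g) \<times> 'm) set \<Rightarrow> 'm" where
  "name_table N = (\<lambda>q \<in> homogeneous_sums (smash_module N). finsum (fib N (fst q)) snd (snd q))"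

text \<open>A graded module with given homogeneous parts is determined by the names in \<open>'m\<close> of its
  non-homogeneous elements. By this estimate these names can be recorded in a family of elements of
  \<open>'m\<close> indexed by the homogeneous elements.\<close>

lemma name_tables_lepoll:
  fixes M :: "('o \<times> 'g, 'k, 'b, 'm) lmod"
  assumes M: "left_module k smash M" and U: "infinite (UNIV :: 'm set)"
  shows "(homogeneous_sums M \<rightarrow>\<^sub>E (UNIV :: 'm set)) \<lesssim> (elements M \<rightarrow>\<^sub>E (UNIV :: 'm set))"
proof -
  \<comment> \<open>The zeros of the fibres at the unit of \<open>G\<close> provide one element per
    object, so objects are no more numerous than elements.\<close>
  have zero: "((x, \<one>\<^bsub>G\<^esub>), \<zero>\<^bsub>fib M (x, \<one>\<^bsub>G\<^esub>)\<^esub>) \<in> elements M" if x: "x \<in> objs B" for x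
  proof -
    interpret M1: module k "fib M (x, \<one>\<^bsub>G\<^esub>)" by (rule left_moduleD(1)[OF M]) (use x in simp)
    show ?thesis using x by (simp add: elements_def)
  qed
  have "inj_on (\<lambda>x. ((x, \<one>\<^bsub>G\<^esub>), \<zero>\<^bsub>fib M (x, \<one>\<^bsub>G\<^esub>)\<^esub>)) (objs B)" by (rule inj_onI) simp
  then have objs: "objs B \<lesssim> elements M" using zero unfolding lepoll_def by blast
  show ?thesis
  proof (cases "finite (elements M)")
    \<comment> \<open>An infinite set has as many finite subsets as elements, and its square is no
      larger.\<close>
    case False
    then have "homogeneous_sums M \<lesssim> elements M \<times> elements M"
      unfolding homogeneous_sums_def
      by (intro times_lepoll_mono objs eqpoll_imp_lepoll eqpoll_Fpow)
    then have "homogeneous_sums M \<lesssim> elements M"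
      using infinite_times_lepoll[OF False] by (rule lepoll_trans)
    then show ?thesis by (intro lepoll_funcset_left) simp
  next
    \<comment> \<open>Now the index set is finite: a table is a finite tuple of names, which an
      infinite universe codes by a single name, and one homogeneous element suffices to carry that
      name.\<close>
    case True
    have "finite (objs B)" using objs True unfolding lepoll_iff by (blast intro: finite_surj)
    then have fin: "finite (homogeneous_sums M)"
      unfolding homogeneous_sums_def Fpow_def using True by simp
    show ?thesis
    proof (cases "objs B = {}")
      \<comment> \<open>Without objects both index sets are empty.\<close>
      case True
      then show ?thesis by (simp add: homogeneous_sums_def elements_def lepoll_iff_card_le)
    next
      case False
      then obtain a where "a \<in> elements M" using zero by blast
      then have "{a} \<lesssim> elements M" by (intro subset_imp_lepoll) simp
      then have "({a} \<rightarrow>\<^sub>E (UNIV :: 'm set)) \<lesssim> (elements M \<rightarrow>\<^sub>E (UNIV :: 'm set))"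
        by (intro lepoll_funcset_left) simp_all
      then have "(UNIV :: 'm set) \<lesssim> (elements M \<rightarrow>\<^sub>E (UNIV :: 'm set))"
        by (rule lepoll_trans1[OF eqpoll_sym[OF PiE_sing_eqpoll_self]])
      with finite_funcset_lepoll[OF fin U] show ?thesis by (rule lepoll_trans)
    qed
  qed
qed

text \<open>Shows that every element of a fibre has its name in the table: its nonzero components,
  tagged with their degrees, form a finite set with the right sum.\<close>

lemma homogeneous_sum_exhaust:
  assumes N: "graded_module k G B N" and x: "x \<in> objs B" and v: "v \<in> carrier (fib N x)"
  obtains Y where "(x, Y) \<in> homogeneous_sums (smash_module N)" "v = finsum (fib N x) snd Y"
    "\<And>y. y \<in> Y \<Longrightarrow> \<exists>s \<in> carrier G. snd y \<in> deg N x s"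
proof -
  note Nd = graded_moduleD[OF N]
  have Nx: "module k (fib N x)" by (rule left_moduleD(1)[OF Nd(1) x])
  interpret Nx: module k "fib N x" by (rule Nx)
  obtain \<pi> where \<pi>: "projections k (fib N x) (carrier G) (deg N x) \<pi>"
    using internal_direct_sum_imp_projections[OF Nx Nd(2)[OF x]] .
  let ?S = "{s \<in> carrier G. \<pi> s v \<noteq> \<zero>\<^bsub>fib N x\<^esub>}"
  \<comment> \<open>The tag keeps summands of different degrees apart, so that the sum over degrees
    can be reindexed as a sum over a set.\<close>
  let ?h = "\<lambda>s. ((x, inv\<^bsub>G\<^esub> s), \<pi> s v)"
  have d: "\<pi> s v \<in> deg N x s" if "s \<in> carrier G" for s
    using \<pi> v that by (simp add: projections_def)
  then have c: "\<pi> s v \<in> carrier (fib N x)" if "s \<in> carrier G" for s using Nd(4)[OF x that] that by blast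
  have fin: "finite ?S" using \<pi> v by (simp add: projections_def)
  have inj: "inj_on ?h ?S" by (rule inj_onI) (simp add: G.inv_inj[THEN inj_onD])
  have "v = finsum (fib N x) (\<lambda>s. \<pi> s v) ?S"
    using fin by (intro projections_finsum[OF Nx \<pi> v]) auto
  also have "\<dots> = finsum (fib N x) (\<lambda>s. snd (?h s)) ?S" by simp
  also have "\<dots> = finsum (fib N x) snd (?h ` ?S)"
    by (rule Nx.M.finsum_reindex[symmetric, OF _ inj]) (use c in auto)
  finally have "v = finsum (fib N x) snd (?h ` ?S)" .
  moreover have "(x, ?h ` ?S) \<in> homogeneous_sums (smash_module N)"
    using x d fin by (auto simp: homogeneous_sums_def elements_def Fpow_def)
  ultimately show ?thesis using that d by fastforce
qed

text \<open>A linear map fixing homogeneous elements sends a sum formed in \<open>N\<close> to the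
  sum of the same elements formed in \<open>P\<close>. Equal tables give both sums the same name, so
  nothing is renamed.\<close>

lemma name_table_inj:
  assumes N: "N \<in> obj (graded_module_category k G B)" and P: "P \<in> obj (graded_module_category k G B)"
    and eq: "smash_module N = smash_module P" and names: "name_table N = name_table P"
  shows "N = P"
proof (rule graded_lmod_eqI[OF N P eq])
  fix x \<eta> v
  assume x: "x \<in> objs B" and \<eta>: "linear_map k (fib N x) (fib P x) \<eta>"
    and fixed: "\<And>s w. \<lbrakk>s \<in> carrier G; w \<in> deg N x s\<rbrakk> \<Longrightarrow> \<eta> w = w" and v: "v \<in> carrier (fib N x)"
  have Ng: "graded_module k G B N" and Pg: "graded_module k G B P"
    using N P by (simp_all add: graded_module_category_def)
  have Nx: "module k (fib N x)" and Px: "module k (fib P x)"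
    using left_moduleD(1)[OF graded_moduleD(1)[OF Ng] x] left_moduleD(1)[OF graded_moduleD(1)[OF Pg] x] .
  interpret Px: module k "fib P x" by (rule Px)
  obtain Y where Y: "(x, Y) \<in> homogeneous_sums (smash_module N)" "v = finsum (fib N x) snd Y"
    and hom: "\<And>y. y \<in> Y \<Longrightarrow> \<exists>s \<in> carrier G. snd y \<in> deg N x s"
    using homogeneous_sum_exhaust[OF Ng x v] by blast
  have fin: "finite Y" using Y(1) by (simp add: homogeneous_sums_def Fpow_def)
  have c: "snd \<in> Y \<rightarrow> carrier (fib N x)" using hom graded_moduleD(4)[OF Ng x] by blast
  have \<eta>y: "\<eta> (snd y) = snd y" if "y \<in> Y" for y using hom[OF that] fixed by blast
  have "\<eta> v = finsum (fib P x) (\<lambda>y. \<eta> (snd y)) Y"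
    unfolding Y(2) by (rule linear_map_finsum[OF Nx Px \<eta> fin c])
  also have "\<dots> = finsum (fib P x) snd Y"
  proof (rule Px.M.finsum_cong')
    have "snd y \<in> carrier (fib P x)" if "y \<in> Y" for y
      using linear_mapD(1)[OF \<eta>, of "snd y"] c \<eta>y[OF that] that by auto
    then show "snd \<in> Y \<rightarrow> carrier (fib P x)" by blast
  qed (simp_all add: \<eta>y)
  also have "\<dots> = name_table P (x, Y)" using Y(1) eq by (simp add: name_table_def)
  also have "\<dots> = v" using Y names[symmetric] by (simp add: name_table_def)
  finally show "\<eta> v = v" .
qed

text \<open>If \<open>G\<close> is trivial, all elements have degree one. Otherwise an object makes
  \<open>objs B \<times> carrier G\<close> have two members, so pairs of names embed into names, and
  a finite universe with this property has at most one element.\<close>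

lemma smash_module_inj_of_finite:
  fixes N P :: "('o, 'g, 'k, 'b, 'm) graded_lmod"
  assumes U: "finite (UNIV :: 'm set)"
    and cl: "closed_under_families (objs B \<times> carrier G) TYPE('m)"
    and N: "N \<in> obj (graded_module_category k G B)" and P: "P \<in> obj (graded_module_category k G B)"
    and eq: "smash_module N = smash_module P"
  shows "N = P"
proof (rule graded_lmod_eqI[OF N P eq])
  fix x \<eta> v
  assume x: "x \<in> objs B" and \<eta>: "linear_map k (fib N x) (fib P x) \<eta>"
    and fixed: "\<And>s w. \<lbrakk>s \<in> carrier G; w \<in> deg N x s\<rbrakk> \<Longrightarrow> \<eta> w = w" and v: "v \<in> carrier (fib N x)"
  have Ng: "graded_module k G B N" using N by (simp add: graded_module_category_def)
  note Nd = graded_moduleD[OF Ng]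
  show "\<eta> v = v"
  proof (cases "carrier G = {\<one>\<^bsub>G\<^esub>}")
    case True
    have Nx: "module k (fib N x)" by (rule left_moduleD(1)[OF Nd(1) x])
    interpret Nx: module k "fib N x" by (rule Nx)
    from Nx Nd(2)[OF x] v have "v \<in> deg N x \<one>\<^bsub>G\<^esub>"
    proof (induction v rule: internal_direct_sum_induct)
      case zero
      then show ?case using submoduleD(2)[OF Nd(3)[OF x G.one_closed]] .
    next
      case (add v w)
      then show ?case using submoduleD(3)[OF Nd(3)[OF x G.one_closed]] by blast
    next
      case (homogeneous s v)
      then show ?case using True by simp
    qed
    then show ?thesis by (rule fixed[OF G.one_closed])
  next
    case False
    then obtain s where s: "s \<in> carrier G" "s \<noteq> \<one>\<^bsub>G\<^esub>" by blast
    \<comment> \<open>A pair is stored as a family with value \<open>a\<close> in degree one and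
      \<open>b\<close> in all other degrees; the degree \<open>s\<close> is where \<open>b\<close>
      is read back.\<close>
    let ?f = "\<lambda>(a :: 'm, b). \<lambda>p \<in> objs B \<times> carrier G. if snd p = \<one>\<^bsub>G\<^esub> then a else b"
    have "inj ?f"
    proof (rule injI, clarify)
      fix a b c d :: 'm
      assume "(\<lambda>p \<in> objs B \<times> carrier G. if snd p = \<one>\<^bsub>G\<^esub> then a else b)
        = (\<lambda>p \<in> objs B \<times> carrier G. if snd p = \<one>\<^bsub>G\<^esub> then c else d)"
      from fun_cong[OF this, of "(x, \<one>\<^bsub>G\<^esub>)"] fun_cong[OF this, of "(x, s)"]
      show "a = c \<and> b = d" using x s by simp
    qed
    moreover have "range ?f \<subseteq> (objs B \<times> carrier G \<rightarrow>\<^sub>E (UNIV :: 'm set))"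
      unfolding split_beta by (rule image_subsetI, subst restrict_PiE_iff) blast
    ultimately have "(UNIV :: ('m \<times> 'm) set) \<lesssim> (objs B \<times> carrier G \<rightarrow>\<^sub>E (UNIV :: 'm set))"
      unfolding lepoll_def by blast
    then have "(UNIV :: 'm set) \<times> (UNIV :: 'm set) \<lesssim> (UNIV :: 'm set)"
      using cl unfolding closed_under_families_def by (simp add: lepoll_trans)
    then have "card ((UNIV :: 'm set) \<times> (UNIV :: 'm set)) \<le> card (UNIV :: 'm set)"
      by (simp only: lepoll_iff_card_le[OF finite_cartesian_product[OF U U] U])
    then have "card (UNIV :: 'm set) * card (UNIV :: 'm set) \<le> card (UNIV :: 'm set)"
      by (simp only: card_cartesian_product)
    then have "card (UNIV :: 'm set) \<le> Suc 0" using U by (cases "card (UNIV :: 'm set)") auto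
    then have "(a :: 'm) = b" for a b
      using card_le_Suc0_iff_eq[OF U] by simp
    then show ?thesis .
  qed
qed

text \<open>\<open>smash_module\<close> forgets the names of elements of mixed degree. In an
  infinite universe each homogeneous \<open>v\<close> is therefore renamed to the code of a pair,
  \<open>v\<close> and one entry of the coded table: the first entries recover the smash module, the
  second ones the table. Renaming stays within the isomorphism class.\<close>

lemma injective_representatives:
  assumes cl: "closed_under_families (objs B \<times> carrier G) TYPE('m)"
  obtains J where
    "inj_on J (obj (graded_module_category k G B :: (('o, 'g, 'k, 'b, 'm) graded_lmod, 'o \<Rightarrow> 'm \<Rightarrow> 'm) cat))"
    "\<And>N. N \<in> obj (graded_module_category k G B) \<Longrightarrow> J N \<in> obj (module_category k smash)"
    "\<And>N. N \<in> obj (graded_module_category k G B)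
      \<Longrightarrow> isomorphic_in (module_category k smash) (smash_module N) (J N)"
proof (cases "finite (UNIV :: 'm set)")
  case True
  show ?thesis
  proof (rule that[of smash_module])
    show "inj_on smash_module (obj (graded_module_category k G B ::
        (('o, 'g, 'k, 'b, 'm) graded_lmod, 'o \<Rightarrow> 'm \<Rightarrow> 'm) cat))"
      using smash_module_inj_of_finite[OF True cl] by (intro inj_onI) blast
    fix N assume N: "N \<in> obj (graded_module_category k G B ::
        (('o, 'g, 'k, 'b, 'm) graded_lmod, 'o \<Rightarrow> 'm \<Rightarrow> 'm) cat)"
    then have l: "left_module k smash (smash_module N)"
      by (intro left_module_smash_module) (simp add: graded_module_category_def)
    then show "smash_module N \<in> obj (module_category k smash)"
      by (simp add: module_category_def extensional_lmod_smash_module)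
    show "isomorphic_in (module_category k smash) (smash_module N) (smash_module N)"
      by (rule isomorphic_in_module_category(1)[OF l l equivariant_id[OF l]]) (simp add: bij_betw_def)
  qed
next
  case False
  obtain pr :: "'m \<times> 'm \<Rightarrow> 'm" where pr: "inj pr"
    using infinite_times_lepoll[OF False] by (auto simp: lepoll_def)
  \<comment> \<open>The code is chosen for the smash module alone, so graded modules with equal
    smash modules have their tables coded in the same way.\<close>
  have "\<forall>M :: ('o \<times> 'g, 'k, 'b, 'm) lmod. \<exists>c. left_module k smash M \<longrightarrow>
      inj_on c (homogeneous_sums M \<rightarrow>\<^sub>E (UNIV :: 'm set)) \<and>
      c ` (homogeneous_sums M \<rightarrow>\<^sub>E UNIV) \<subseteq> elements M \<rightarrow>\<^sub>E (UNIV :: 'm set)"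
    using name_tables_lepoll[OF _ False] unfolding lepoll_def by blast
  then obtain c :: "('o \<times> 'g, 'k, 'b, 'm) lmod \<Rightarrow> ('o \<times> (('o \<times> 'g) \<times> 'm) set \<Rightarrow> 'm) \<Rightarrow> ('o \<times> 'g) \<times> 'm \<Rightarrow> 'm"
    where c: "\<And>M. left_module k smash M \<Longrightarrow> inj_on (c M) (homogeneous_sums M \<rightarrow>\<^sub>E UNIV)"
      "\<And>M. left_module k smash M \<Longrightarrow> c M ` (homogeneous_sums M \<rightarrow>\<^sub>E UNIV) \<subseteq> elements M \<rightarrow>\<^sub>E UNIV"
    by metis
  define label where "label N p v = pr (v, c (smash_module N) (name_table N) (p, v))" for N p v
  define J where "J N = transport k smash (label N) (smash_module N)" for N
  \<comment> \<open>Decoding the first entry of the pair works for every \<open>N\<close> at once,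
    as needed to compare two labellings.\<close>
  define r where "r p u = fst (inv_into UNIV pr u)" for p :: "'o \<times> 'g" and u
  have rl: "r p (label N p v) = v" for N p v by (simp add: r_def label_def inv_f_f[OF pr])
  have inj: "inj_on (label N p) A" for N p A by (rule inj_on_inverseI[of _ "r p"]) (rule rl)
  have t: "name_table N \<in> homogeneous_sums (smash_module N) \<rightarrow>\<^sub>E UNIV"
    for N :: "('o, 'g, 'k, 'b, 'm) graded_lmod"
    by (simp add: name_table_def)
  show ?thesis
  proof (rule that[of J])
    show "inj_on J (obj (graded_module_category k G B ::
        (('o, 'g, 'k, 'b, 'm) graded_lmod, 'o \<Rightarrow> 'm \<Rightarrow> 'm) cat))"
    proof (rule inj_onI)
      fix N P assume N: "N \<in> obj (graded_module_category k G B ::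
          (('o, 'g, 'k, 'b, 'm) graded_lmod, 'o \<Rightarrow> 'm \<Rightarrow> 'm) cat)"
        and P: "P \<in> obj (graded_module_category k G B ::
          (('o, 'g, 'k, 'b, 'm) graded_lmod, 'o \<Rightarrow> 'm \<Rightarrow> 'm) cat)"
        and eq: "J N = J P"
      have l: "left_module k smash (smash_module N)" "left_module k smash (smash_module P)"
        using N P by (simp_all add: left_module_smash_module graded_module_category_def)
      note * = transport_eq_imp_eq[OF category_over_smash l(1) extensional_lmod_smash_module
          l(2) extensional_lmod_smash_module, of r "label N" "label P", OF rl rl eq[unfolded J_def]]
      have sm: "smash_module N = smash_module P" using *(1,2) by (intro lmod.equality) simp_all
      have "c (smash_module N) (name_table N) = c (smash_module N) (name_table P)"
      proof (rule PiE_ext)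
        show "c (smash_module N) (name_table N) \<in> elements (smash_module N) \<rightarrow>\<^sub>E UNIV"
          "c (smash_module N) (name_table P) \<in> elements (smash_module N) \<rightarrow>\<^sub>E UNIV"
          using c(2)[OF l(1)] t[of N] t[of P] sm by auto
        fix z assume z: "z \<in> elements (smash_module N)"
        then have "label N (fst z) (snd z) = label P (fst z) (snd z)"
          by (intro *(3)) (auto simp: elements_def)
        then show "c (smash_module N) (name_table N) z = c (smash_module N) (name_table P) z"
          using injD[OF pr] sm by (simp add: label_def) (metis prod.inject)
      qed
      then have "name_table N = name_table P"
        using inj_onD[OF c(1)[OF l(1)]] t[of N] t[of P] sm by simp
      then show "N = P" by (rule name_table_inj[OF N P sm])
    qed
    fix N assume N: "N \<in> obj (graded_module_category k G B ::
        (('o, 'g, 'k, 'b, 'm) graded_lmod, 'o \<Rightarrow> 'm \<Rightarrow> 'm) cat)"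
    then have l: "left_module k smash (smash_module N)"
      by (intro left_module_smash_module) (simp add: graded_module_category_def)
    show "J N \<in> obj (module_category k smash)"
      using left_module_transport[OF category_over_smash l inj] extensional_lmod_transport
      by (simp add: J_def module_category_def)
    show "isomorphic_in (module_category k smash) (smash_module N) (J N)"
      unfolding J_def by (rule isomorphic_in_transport[OF category_over_smash l inj])
  qed
qed

end

theorem theorem4p5:
  fixes k :: "('k, 'r) ring_scheme"
    and G :: "('g, 'h) monoid_scheme"
    and B :: "('o, 'g, 'k, 'b) graded_kcat"
  assumes "cring k"
    and "group G"
    and "graded_category_over k G B"
    and "closed_under_families (objs B \<times> carrier G) TYPE('m)"
  shows "isomorphic_categories
           (graded_module_category k G B :: (('o, 'g, 'k, 'b, 'm) graded_lmod, 'o \<Rightarrow> 'm \<Rightarrow> 'm) cat)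
           (module_category k (smash_product G B) ::
              (('o \<times> 'g, 'k, 'b, 'm) lmod, 'o \<times> 'g \<Rightarrow> 'm \<Rightarrow> 'm) cat)"
proof -
  interpret graded_category k G B by (rule graded_category.intro) fact+
  let ?A = "graded_module_category k G B :: (('o, 'g, 'k, 'b, 'm) graded_lmod, 'o \<Rightarrow> 'm \<Rightarrow> 'm) cat"
  let ?C = "module_category k smash :: (('o \<times> 'g, 'k, 'b, 'm) lmod, 'o \<times> 'g \<Rightarrow> 'm \<Rightarrow> 'm) cat"
  \<comment> \<open>One code serves all modules over the smash product, so that equal coded sums can
    be decoded alike.\<close>
  obtain e :: "('g \<Rightarrow> 'm) \<Rightarrow> 'm" where e: "objs B \<noteq> {} \<Longrightarrow> inj_on e (carrier G \<rightarrow>\<^sub>E UNIV)"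
    using closed_under_families_code[OF assms(4)] by blast
  obtain J where J: "inj_on J (obj ?A)" "\<And>N. N \<in> obj ?A \<Longrightarrow> J N \<in> obj ?C"
    "\<And>N. N \<in> obj ?A \<Longrightarrow> isomorphic_in ?C (smash_module N) (J N)"
    using injective_representatives[OF assms(4)] by blast
  show ?thesis
  proof (rule isomorphic_categoriesI_injections[OF category_graded_module_category
        category_module_category is_functor_smash])
    show "bij_betw (smash_map N) (arr ?A N P) (arr ?C (smash_module N) (smash_module P))"
      if "N \<in> obj ?A" "P \<in> obj ?A" for N P
      using bij_betw_smash_map[of N P] that by (simp add: graded_module_category_def module_category_def)
    show "inj_on J (obj ?A)" "J ` obj ?A \<subseteq> obj ?C" using J by auto
    show "isomorphic_in ?C (smash_module N) (J N)" if "N \<in> obj ?A" for N by (rule J(3)[OF that])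
    show "inj_on (coded_sum e) (obj ?C)" by (rule inj_on_coded_sum[OF e])
    show "coded_sum e ` obj ?C \<subseteq> obj ?A"
      using coded_sum_object[OF e] by (auto simp: module_category_def)
    show "isomorphic_in ?C (smash_module (coded_sum e M)) M" if "M \<in> obj ?C" for M
      using that isomorphic_in_coded_sum[OF e] by (simp add: module_category_def)
  qed
qed

end
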